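(* Let $g\notin\{-1,0,1\}$ be rational, written as $g=\pm g_0^h$ with $g_0>0$ rational not an exact power of a rational and $h\ge1$ an integer, and let $f,n$ be positive integers. Then $$\mathbb{Q}(\zeta_f)\cap K_{n,n}=\mathbb{Q}\big(\zeta_{(f,n)},\sqrt{\gamma_g(f,n)}\big),$$ unless we are in the exceptional case, in which case $$\mathbb{Q}(\zeta_f)\cap K_{n,n}=\mathbb{Q}\big(\zeta_{(f,n)},\zeta_{2(f,n)}\sqrt{\gamma_g(f,n)}\big).$$
   Context: All fields are subfields of $\mathbb{C}$; $\zeta_m=e^{2\pi i/m}$, and $K_{n,n}=\mathbb{Q}(\zeta_n,g^{1/n})$ (the splitting field of $x^n-g$). For a nonzero rational $g_1$, $D(g_1)$ is the discriminant of $\mathbb{Q}(\sqrt{g_1})$; a fundamental discriminant is an integer of the form $D(g_1)$. For a fundamental discriminant $D$ (with $f,n$ fixed): let $f_{\rm odd}$ be the largest odd divisor of $f$, $b=D/(f,D)$, and $\gamma(D)=(-1)^{((f_{\rm odd},D)-1)/2}(f_{\rm odd},D)$ if $\nu_2(f)<\nu_2(D)$, and $\gamma(D)=(-1)^{(b-1)/2}(f,D)$ otherwise; $\gamma_0(D)=\gamma(D)$ if $D\nmid n$ and $D\mid[f,n]$, and $\gamma_0(D)=1$ otherwise; $\gamma_1(D)=\gamma(D)$ if $\nu_2(f)>\nu_2(n)$ and $D\mid[f,n]$, and $\gamma_1(D)=1$ otherwise. Seven cases (exactly one applies): (1) $g>0$, $\nu_2(n)\le\nu_2(h)$; (2) $g>0$,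 $\nu_2(n)\ge\nu_2(h)+1$; (3) $g<0$, $\nu_2(n)\ge\nu_2(h)+2$; (4) $g<0$, $\nu_2(n)=1$, $\nu_2(h)=0$; (5) $g<0$, $\nu_2(h)=1$, $\nu_2(n)=2$, $8\mid D(g_0)$; (6) $g<0$, $\nu_2(n)\le\nu_2(h)$; (7) $g<0$, $\nu_2(n)=\nu_2(h)+1$ and none of (1)–(6) applies. Define $\gamma_g(f,n)$ to be: $1$ in case (1); $\gamma_0(D(g_0))$ in cases (2) and (3); $\gamma_0(D(-g_0))$ in case (4); $\gamma_0(D(2g_0))$ in case (5); $1$ in case (6); $\gamma_1(D(g_0))$ in case (7). We are in the exceptional case if $\nu_2(f)>\nu_2(n)\ge1$ and either case (6) applies, or case (7) applies and $D(g_0)\mid[f,n]$. *)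

theory Defs
  imports
    "HOL-Analysis.Complex_Transcendental"
    "HOL-Algebra.Generated_Fields"
    "HOL-Algebra.Algebraic_Closure_Type"
    "Jordan_Normal_Form.Determinant"
begin

section \<open>Subfields of the complex numbers\<close>

abbreviation CC :: "complex ring" where
  "CC \<equiv> ring_of_type_algebra"

text \<open>\<open>adjoin S\<close> is the field \<open>\<rat>(S)\<close>: the subfield of the complex numbers generated by \<open>S\<close>.\<close>

definition adjoin :: "complex set \<Rightarrow> complex set" where
  "adjoin S = generate_field CC S"

definition zeta :: "nat \<Rightarrow> complex" where
  "zeta m = exp (2 * of_real pi * \<i> / of_nat m)"

text \<open>The complex power below is the principal \<open>n\<close>-th root of \<open>g\<close> (also for \<open>g < 0\<close>); since
  \<open>zeta n\<close> is adjoined as well, any other \<open>n\<close>-th root of \<open>g\<close> gives the same field.\<close>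

definition kummer_field :: "rat \<Rightarrow> nat \<Rightarrow> complex set" where
  "kummer_field g n = adjoin {zeta n, of_rat g powr (1 / of_nat n)}"


section \<open>Discriminants\<close>

text \<open>The discriminant of a number field \<open>F\<close> is \<open>det (\<sigma>\<^sub>i(\<omega>\<^sub>j))\<^sup>2\<close>, where the \<open>\<omega>\<^sub>j\<close> form a
  \<open>\<int>\<close>-basis of the ring of integers and the \<open>\<sigma>\<^sub>i\<close> are all the embeddings of \<open>F\<close> into the complex
  numbers. Embeddings are extensional, so that each one is represented by exactly one HOL function.\<close>

definition ring_of_integers :: "complex set \<Rightarrow> complex set" where
  "ring_of_integers F = {x \<in> F. algebraic_int x}"

definition integral_basis :: "complex set \<Rightarrow> nat \<Rightarrow> (nat \<Rightarrow> complex) \<Rightarrow> bool" where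
  "integral_basis F k \<omega> \<longleftrightarrow>
     (\<forall>j<k. \<omega> j \<in> ring_of_integers F) \<and>
     (\<forall>x\<in>ring_of_integers F.
        \<exists>!c :: nat \<Rightarrow> int. c \<in> extensional {..<k} \<and> x = (\<Sum>j<k. of_int (c j) * \<omega> j))"

definition embeddings :: "complex set \<Rightarrow> (complex \<Rightarrow> complex) set" where
  "embeddings F = Ring.ring_hom (CC\<lparr>carrier := F\<rparr>) CC \<inter> extensional F"

definition field_discriminant :: "complex set \<Rightarrow> int" where
  "field_discriminant F = (THE d. \<exists>k \<omega> \<sigma>. integral_basis F k \<omega> \<and>
     bij_betw \<sigma> {..<k} (embeddings F) \<and>
     of_int d = (Determinant.det (mat k k (\<lambda>(i, j). \<sigma> i (\<omega> j))))\<^sup>2)"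

text \<open>If \<open>q\<close> is a rational square, this is the discriminant of the rational numbers, i.e. \<open>1\<close>.\<close>

definition quad_disc :: "rat \<Rightarrow> int" where
  "quad_disc q = field_discriminant (adjoin {csqrt (of_rat q)})"


section \<open>The numbers \<open>\<gamma>\<close>\<close>

abbreviation nu2 :: "'a::factorial_semiring \<Rightarrow> nat" where
  "nu2 x \<equiv> multiplicity 2 x"

text \<open>\<open>(-1)\<^sup>k\<close> for an integer \<open>k\<close> that may be negative.\<close>

definition neg_one_pow :: "int \<Rightarrow> int" where
  "neg_one_pow k = (if even k then 1 else -1)"

definition odd_part :: "nat \<Rightarrow> nat" where
  "odd_part f = Max {d. odd d \<and> d dvd f}"

text \<open>\<open>D\<close> may be negative; \<open>gcd\<close> is always nonnegative, so \<open>D div gcd (int f) D\<close> has the sign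
  of \<open>D\<close>. Both divisions by \<open>2\<close> are exact where they are used.\<close>

definition gam :: "nat \<Rightarrow> int \<Rightarrow> int" where
  "gam f D =
     (if nu2 f < nu2 D
      then neg_one_pow ((gcd (int (odd_part f)) D - 1) div 2) * gcd (int (odd_part f)) D
      else neg_one_pow ((D div gcd (int f) D - 1) div 2) * gcd (int f) D)"

definition gam0 :: "nat \<Rightarrow> nat \<Rightarrow> int \<Rightarrow> int" where
  "gam0 f n D = (if \<not> D dvd int n \<and> D dvd int (lcm f n) then gam f D else 1)"

definition gam1 :: "nat \<Rightarrow> nat \<Rightarrow> int \<Rightarrow> int" where
  "gam1 f n D = (if nu2 f > nu2 n \<and> D dvd int (lcm f n) then gam f D else 1)"

text \<open>The number of the case that applies. The conditions of cases 1 to 6 are mutually exclusive,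
  so their order is irrelevant; \<open>g = 0\<close> is mapped to the dummy value \<open>0\<close>.\<close>

definition gcase :: "rat \<Rightarrow> rat \<Rightarrow> nat \<Rightarrow> nat \<Rightarrow> nat" where
  "gcase g g0 h n =
     (if g > 0 \<and> nu2 n \<le> nu2 h then 1
      else if g > 0 \<and> nu2 n \<ge> nu2 h + 1 then 2
      else if g < 0 \<and> nu2 n \<ge> nu2 h + 2 then 3
      else if g < 0 \<and> nu2 n = 1 \<and> nu2 h = 0 then 4
      else if g < 0 \<and> nu2 h = 1 \<and> nu2 n = 2 \<and> 8 dvd quad_disc g0 then 5
      else if g < 0 \<and> nu2 n \<le> nu2 h then 6
      else if g < 0 \<and> nu2 n = nu2 h + 1 then 7
      else 0)"

definition gam_g :: "rat \<Rightarrow> rat \<Rightarrow> nat \<Rightarrow> nat \<Rightarrow> nat \<Rightarrow> int" where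
  "gam_g g g0 h f n =
     (let c = gcase g g0 h n in
      if c = 2 \<or> c = 3 then gam0 f n (quad_disc g0)
      else if c = 4 then gam0 f n (quad_disc (- g0))
      else if c = 5 then gam0 f n (quad_disc (2 * g0))
      else if c = 7 then gam1 f n (quad_disc g0)
      else 1)"

definition exceptional :: "rat \<Rightarrow> rat \<Rightarrow> nat \<Rightarrow> nat \<Rightarrow> nat \<Rightarrow> bool" where
  "exceptional g g0 h f n \<longleftrightarrow> nu2 f > nu2 n \<and> nu2 n \<ge> 1 \<and>
     (gcase g g0 h n = 6 \<or> gcase g g0 h n = 7 \<and> quad_disc g0 dvd int (lcm f n))"

end

theory Submission
  imports Defs "Berlekamp_Zassenhaus.Factor_Bound" "HOL-Number_Theory.Number_Theory"
begin

text \<open>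
  Let \<open>F = \<rat>(\<zeta>\<^sub>n)\<close>, \<open>N = [f, n]\<close> and \<open>\<alpha> = g\<^bsup>1/n\<^esup>\<close>. By Kummer theory, an element of \<open>F(\<alpha>)\<close> that lies in
  \<open>\<rat>(\<zeta>\<^sub>N)\<close> already lies in \<open>F(\<alpha>\<^sup>s)\<close>, where \<open>\<alpha>\<^sup>s\<close> is the least power of \<open>\<alpha>\<close> in \<open>\<rat>(\<zeta>\<^sub>N)\<close>. The conjugates of
  the positive radical \<open>\<bar>\<alpha>\<^sup>s\<bar>\<close> in a cyclotomic field are real, hence equal to it up to sign, so its
  square is rational; as \<open>g\<^sub>0\<close> is not a perfect power, \<open>n\<close> divides \<open>2hs\<close>. Thus \<open>\<alpha>\<close> may be replaced by
  \<open>\<alpha>\<^sup>k\<close> with \<open>k = n / (n, 2h)\<close>, which up to a factor in \<open>F\<close> is one of \<open>1\<close>, \<open>\<surd>g\<^sub>0\<close>, \<open>\<zeta>\<^sub>2\<^sub>n\<close>, \<open>\<zeta>\<^sub>2\<^sub>n\<surd>g\<^sub>0\<close>.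

  The extension \<open>F(\<beta>)\<close> that remains is at most quadratic. Either \<open>\<beta>\<close> is not in \<open>\<rat>(\<zeta>\<^sub>N)\<close> and the
  intersection is \<open>\<rat>(\<zeta>\<^sub>f) \<inter> F = \<rat>(\<zeta>\<^bsub>(f,n)\<^esub>)\<close>, or \<open>F(\<beta>) = F(\<delta>)\<close> for some \<open>\<delta>\<close> in \<open>\<rat>(\<zeta>\<^sub>f)\<close> and it is
  \<open>\<rat>(\<zeta>\<^bsub>(f,n)\<^esub>, \<delta>)\<close>. To find \<open>\<delta>\<close>, note that \<open>\<surd>D\<close> lies in \<open>\<rat>(\<zeta>\<^sub>N)\<close> iff the discriminant \<open>D\<close> divides \<open>N\<close>,
  and that \<open>D = \<gamma>(D) b\<close> splits into discriminants with \<open>\<gamma>(D)\<close> dividing \<open>f\<close> and \<open>b\<close> dividing \<open>n\<close>.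
\<close>

hide_const (open) Divisibility.prime comm_monoid_mult_class.coprime

section \<open>Subfields and polynomials over them\<close>

text \<open>Two coprime numbers govern the radical that survives the reduction:
  \<open>k = n div gcd n (2 * h)\<close> and \<open>c = (2 * h) div gcd n (2 * h)\<close>. The
  positive radical satisfies \<open>(r ^ k)\<^sup>2 = g0 ^ c\<close>, so an odd \<open>c\<close>
  leaves \<surd>g0; for negative \<open>g\<close> the principal root carries the factor
  \<open>zeta (2 * n)\<close>, and an odd \<open>k\<close> keeps it. Comparing \<open>nu2 n\<close>
  with \<open>nu2 h\<close> decides both parities, which is the origin of the case distinction. For
  even \<open>n\<close> the number \<open>zeta (2 * n)\<close> is a square root of
  \<open>zeta n\<close> outside \<open>cyclotomic n\<close>, whence the exceptional form of the
  answer. For small \<open>nu2 n\<close> it can be traded for a rational radical: up to a factor in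
  \<open>cyclotomic n\<close> it is \<i> if \<open>nu2 n = 1\<close> and \<surd>2 if
  \<open>nu2 n = 2\<close>, which turns \<surd>g0 into \<surd>(-g0) or \<surd>(2 * g0). The latter
  is needed if 8 divides the discriminant of \<surd>g0, because then the product of
  \<open>zeta (2 * n)\<close> and \<surd>g0 may lie in a cyclotomic field that contains neither
  factor. In case 7 this cannot happen and the two factors can be treated separately.\<close>

locale ring_subset =
  fixes E :: "'a::field_char_0 set"
  assumes one_mem [simp, intro]: "1 \<in> E"
    and add_mem [intro]: "x \<in> E \<Longrightarrow> y \<in> E \<Longrightarrow> x + y \<in> E"
    and uminus_mem [intro]: "x \<in> E \<Longrightarrow> - x \<in> E"
    and mult_mem [intro]: "x \<in> E \<Longrightarrow> y \<in> E \<Longrightarrow> x * y \<in> E"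
begin

lemma zero_mem [simp, intro]: "0 \<in> E"
  using add_mem[OF one_mem uminus_mem[OF one_mem]] by simp

lemma diff_mem [intro]: "x \<in> E \<Longrightarrow> y \<in> E \<Longrightarrow> x - y \<in> E"
  using add_mem[OF _ uminus_mem, of x y] by simp

lemma power_mem [intro]: "x \<in> E \<Longrightarrow> x ^ k \<in> E"
  by (induction k) auto

lemma sum_mem [intro]: "(\<And>i. i \<in> I \<Longrightarrow> f i \<in> E) \<Longrightarrow> sum f I \<in> E"
  by (induction I rule: infinite_finite_induct) auto

lemma prod_mem [intro]: "(\<And>i. i \<in> I \<Longrightarrow> f i \<in> E) \<Longrightarrow> prod f I \<in> E"
  by (induction I rule: infinite_finite_induct) auto

lemma of_nat_mem [simp, intro]: "of_nat k \<in> E"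
  by (induction k) auto

lemma of_int_mem [simp, intro]: "of_int k \<in> E"
  by (cases k) auto

lemma uminus_mem_iff: "- x \<in> E \<longleftrightarrow> x \<in> E"
  using uminus_mem[of x] uminus_mem[of "- x"] by auto

lemma square_eq_mem: "x\<^sup>2 = y\<^sup>2 \<Longrightarrow> x \<in> E \<longleftrightarrow> y \<in> E"
  by (auto simp: power2_eq_iff uminus_mem_iff)

end

locale field_subset = ring_subset +
  assumes inverse_mem [intro]: "x \<in> E \<Longrightarrow> inverse x \<in> E"
begin

lemma divide_mem [intro]: "x \<in> E \<Longrightarrow> y \<in> E \<Longrightarrow> x / y \<in> E"
  using mult_mem[OF _ inverse_mem, of x y] by (simp add: divide_inverse)

lemma Rats_subset: "\<rat> \<subseteq> E"
  by (auto elim!: Rats_cases')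

lemma mult_mem_iff: "x \<in> E \<Longrightarrow> x \<noteq> 0 \<Longrightarrow> x * y \<in> E \<longleftrightarrow> y \<in> E"
  using divide_mem[of "x * y" x] by auto

end

text \<open>Coefficients are confined to \<open>E\<close> while the polynomials stay over the
  ambient type, so that one polynomial can be read over \<int>, over \<rat> and over any cyclotomic
  field without coercions.\<close>

definition polys_over :: "'a::zero set \<Rightarrow> 'a poly set" where
  "polys_over E = {p. \<forall>i. coeff p i \<in> E}"

lemma polys_over_mono: "E \<subseteq> E' \<Longrightarrow> polys_over E \<subseteq> polys_over E'"
  by (auto simp: polys_over_def)

text \<open>Minimality is divisibility in the ambient polynomial ring, which passes directly to
  roots. That the quotient has coefficients in a field \<open>E\<close> is recovered in
  \<open>min_poly_quotient\<close>.\<close>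

definition is_min_poly :: "'a::field_char_0 set \<Rightarrow> 'a \<Rightarrow> 'a poly \<Rightarrow> bool" where
  "is_min_poly E x m \<longleftrightarrow> m \<in> polys_over E \<and> lead_coeff m = 1 \<and> poly m x = 0 \<and>
     (\<forall>q\<in>polys_over E. poly q x = 0 \<longrightarrow> m dvd q)"

definition poly_values :: "'a::field_char_0 set \<Rightarrow> 'a \<Rightarrow> 'a set" where
  "poly_values E x = {poly p x |p. p \<in> polys_over E}"

context ring_subset
begin

lemma polys_over_0 [simp, intro]: "0 \<in> polys_over E"
  by (auto simp: polys_over_def)

lemma polys_over_pCons [simp]: "pCons a p \<in> polys_over E \<longleftrightarrow> a \<in> E \<and> p \<in> polys_over E"
  by (auto simp: polys_over_def coeff_pCons split: nat.splits)

lemma polys_over_1 [simp, intro]: "1 \<in> polys_over E"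
  using polys_over_pCons[of 1 0] by (simp del: polys_over_pCons)

lemma polys_over_add [intro]: "p \<in> polys_over E \<Longrightarrow> q \<in> polys_over E \<Longrightarrow> p + q \<in> polys_over E"
  by (auto simp: polys_over_def)

lemma polys_over_uminus [intro]: "p \<in> polys_over E \<Longrightarrow> - p \<in> polys_over E"
  by (auto simp: polys_over_def)

lemma polys_over_diff [intro]: "p \<in> polys_over E \<Longrightarrow> q \<in> polys_over E \<Longrightarrow> p - q \<in> polys_over E"
  by (auto simp: polys_over_def)

lemma polys_over_smult [intro]: "a \<in> E \<Longrightarrow> p \<in> polys_over E \<Longrightarrow> smult a p \<in> polys_over E"
  by (auto simp: polys_over_def)

lemma polys_over_mult [intro]: "p \<in> polys_over E \<Longrightarrow> q \<in> polys_over E \<Longrightarrow> p * q \<in> polys_over E"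
  by (auto simp: polys_over_def coeff_mult)

lemma polys_over_monom [intro]: "a \<in> E \<Longrightarrow> monom a k \<in> polys_over E"
  by (auto simp: polys_over_def)

lemma polys_over_sum [intro]:
  "(\<And>i. i \<in> I \<Longrightarrow> f i \<in> polys_over E) \<Longrightarrow> sum f I \<in> polys_over E"
  by (induction I rule: infinite_finite_induct) auto

lemma polys_over_pcompose [intro]:
  "p \<in> polys_over E \<Longrightarrow> q \<in> polys_over E \<Longrightarrow> pcompose p q \<in> polys_over E"
  by (induction p) (auto simp: pcompose_pCons)

lemma poly_mem: "p \<in> polys_over E \<Longrightarrow> x \<in> E \<Longrightarrow> poly p x \<in> E"
  by (induction p) auto

text \<open>Division by a monic polynomial takes no inverses, so it also works over \<int>. Positive
  degree of \<open>q\<close> makes the strict bound attainable, as the zero polynomial has degree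
  0.\<close>

lemma polys_over_division:
  assumes "p \<in> polys_over E" "q \<in> polys_over E" "lead_coeff q = 1" "degree q > 0"
  shows "\<exists>u\<in>polys_over E. \<exists>r\<in>polys_over E. p = u * q + r \<and> degree r < degree q"
  using assms(1)
proof (induction "degree p" arbitrary: p rule: less_induct)
  case less
  show ?case
  proof (cases "degree p < degree q")
    case True
    with less.prems show ?thesis by (intro bexI[of _ 0] bexI[of _ p]) auto
  next
    case False
    define t where "t = monom (lead_coeff p) (degree p - degree q)"
    define p' where "p' = p - t * q"
    have t: "t \<in> polys_over E"
      using less.prems by (auto simp: t_def polys_over_def)
    then have p': "p' \<in> polys_over E"
      unfolding p'_def by (rule polys_over_diff[OF less.prems polys_over_mult[OF _ assms(2)]])
    have p0: "p \<noteq> 0" using False assms by auto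
    have "lead_coeff p \<noteq> 0" using p0 by simp
    then have "degree t = degree p - degree q" "t \<noteq> 0"
      unfolding t_def by (simp_all only: Polynomial.degree_monom_eq monom_eq_0_iff not_False_eq_True)
    then have "degree (t * q) = degree p"
      using False assms(3,4) by (subst degree_mult_eq) auto
    moreover have "lead_coeff (t * q) = lead_coeff p"
      by (simp only: lead_coeff_mult t_def Polynomial.lead_coeff_monom assms(3) mult_1_right)
    ultimately have "degree p' \<le> degree p" "coeff p' (degree p) = 0"
      by (auto simp: p'_def intro: degree_diff_le)
    moreover have "degree p > 0" using False assms by auto
    ultimately have "degree p' < degree p"
      by (metis degree_0 le_neq_implies_less leading_coeff_0_iff)
    from less.hyps[OF this p'] obtain u r where
      "u \<in> polys_over E" "r \<in> polys_over E" "p' = u * q + r" "degree r < degree q" by blast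
    with t show ?thesis
      by (intro bexI[of _ "u + t"] bexI[of _ r]) (auto simp: p'_def algebra_simps)
  qed
qed

end

section \<open>Minimal polynomials and simple algebraic extensions\<close>

context field_subset
begin

lemma min_poly_degree_pos: "is_min_poly E x m \<Longrightarrow> degree m > 0"
  by (rule Nat.gr0I) (auto simp: is_min_poly_def elim!: degree_eq_zeroE)

lemma min_poly_exists:
  assumes "p \<in> polys_over E" "p \<noteq> 0" "poly p x = 0"
  shows "\<exists>m. is_min_poly E x m"
proof -
  define P where "P = (\<lambda>q. q \<in> polys_over E \<and> q \<noteq> 0 \<and> poly q x = 0)"
  define m' where "m' = arg_min degree P"
  have "P p" using assms by (auto simp: P_def)
  then have m': "P m'" and min: "\<And>q. P q \<Longrightarrow> degree m' \<le> degree q"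
    using arg_min_nat_lemma[of P p degree] by (auto simp: m'_def)
  define m where "m = smult (inverse (lead_coeff m')) m'"
  have deg: "degree m = degree m'" and lc: "lead_coeff m = 1"
    using m' by (auto simp: m_def P_def)
  have m: "m \<in> polys_over E" "poly m x = 0"
    using m' by (auto simp: m_def P_def polys_over_def)
  have "degree m > 0" using m lc by (intro Nat.gr0I) (auto elim!: degree_eq_zeroE)
  have "m dvd q" if q: "q \<in> polys_over E" "poly q x = 0" for q
  proof -
    obtain u r where ur: "u \<in> polys_over E" "r \<in> polys_over E" "q = u * m + r" "degree r < degree m"
      using polys_over_division[OF q(1) m(1) lc \<open>degree m > 0\<close>] by blast
    with q m have "poly r x = 0" by simp
    with ur min[of r] deg have "r = 0" by (auto simp: P_def)
    with ur show ?thesis by simp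
  qed
  with m lc show ?thesis by (auto simp: is_min_poly_def)
qed

lemma min_poly_eq_0:
  assumes "is_min_poly E x m" "q \<in> polys_over E" "poly q x = 0" "degree q < degree m"
  shows "q = 0"
  using assms dvd_imp_degree_le[of m q] by (auto simp: is_min_poly_def)

lemma poly_values_small_degree:
  assumes "is_min_poly E x m" "p \<in> polys_over E"
  shows "\<exists>q\<in>polys_over E. poly q x = poly p x \<and> degree q < degree m"
  using polys_over_division[of p m] assms min_poly_degree_pos[of x m]
  by (auto simp: is_min_poly_def)

text \<open>A Euclidean descent: dividing \<open>m\<close> by \<open>p\<close> leaves a remainder of
  smaller degree whose value at \<open>x\<close> is a multiple of \<open>poly p x\<close>, so
  inverting the former inverts the latter.\<close>

lemma inverse_poly_values:
  assumes "is_min_poly E x m" "p \<in> polys_over E" "poly p x \<noteq> 0"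
  shows "inverse (poly p x) \<in> poly_values E x"
proof -
  have *: "\<exists>r\<in>polys_over E. poly r x * poly p x = 1"
    if "p \<in> polys_over E" "poly p x \<noteq> 0" "degree p < degree m" for p
    using that
  proof (induction "degree p" arbitrary: p rule: less_induct)
    case less
    define a where "a = lead_coeff p"
    have a: "a \<in> E" "a \<noteq> 0" using less.prems by (auto simp: a_def polys_over_def)
    show ?case
    proof (cases "degree p = 0")
      case True
      then have "p = [:a:]" by (auto simp: a_def elim!: degree_eq_zeroE)
      with a show ?thesis by (intro bexI[of _ "[:inverse a:]"]) auto
    next
      case False
      define p1 where "p1 = smult (inverse a) p"
      have p1: "p1 \<in> polys_over E" "lead_coeff p1 = 1" "degree p1 = degree p"
        using less.prems a by (auto simp: p1_def a_def[symmetric])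
      obtain u r where ur: "u \<in> polys_over E" "r \<in> polys_over E" "m = u * p1 + r" "degree r < degree p1"
        using polys_over_division[of m p1] p1 assms(1) False by (auto simp: is_min_poly_def)
      \<comment> \<open>A remainder vanishing at \<open>x\<close> would be zero, and then the
        cofactor \<open>u\<close> would vanish at \<open>x\<close> in degree below
        \<open>degree m\<close>.\<close>
      have rx: "poly r x \<noteq> 0"
      proof
        assume r0: "poly r x = 0"
        with min_poly_eq_0[OF assms(1) ur(2)] ur(4) p1 less.prems have "r = 0" by auto
        with ur have m: "m = u * p1" by simp
        have nz: "m \<noteq> 0" using assms(1) by (auto simp: is_min_poly_def)
        have "poly m x = 0" using assms(1) by (auto simp: is_min_poly_def)
        with m have "poly u x = 0" using less.prems a by (auto simp: p1_def)
        moreover have "degree u < degree m" using m nz p1 False by (auto simp: degree_mult_eq)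
        ultimately have "u = 0" using min_poly_eq_0[OF assms(1) ur(1)] by blast
        with m nz show False by simp
      qed
      obtain t where t: "t \<in> polys_over E" "poly t x * poly r x = 1"
        using less.hyps[of r] ur rx p1 less.prems by auto
      have "poly m x = 0" using assms(1) by (auto simp: is_min_poly_def)
      with ur have "poly r x = - poly u x * inverse a * poly p x"
        by (auto simp: p1_def eq_neg_iff_add_eq_0 algebra_simps)
      with t have "poly (t * smult (- inverse a) u) x * poly p x = 1"
        by (simp add: mult_ac)
      moreover have "t * smult (- inverse a) u \<in> polys_over E" using t ur a by blast
      ultimately show ?thesis by blast
    qed
  qed
  obtain q where q: "q \<in> polys_over E" "poly q x = poly p x" "degree q < degree m"
    using poly_values_small_degree[OF assms(1,2)] by blast
  obtain r where "r \<in> polys_over E" "poly r x * poly q x = 1" using *[of q] q assms by auto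
  with q have "inverse (poly p x) = poly r x" using assms(3) by (simp add: field_simps)
  with \<open>r \<in> polys_over E\<close> show ?thesis by (auto simp: poly_values_def)
qed

lemma field_subset_poly_values:
  assumes "p \<in> polys_over E" "p \<noteq> 0" "poly p x = 0"
  shows "field_subset (poly_values E x)"
proof
  obtain m where m: "is_min_poly E x m" using min_poly_exists assms by blast
  show "1 \<in> poly_values E x" by (auto simp: poly_values_def intro!: exI[of _ 1])
  fix y z assume "y \<in> poly_values E x" "z \<in> poly_values E x"
  then obtain p q where pq: "p \<in> polys_over E" "q \<in> polys_over E" "y = poly p x" "z = poly q x"
    by (auto simp: poly_values_def)
  show "y + z \<in> poly_values E x" using pq by (auto simp: poly_values_def intro!: exI[of _ "p + q"])
  show "y * z \<in> poly_values E x" using pq by (auto simp: poly_values_def intro!: exI[of _ "p * q"])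
  show "- y \<in> poly_values E x" using pq by (auto simp: poly_values_def intro!: exI[of _ "- p"])
  show "inverse y \<in> poly_values E x"
    using inverse_poly_values[OF m pq(1)] pq(3)
    by (cases "y = 0") (auto simp: poly_values_def intro!: exI[of _ 0])
qed

lemma poly_values_subset:
  assumes "field_subset E'" "E \<subseteq> E'" "x \<in> E'"
  shows "poly_values E x \<subseteq> E'"
  using ring_subset.poly_mem[OF field_subset.axioms(1)[OF assms(1)]] polys_over_mono[OF assms(2)] assms(3)
  by (auto simp: poly_values_def)

lemma const_in_poly_values: "E \<subseteq> poly_values E x"
proof
  fix a assume "a \<in> E"
  then show "a \<in> poly_values E x" by (auto simp: poly_values_def intro!: exI[of _ "[:a:]"])
qed

lemma self_in_poly_values: "x \<in> poly_values E x"
  by (auto simp: poly_values_def intro!: exI[of _ "[:0, 1:]"])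

end

lemma field_subset_Rats: "field_subset \<rat>"
  by standard auto

interpretation Rats: field_subset \<rat>
  by (rule field_subset_Rats)

interpretation Ints: ring_subset \<int>
  by standard auto


section \<open>Adjunction\<close>

lemma carrier_CC [simp]: "carrier CC = UNIV"
  and one_CC [simp]: "\<one>\<^bsub>CC\<^esub> = 1"
  and zero_CC [simp]: "\<zero>\<^bsub>CC\<^esub> = 0"
  and add_CC [simp]: "x \<oplus>\<^bsub>CC\<^esub> y = x + y"
  and mult_CC [simp]: "x \<otimes>\<^bsub>CC\<^esub> y = x * y"
  by (simp_all add: ring_of_type_algebra_def)

lemma uminus_CC [simp]: "\<ominus>\<^bsub>CC\<^esub> x = - x"
proof -
  interpret cring CC by (rule cring_from_type_algebra)
  show ?thesis by (rule minus_equality) auto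
qed

lemma inverse_CC [simp]: "x \<noteq> 0 \<Longrightarrow> inv\<^bsub>CC\<^esub> x = inverse x"
  using comm_monoid.comm_inv_char[OF cring.axioms(2)[OF cring_from_type_algebra], of x "inverse x"]
  by simp

lemma field_subset_adjoin: "field_subset (adjoin S)"
proof
  show "1 \<in> adjoin S"
    using generate_field.one[of CC S] by (simp add: adjoin_def)
  fix x y assume xy: "x \<in> adjoin S" "y \<in> adjoin S"
  show "x + y \<in> adjoin S"
    using generate_field.eng_add[of x CC S y] xy by (simp add: adjoin_def)
  show "x * y \<in> adjoin S"
    using generate_field.eng_mult[of x CC S y] xy by (simp add: adjoin_def)
  show "- x \<in> adjoin S"
    using generate_field.a_inv[of x CC S] xy by (simp add: adjoin_def)
  show "inverse x \<in> adjoin S"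
    using generate_field.m_inv[of x CC S] xy by (cases "x = 0") (simp_all add: adjoin_def)
qed

interpretation adjoin: field_subset "adjoin S" for S
  by (rule field_subset_adjoin)

lemma subset_adjoin: "S \<subseteq> adjoin S"
  by (auto simp: adjoin_def intro: generate_field.incl)

lemma in_adjoin: "x \<in> S \<Longrightarrow> x \<in> adjoin S"
  using subset_adjoin by blast

lemma adjoin_least:
  assumes "field_subset E" "S \<subseteq> E"
  shows "adjoin S \<subseteq> E"
proof
  interpret field_subset E by fact
  fix x assume "x \<in> adjoin S"
  then show "x \<in> E" unfolding adjoin_def
    by (induction rule: generate_field.induct) (use assms(2) in auto)
qed

lemma adjoin_subset_iff: "adjoin S \<subseteq> adjoin T \<longleftrightarrow> S \<subseteq> adjoin T"
  using adjoin_least[OF field_subset_adjoin, of S T] subset_adjoin[of S] by blast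

lemma adjoin_eqI: "S \<subseteq> adjoin T \<Longrightarrow> T \<subseteq> adjoin S \<Longrightarrow> adjoin S = adjoin T"
  by (simp add: adjoin_subset_iff subset_antisym)

lemma adjoin_mono: "S \<subseteq> T \<Longrightarrow> adjoin S \<subseteq> adjoin T"
  using subset_adjoin[of T] by (auto simp: adjoin_subset_iff)

lemma adjoin_empty: "adjoin {} = \<rat>"
  using adjoin_least[OF field_subset_Rats, of "{}"] adjoin.Rats_subset by blast

text \<open>The annihilating polynomial is what makes the set of polynomial values closed under
  inverses.\<close>

lemma adjoin_insert:
  assumes "p \<in> polys_over (adjoin S)" "p \<noteq> 0" "poly p x = 0"
  shows "adjoin (insert x S) = poly_values (adjoin S) x"
proof
  show "adjoin (insert x S) \<subseteq> poly_values (adjoin S) x"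
    using adjoin.field_subset_poly_values[OF assms] adjoin.const_in_poly_values[of S x]
      adjoin.self_in_poly_values[of x S] subset_adjoin[of S] by (intro adjoin_least) auto
  show "poly_values (adjoin S) x \<subseteq> adjoin (insert x S)"
    using adjoin_mono[of S "insert x S"] in_adjoin[of x "insert x S"]
    by (intro adjoin.poly_values_subset field_subset_adjoin) auto
qed

lemma adjoin_insert_mem: "x \<in> adjoin S \<Longrightarrow> adjoin (insert x S) = adjoin S"
  using subset_adjoin[of S] subset_adjoin[of "insert x S"] by (intro adjoin_eqI) auto

lemma adjoin_singleton:
  assumes "p \<in> polys_over \<rat>" "p \<noteq> 0" "poly p x = 0"
  shows "adjoin {x} = poly_values \<rat> x"
  using adjoin_insert[of p "{}" x] assms by (simp add: adjoin_empty)

lemma adjoin_insert_square: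
  assumes "x\<^sup>2 \<in> adjoin S"
  shows "adjoin (insert x S) = {u + v * x |u v. u \<in> adjoin S \<and> v \<in> adjoin S}"
proof
  have "\<exists>u\<in>adjoin S. \<exists>v\<in>adjoin S. poly p x = u + v * x" if "p \<in> polys_over (adjoin S)" for p
    using that
  proof (induction p)
    case 0
    show ?case by (intro bexI[of _ 0]) auto
  next
    case (pCons a p)
    then obtain u v where uv: "u \<in> adjoin S" "v \<in> adjoin S" "poly p x = u + v * x" by auto
    then have "poly (pCons a p) x = (a + v * x\<^sup>2) + u * x"
      by (simp add: algebra_simps power2_eq_square)
    with uv pCons.prems assms show ?case by (metis adjoin.add_mem adjoin.mult_mem adjoin.polys_over_pCons)
  qed
  moreover have "adjoin (insert x S) = poly_values (adjoin S) x"
    using assms by (intro adjoin_insert[of "[:- (x\<^sup>2), 0, 1:]"]) (auto simp: power2_eq_square)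
  ultimately show "adjoin (insert x S) \<subseteq> {u + v * x |u v. u \<in> adjoin S \<and> v \<in> adjoin S}"
    unfolding poly_values_def by (smt (verit, best) Collect_mono_iff)
  show "{u + v * x |u v. u \<in> adjoin S \<and> v \<in> adjoin S} \<subseteq> adjoin (insert x S)"
    using adjoin_mono[of S "insert x S"] in_adjoin[of x "insert x S"] by auto
qed


section \<open>Roots of unity\<close>

lemma zeta_power: "zeta n ^ k = exp (2 * of_real pi * \<i> * of_nat k / of_nat n)"
  by (simp add: zeta_def mult.commute flip: exp_of_nat_mult)

lemma zeta_nonzero [simp]: "zeta n \<noteq> 0"
  by (simp add: zeta_def)

lemma zeta_power_self [simp]: "n > 0 \<Longrightarrow> zeta n ^ n = 1"
  by (simp add: zeta_power exp_two_pi_i)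

lemma zeta_power_eq_iff: "n > 0 \<Longrightarrow> zeta n ^ j = zeta n ^ k \<longleftrightarrow> [j = k] (mod n)"
  unfolding zeta_power cong_def by (rule complex_root_unity_eq) simp

lemma zeta_1 [simp]: "zeta (Suc 0) = 1" "zeta 1 = 1"
  using zeta_power_self[of 1] by simp_all

lemma zeta_2 [simp]: "zeta 2 = -1"
  by (simp add: zeta_def exp_pi_i' mult.commute)

lemma zeta_4 [simp]: "zeta 4 = \<i>"
  by (simp add: zeta_def exp_eq_polar cis_conv_exp[symmetric] flip: cis_pi_half)

lemma zeta_power_div: "d dvd N \<Longrightarrow> N > 0 \<Longrightarrow> zeta N ^ (N div d) = zeta d"
  unfolding zeta_power by (auto simp: zeta_def elim!: dvdE)

lemma root_of_unity_zeta:
  assumes "z ^ n = 1" "n > 0"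
  obtains j where "z = zeta n ^ j"
proof -
  have "z \<in> {z. z ^ n = 1}" using assms by simp
  then show thesis using complex_roots_unity[of n] assms(2) that by (auto simp: zeta_power)
qed

lemma norm_zeta [simp]: "norm (zeta n) = 1"
  by (simp add: zeta_def norm_exp_eq_Re)

lemma cnj_zeta: "cnj (zeta n) = inverse (zeta n)"
  using complex_norm_square[of "zeta n"] by (simp add: field_simps)

abbreviation cyclotomic :: "nat \<Rightarrow> complex set" where
  "cyclotomic n \<equiv> adjoin {zeta n}"

lemma zeta_in_cyclotomic: "d dvd n \<Longrightarrow> n > 0 \<Longrightarrow> zeta d \<in> cyclotomic n"
  using adjoin.power_mem[OF in_adjoin, of "zeta n" "{zeta n}" "n div d"] zeta_power_div by simp

lemma cyclotomic_mono: "d dvd n \<Longrightarrow> n > 0 \<Longrightarrow> cyclotomic d \<subseteq> cyclotomic n"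
  by (simp add: adjoin_subset_iff zeta_in_cyclotomic)

lemma cyclotomic_1: "cyclotomic 1 = \<rat>" "cyclotomic (Suc 0) = \<rat>"
  using adjoin_insert_mem[of 1 "{}"] by (simp_all add: adjoin_empty)

lemma cyclotomic_eq_poly_values:
  assumes "n > 0"
  shows "cyclotomic n = poly_values \<rat> (zeta n)"
proof (rule adjoin_singleton)
  show "monom 1 n - 1 \<in> polys_over \<rat>" by auto
  show "poly (monom 1 n - 1) (zeta n) = 0" using assms by (simp add: poly_monom)
  show "monom 1 n - 1 \<noteq> (0 :: complex poly)"
  proof
    assume "monom 1 n - 1 = (0 :: complex poly)"
    then have "poly (monom 1 n - 1) (0 :: complex) = 0" by (simp only: poly_0)
    with assms show False by (simp add: poly_monom power_0_left)
  qed
qed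


section \<open>Conjugates of roots of unity\<close>

lemma polys_over_Rats_obtain:
  assumes "p \<in> polys_over (\<rat> :: 'a::field_char_0 set)"
  obtains q where "p = map_poly of_rat q"
proof
  have inv: "of_rat (inv_into UNIV of_rat x) = x" if "x \<in> \<rat>" for x :: 'a
    using that by (simp add: Rats_def f_inv_into_f)
  have "inv_into UNIV of_rat (0::'a) = 0"
    by (simp add: inv_into_def)
  then show "p = map_poly of_rat (map_poly (inv_into UNIV of_rat) p)"
    using assms inv by (intro poly_eqI) (auto simp: coeff_map_poly polys_over_def)
qed

text \<open>Division with remainder by the monic \<open>m\<close> stays over \<open>E\<close>, and
  the remainder vanishes at \<open>x\<close> in too small a degree.\<close>

lemma min_poly_quotient:
  assumes "field_subset E" "is_min_poly E x m" "q \<in> polys_over E" "poly q x = 0"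
  obtains u where "u \<in> polys_over E" "q = u * m"
proof -
  interpret field_subset E by fact
  obtain u r where ur: "u \<in> polys_over E" "r \<in> polys_over E" "q = u * m + r" "degree r < degree m"
    using polys_over_division[of q m] assms min_poly_degree_pos by (auto simp: is_min_poly_def)
  with assms have "poly r x = 0" by (simp add: is_min_poly_def)
  with ur min_poly_eq_0[OF assms(2)] have "r = 0" by blast
  with ur that show thesis by simp
qed

text \<open>Gauss's lemma: the monic integer polynomial \<open>P\<close> factors over \<rat> as
  \<open>m' * u'\<close>, and the primitive part \<open>g\<close> of \<open>m'\<close> divides
  \<open>P\<close> over \<int>.\<close>

lemma min_poly_algebraic_int:
  fixes x :: "'a::field_char_0"
  assumes "algebraic_int x" "is_min_poly \<rat> x m"
  shows "m \<in> polys_over \<int>"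
proof -
  obtain P where P: "poly (map_poly of_int P) x = 0" "lead_coeff P = 1"
    using assms(1) by (auto simp: algebraic_int_altdef_ipoly)
  have "map_poly of_int P \<in> polys_over (\<rat> :: 'a set)"
    by (auto simp: polys_over_def coeff_map_poly)
  then obtain u where u: "u \<in> polys_over \<rat>" "map_poly of_int P = u * m"
    using min_poly_quotient[OF field_subset_Rats assms(2) _ P(1)] by blast
  obtain u' where u': "u = map_poly of_rat u'" using u(1) polys_over_Rats_obtain by blast
  obtain m' where m': "m = map_poly of_rat m'"
    using assms(2) polys_over_Rats_obtain by (auto simp: is_min_poly_def)
  interpret R: map_poly_inj_idom_hom "of_rat :: rat \<Rightarrow> 'a" ..
  have "map_poly of_rat (map_poly rat_of_int P) = map_poly (of_int :: int \<Rightarrow> 'a) P"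
    by (simp add: map_poly_map_poly o_def)
  also have "\<dots> = map_poly of_rat (m' * u')"
    by (simp add: u(2) u' m' R.hom_mult mult.commute)
  finally have Pmu: "map_poly rat_of_int P = m' * u'" by simp
  obtain s g where sg: "rat_to_normalized_int_poly m' = (s, g)" by force
  obtain r where "P = g * smult (content P) r"
    using rat_to_int_factor_explicit[OF Pmu sg] by blast
  \<comment> \<open>The leading coefficient of \<open>g\<close> divides 1. Since \<open>m'\<close>
    is monic and its content \<open>s\<close> is positive, this leaves only
    \<open>s = 1\<close>.\<close>
  then have "lead_coeff g * lead_coeff (smult (content P) r) = 1"
    using P(2) lead_coeff_mult[of g "smult (content P) r"] by simp
  then have lg: "lead_coeff g = 1 \<or> lead_coeff g = -1"
    by (auto simp: zmult_eq_1_iff)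
  have m'_eq: "m' = smult s (map_poly of_int g)" and s: "s > 0"
    using rat_to_normalized_int_poly[OF sg] by auto
  have "lead_coeff m' = 1"
    using assms(2) unfolding m' is_min_poly_def by (simp add: degree_map_poly coeff_map_poly)
  then have "s * of_int (lead_coeff g) = 1"
    using s by (simp add: m'_eq degree_map_poly coeff_map_poly)
  with lg s have "s = 1" by auto
  then have "m = map_poly of_int g"
    by (simp add: m' m'_eq map_poly_map_poly o_def)
  then show ?thesis by (auto simp: polys_over_def coeff_map_poly)
qed

text \<open>The inner binomial coefficients are divisible by \<open>p\<close>, so \<open>div\<close>
  is exact here.\<close>

lemma binomial_prime_power:
  fixes a b :: "'a::comm_ring_1"
  assumes "prime p"
  shows "(a + b) ^ p = a ^ p + b ^ p +
    of_nat p * (\<Sum>k\<in>{1..<p}. of_nat ((p choose k) div p) * a ^ k * b ^ (p - k))"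
proof -
  have p: "p > 0" using assms by (rule prime_gt_0_nat)
  have "(a + b) ^ p = (\<Sum>k\<le>p. of_nat (p choose k) * a ^ k * b ^ (p - k))"
    by (rule binomial_ring)
  also have "{..p} = insert 0 (insert p {1..<p})" using p by auto
  also have "(\<Sum>k\<in>\<dots>. of_nat (p choose k) * a ^ k * b ^ (p - k)) =
      b ^ p + (a ^ p + (\<Sum>k\<in>{1..<p}. of_nat (p choose k) * a ^ k * b ^ (p - k)))"
    using p by simp
  also have "(\<Sum>k\<in>{1..<p}. of_nat (p choose k) * a ^ k * b ^ (p - k)) =
      (\<Sum>k\<in>{1..<p}. of_nat p * (of_nat ((p choose k) div p) * a ^ k * b ^ (p - k)))"
  proof (intro sum.cong refl)
    fix k assume "k \<in> {1..<p}"
    then have "p dvd (p choose k)" using assms by (intro dvd_choose_prime) auto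
    then have "p choose k = p * ((p choose k) div p)" by simp
    then have "of_nat (p choose k) = (of_nat p * of_nat ((p choose k) div p) :: 'a)"
      by (metis of_nat_mult)
    then show "of_nat (p choose k) * a ^ k * b ^ (p - k) =
        of_nat p * (of_nat ((p choose k) div p) * a ^ k * b ^ (p - k))"
      by (simp add: mult.assoc)
  qed
  finally show ?thesis by (simp add: sum_distrib_left add_ac)
qed

text \<open>Modulo \<open>p\<close>, raising to the power \<open>p\<close> commutes with integer
  polynomials; \<open>h\<close> records the error, uniformly in \<open>x\<close>.\<close>

lemma frobenius_polys_over_Ints:
  fixes P :: "'a::field_char_0 poly"
  assumes "prime p" "P \<in> polys_over \<int>"
  shows "\<exists>h\<in>polys_over \<int>. \<forall>x. poly P (x ^ p) = poly P x ^ p + of_nat p * poly h x"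
  using assms(2)
proof (induction P)
  case 0
  have "p > 0" using assms(1) by (rule prime_gt_0_nat)
  then show ?case by (intro bexI[of _ 0]) auto
next
  case (pCons a P)
  then obtain h where h: "h \<in> polys_over \<int>" "\<And>x. poly P (x ^ p) = poly P x ^ p + of_nat p * poly h x"
    by auto
  from pCons.prems have "a \<in> \<int>" by simp
  then obtain a' where a': "a = of_int a'" by (elim Ints_cases)
  have P: "P \<in> polys_over \<int>" using pCons.prems by simp
  have p0: "p > 0" using assms(1) by (rule prime_gt_0_nat)
  \<comment> \<open>Fermat's theorem is applied to a natural number, so the possibly negative
    coefficient is replaced by its residue.\<close>
  define c where "c = nat (a' mod int p)"
  have c: "[int c = a'] (mod int p)" using p0 by (simp add: c_def cong_def)
  have "[c ^ p = c] (mod p)"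
  proof (cases "p dvd c")
    case True
    moreover from this have "p dvd c ^ p" using p0 by (simp add: dvd_power_iff_le dvd_trans[OF _ dvd_power])
    ultimately show ?thesis by (simp add: cong_def mod_eq_0_iff_dvd)
  next
    case False
    then have "[c ^ (p - 1) * c = 1 * c] (mod p)"
      by (intro cong_scalar_right fermat_theorem assms(1))
    then show ?thesis using p0 by (simp flip: power_Suc2)
  qed
  then have "[int c ^ p = int c] (mod int p)"
    using cong_int_iff[of "c ^ p" c p] by simp
  then have "[a' ^ p = a'] (mod int p)" using c by (meson cong_pow cong_sym cong_trans)
  then obtain b where "a' ^ p = a' + int p * b"
    by (metis cong_iff_lin cong_sym)
  then have b: "a ^ p = a + of_nat p * of_int b"
    by (metis a' of_int_add of_int_mult of_int_of_nat_eq of_int_power)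
  define C where "C = (\<Sum>k\<in>{1..<p}. of_nat ((p choose k) div p) * [:a:] ^ k * (pCons 0 P) ^ (p - k))"
  have power: "q ^ k \<in> polys_over \<int>" if "q \<in> polys_over \<int>" for q :: "'a poly" and k
    using that by (induction k) auto
  have nat: "of_nat k \<in> polys_over (\<int> :: 'a set)" for k
    by (auto simp: polys_over_def of_nat_poly coeff_pCons split: nat.splits)
  have "C \<in> polys_over \<int>"
    unfolding C_def using pCons.prems by (intro Ints.polys_over_sum Ints.polys_over_mult power nat) auto
  \<comment> \<open>With \<open>a ^ p = a + p * b\<close> and \<open>C\<close> the error of the
    binomial expansion, the errors combine to \<open>x ^ p * h - b - C\<close>.\<close>
  then have "monom 1 p * h - [:of_int b:] - C \<in> polys_over \<int>"
    using h(1) by (intro Ints.polys_over_diff Ints.polys_over_mult) auto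
  moreover have "poly (pCons a P) (x ^ p) =
      poly (pCons a P) x ^ p + of_nat p * poly (monom 1 p * h - [:of_int b:] - C) x" for x
  proof -
    have "poly (pCons a P) x ^ p = (a + x * poly P x) ^ p" by simp
    also have "\<dots> = a ^ p + (x * poly P x) ^ p + of_nat p * poly C x"
      unfolding C_def by (subst binomial_prime_power[OF assms(1)]) (simp add: poly_sum mult_ac)
    finally have "poly (pCons a P) x ^ p = \<dots>" .
    then show ?thesis
      by (simp add: h(2) b poly_monom power_mult_distrib algebra_simps)
  qed
  ultimately show ?case by blast
qed

text \<open>Landau's proof of the irreducibility of the cyclotomic polynomials: for all large primes \<open>p\<close>,
  the value of the minimal polynomial at a \<open>p\<close>-th power of a root has coordinates that are
  divisible by \<open>p\<close> but bounded, so it vanishes. Every residue class prime to \<open>N\<close> contains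
  a number all of whose prime factors are large.\<close>

lemma min_poly_zeta_conjugate:
  assumes N: "N > 0" and m: "is_min_poly \<rat> (zeta N) m" and a: "coprime a N"
  shows "poly m (zeta N ^ a) = 0"
proof -
  have "algebraic_int (zeta N)"
  proof (rule algebraic_int_root)
    show "poly (monom 1 N) (zeta N) = 1" using N by (simp add: poly_monom)
    show "lead_coeff (monom 1 N) = (1 :: complex)" by (rule Polynomial.lead_coeff_monom)
    show "degree (monom 1 N :: complex poly) > 0" using N by (simp add: Polynomial.degree_monom_eq)
  qed auto
  then have mZ: "m \<in> polys_over \<int>" using min_poly_algebraic_int m by blast
  have mono: "lead_coeff m = 1" using m by (simp add: is_min_poly_def)
  have Ints_Rats: "polys_over \<int> \<subseteq> polys_over (\<rat> :: complex set)"
    by (intro polys_over_mono) (auto elim!: Ints_cases)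
  have red: "\<exists>r\<in>polys_over \<int>. degree r < degree m \<and> poly r (zeta N) = poly q (zeta N)"
    if "q \<in> polys_over \<int>" for q
    using Ints.polys_over_division[OF that mZ mono Rats.min_poly_degree_pos[OF m]] m
    by (auto simp: is_min_poly_def)
  have red_power: "\<exists>r\<in>polys_over \<int>. degree r < degree m \<and> poly r (zeta N) = poly q (zeta N ^ k)"
    if "q \<in> polys_over \<int>" for q k
    using red[of "pcompose q (monom 1 k)"] that by (auto simp: poly_pcompose poly_monom)
  \<comment> \<open>\<open>R k\<close> holds integer coordinates of
    \<open>poly m (zeta N ^ k)\<close> with respect to the powers of \<open>zeta N\<close> below
    \<open>degree m\<close>.\<close>
  define R where "R = (\<lambda>k. SOME r. r \<in> polys_over \<int> \<and> degree r < degree m \<and>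
    poly r (zeta N) = poly m (zeta N ^ k))"
  have R: "R k \<in> polys_over \<int>" "degree (R k) < degree m" "poly (R k) (zeta N) = poly m (zeta N ^ k)" for k
    using someI_ex[of "\<lambda>r. r \<in> polys_over \<int> \<and> degree r < degree m \<and> poly r (zeta N) = poly m (zeta N ^ k)"]
      red_power[OF mZ, of k] unfolding R_def by blast+
  \<comment> \<open>The values depend on \<open>k\<close> modulo \<open>N\<close> only, so finitely
    many coordinates have to be bounded.\<close>
  define S where "S = (\<Union>k<N. (\<lambda>i. norm (coeff (R k) i)) ` {..degree m})"
  have "finite S" by (simp add: S_def)
  then obtain B where B: "\<And>s. s \<in> S \<Longrightarrow> s \<le> B" by (meson finite_has_maximal2 bdd_above_finite bdd_above_def)
  define K where "K = nat \<lceil>B\<rceil>"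
  have step: "poly m (zeta N ^ (k * p)) = 0"
    if k: "poly m (zeta N ^ k) = 0" and p: "prime p" "p > K" for k p
  proof -
    obtain h where h: "h \<in> polys_over \<int>" "\<And>x. poly m (x ^ p) = poly m x ^ p + of_nat p * poly h x"
      using frobenius_polys_over_Ints[OF p(1) mZ] by blast
    have p0: "p > 0" using p(1) by (rule prime_gt_0_nat)
    obtain h' where h': "h' \<in> polys_over \<int>" "degree h' < degree m" "poly h' (zeta N) = poly h (zeta N ^ k)"
      using red_power[OF h(1)] by blast
    define j where "j = (k * p) mod N"
    have j: "zeta N ^ j = zeta N ^ (k * p)" "j < N"
      using N by (simp_all add: zeta_power_eq_iff j_def)
    \<comment> \<open>Since \<open>m\<close> vanishes at \<open>zeta N ^ k\<close>, only the
      multiple of \<open>p\<close> survives in the Frobenius identity; both sides are in reduced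
      form, so their coordinates agree.\<close>
    have "poly (R j - smult (of_nat p) h') (zeta N) = 0"
      using h(2)[of "zeta N ^ k"] k p0 by (simp add: R j h' power_mult)
    moreover have "R j - smult (of_nat p) h' \<in> polys_over \<rat>"
      using R(1)[of j] h'(1) Ints_Rats by auto
    moreover have "degree (R j - smult (of_nat p) h') < degree m"
      using R(2)[of j] h'(2) by (intro degree_diff_less) auto
    ultimately have "R j - smult (of_nat p) h' = 0"
      using Rats.min_poly_eq_0[OF m] by blast
    then have Rj: "R j = smult (of_nat p) h'" by simp
    have "h' = 0"
    proof (rule poly_eqI)
      fix i
      show "coeff h' i = coeff 0 i"
      proof (cases "i \<le> degree m")
        case True
        have "coeff h' i \<in> \<int>" using h'(1) by (auto simp: polys_over_def)
        then obtain c where c: "coeff h' i = of_int c" by (auto simp: Ints_def)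
        have "norm (coeff (R j) i) \<le> B"
          using j(2) True by (intro B) (auto simp: S_def)
        then have "real p * \<bar>of_int c\<bar> \<le> B" by (simp add: Rj c norm_mult)
        moreover have "B < real p" using p(2) unfolding K_def by linarith
        ultimately have "real p * \<bar>of_int c\<bar> < real p * 1" by simp
        then have "\<bar>of_int c :: real\<bar> < 1" using p0 by (simp only: mult_less_cancel_left_pos of_nat_0_less_iff)
        then have "c = 0" by linarith
        with c show ?thesis by simp
      qed (use h'(2) in \<open>auto intro: coeff_eq_0\<close>)
    qed
    then show ?thesis using R(3)[of j] by (simp add: Rj j)
  qed
  have large: "poly m (zeta N ^ k) = 0" if "k > 0" "\<And>p. prime p \<Longrightarrow> p dvd k \<Longrightarrow> p > K" for k
    using that
  proof (induction k rule: less_induct)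
    case (less k)
    show ?case
    proof (cases "k = 1")
      case True
      then show ?thesis using m by (simp add: is_min_poly_def)
    next
      case False
      then obtain p where p: "prime p" "p dvd k" using prime_factor_nat by blast
      then obtain l where l: "k = l * p" by (metis dvdE mult.commute)
      have "l > 0" "l < k" using l less.prems(1) prime_gt_1_nat[OF p(1)] by auto
      then have "poly m (zeta N ^ l) = 0" using less l by auto
      then show ?thesis unfolding l using p less.prems(2) by (intro step) auto
    qed
  qed
  \<comment> \<open>Adding \<open>N * Q\<close> to \<open>a\<close> keeps the residue class and
    expels the small primes: one that divides \<open>a\<close> divides neither \<open>N\<close> nor
    \<open>Q\<close>, and one that does not divide \<open>a\<close> divides
    \<open>Q\<close>.\<close>
  define Q where "Q = \<Prod>{p. prime p \<and> p \<le> K \<and> \<not> p dvd a}"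
  have fin: "finite {p. prime p \<and> p \<le> K \<and> \<not> p dvd a}" by simp
  define k where "k = a + N * Q"
  have "Q > 0" unfolding Q_def by (intro prod_pos) (auto intro: prime_gt_0_nat)
  with N have "k > 0" by (simp add: k_def)
  moreover have "p > K" if p: "prime p" "p dvd k" for p
  proof (rule ccontr)
    assume "\<not> p > K"
    then have pK: "p \<le> K" by simp
    show False
    proof (cases "p dvd a")
      case True
      then have "p dvd N * Q" using p(2) by (simp add: k_def dvd_add_right_iff)
      moreover have "\<not> p dvd N" using True a p(1) coprime_common_divisor[OF a] not_prime_unit by blast
      ultimately have "p dvd Q" using p(1) by (simp add: prime_dvd_mult_iff)
      then obtain q where "prime q" "\<not> q dvd a" "p dvd q"
        using p(1) fin by (auto simp: Q_def prime_dvd_prod_iff)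
      with True p(1) show False using primes_dvd_imp_eq by blast
    next
      case False
      then have "p dvd Q" unfolding Q_def using p pK by (intro dvd_prodI[OF fin, of p "\<lambda>x. x"]) auto
      with p(2) have "p dvd a" by (metis dvd_add_left_iff dvd_mult k_def)
      with False show False ..
    qed
  qed
  ultimately have "poly m (zeta N ^ k) = 0" by (rule large)
  moreover have "zeta N ^ k = zeta N ^ a" using N by (simp add: zeta_power_eq_iff k_def cong_def)
  ultimately show ?thesis by simp
qed


section \<open>Galois conjugation on cyclotomic fields\<close>

lemma poly_dvd_root: "p dvd q \<Longrightarrow> poly p z = 0 \<Longrightarrow> poly q z = 0"
  by (metis dvdE mult_zero_left poly_mult)

text \<open>The automorphism sending \<open>zeta N\<close> to \<open>zeta N ^ a\<close>, given by
  its action on polynomial expressions. For \<open>a\<close> coprime to \<open>N\<close> the chosen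
  polynomial does not affect the value on \<open>cyclotomic N\<close>; outside that field the value
  is unspecified.\<close>

definition galois_conj :: "nat \<Rightarrow> nat \<Rightarrow> complex \<Rightarrow> complex" where
  "galois_conj N a x = poly (SOME p. p \<in> polys_over \<rat> \<and> poly p (zeta N) = x) (zeta N ^ a)"

lemma min_poly_zeta_exists:
  assumes "N > 0" "field_subset E"
  obtains m where "is_min_poly E (zeta N) m" "m dvd monom 1 N - 1"
proof -
  interpret field_subset E by fact
  have E: "monom 1 N - 1 \<in> polys_over E" by auto
  have 0: "poly (monom 1 N - 1) (zeta N) = 0" using assms(1) by (simp add: poly_monom)
  have "poly (monom 1 N - 1) (0 :: complex) \<noteq> 0"
    using assms(1) by (simp add: poly_monom power_0_left)
  then have "monom 1 N - 1 \<noteq> (0 :: complex poly)" by force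
  from min_poly_exists[OF E this 0] obtain m where m: "is_min_poly E (zeta N) m" by blast
  with E 0 show thesis by (intro that[of m]) (auto simp: is_min_poly_def)
qed

text \<open>The cofactor in \<open>m\<close> of the minimal polynomial of \<open>z\<close> has too
  small a degree to vanish at \<open>x\<close>. So that minimal polynomial vanishes at
  \<open>x\<close>, and it and \<open>m\<close> divide each other.\<close>

lemma min_poly_of_root:
  assumes "field_subset E" "is_min_poly E x m" "poly m z = 0"
  shows "is_min_poly E z m"
proof -
  interpret field_subset E by fact
  have m: "m \<in> polys_over E" "m \<noteq> 0" "lead_coeff m = 1" "poly m x = 0"
    using assms(2) by (auto simp: is_min_poly_def)
  obtain m' where m': "is_min_poly E z m'" using min_poly_exists[OF m(1,2) assms(3)] by blast
  obtain u where u: "u \<in> polys_over E" "m = u * m'"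
    using min_poly_quotient[OF assms(1) m' m(1) assms(3)] .
  have nz: "u \<noteq> 0" "m' \<noteq> 0" using m(2) u(2) by auto
  have "poly u x \<noteq> 0"
  proof
    assume "poly u x = 0"
    moreover have "degree u < degree m"
      using nz min_poly_degree_pos[OF m'] by (simp add: u(2) degree_mult_eq)
    ultimately show False using min_poly_eq_0[OF assms(2) u(1)] nz(1) by blast
  qed
  then have "poly m' x = 0" using m(4) by (simp add: u(2))
  then have "m dvd m'" using assms(2) m' by (auto simp: is_min_poly_def)
  moreover have "m' dvd m" by (simp add: u(2))
  ultimately have "m = m'" using m(3) m' by (intro poly_dvd_antisym) (auto simp: is_min_poly_def)
  with m' show ?thesis by simp
qed

context
  fixes N a :: nat
  assumes N: "N > 0" and a: "coprime a N"
begin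

text \<open>Two polynomials with the same value at \<open>zeta N\<close> differ by a multiple of the
  minimal polynomial, which vanishes at \<open>zeta N ^ a\<close> too.\<close>

lemma galois_conj_poly:
  assumes "p \<in> polys_over \<rat>"
  shows "galois_conj N a (poly p (zeta N)) = poly p (zeta N ^ a)"
proof -
  define q where "q = (SOME q. q \<in> polys_over \<rat> \<and> poly q (zeta N) = poly p (zeta N))"
  have q: "q \<in> polys_over \<rat>" "poly q (zeta N) = poly p (zeta N)"
    using someI[of "\<lambda>q. q \<in> polys_over \<rat> \<and> poly q (zeta N) = poly p (zeta N)" p] assms
    unfolding q_def by auto
  obtain m where m: "is_min_poly \<rat> (zeta N) m"
    using min_poly_zeta_exists[OF N field_subset_Rats] by blast
  have "p - q \<in> polys_over \<rat>" "poly (p - q) (zeta N) = 0" using assms q by auto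
  then have "m dvd p - q" using m by (auto simp: is_min_poly_def)
  then have "poly (p - q) (zeta N ^ a) = 0"
    using min_poly_zeta_conjugate[OF N m a] by (rule poly_dvd_root)
  then show ?thesis by (simp add: galois_conj_def q_def[symmetric])
qed

lemma cyclotomic_poly:
  assumes "x \<in> cyclotomic N"
  obtains p where "p \<in> polys_over \<rat>" "x = poly p (zeta N)"
  using assms by (auto simp: cyclotomic_eq_poly_values[OF N] poly_values_def)

lemma galois_conj_add:
  assumes "x \<in> cyclotomic N" "y \<in> cyclotomic N"
  shows "galois_conj N a (x + y) = galois_conj N a x + galois_conj N a y"
proof -
  obtain p q where "p \<in> polys_over \<rat>" "x = poly p (zeta N)" "q \<in> polys_over \<rat>" "y = poly q (zeta N)"
    using assms by (metis cyclotomic_poly)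
  then show ?thesis using galois_conj_poly[of "p + q"] by (auto simp: galois_conj_poly)
qed

lemma galois_conj_mult:
  assumes "x \<in> cyclotomic N" "y \<in> cyclotomic N"
  shows "galois_conj N a (x * y) = galois_conj N a x * galois_conj N a y"
proof -
  obtain p q where "p \<in> polys_over \<rat>" "x = poly p (zeta N)" "q \<in> polys_over \<rat>" "y = poly q (zeta N)"
    using assms by (metis cyclotomic_poly)
  then show ?thesis using galois_conj_poly[of "p * q"] by (auto simp: galois_conj_poly)
qed

lemma galois_conj_Rats: "x \<in> \<rat> \<Longrightarrow> galois_conj N a x = x"
  using galois_conj_poly[of "[:x:]"] by simp

lemma galois_conj_power:
  assumes "x \<in> cyclotomic N"
  shows "galois_conj N a (x ^ k) = galois_conj N a x ^ k"
  using assms by (induction k) (auto simp: galois_conj_Rats galois_conj_mult adjoin.power_mem)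

lemma galois_conj_zeta: "galois_conj N a (zeta N) = zeta N ^ a"
  using galois_conj_poly[of "[:0, 1:]"] by simp

lemma galois_conj_cyclotomic:
  assumes "d dvd N" "p \<in> polys_over \<rat>"
  shows "galois_conj N a (poly p (zeta d)) = poly p (zeta d ^ a)"
proof -
  have z: "zeta d = zeta N ^ (N div d)" using zeta_power_div assms(1) N by simp
  have "pcompose p (monom 1 (N div d)) \<in> polys_over \<rat>" using assms(2) by auto
  from galois_conj_poly[OF this] show ?thesis
    unfolding z by (simp add: poly_pcompose poly_monom mult.commute flip: power_mult)
qed

lemma galois_conj_closed:
  assumes "d dvd N" "x \<in> cyclotomic d"
  shows "galois_conj N a x \<in> cyclotomic d"
proof -
  have d: "d > 0" using assms(1) N by (auto intro: dvd_pos_nat)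
  obtain p where p: "p \<in> polys_over \<rat>" "x = poly p (zeta d)"
    using assms(2) by (auto simp: cyclotomic_eq_poly_values[OF d] poly_values_def)
  have "polys_over \<rat> \<subseteq> polys_over (cyclotomic d)"
    by (intro polys_over_mono adjoin.Rats_subset)
  then have "poly p (zeta d ^ a) \<in> cyclotomic d"
    using p(1) by (intro adjoin.poly_mem adjoin.power_mem in_adjoin) auto
  then show ?thesis using galois_conj_cyclotomic[OF assms(1) p(1)] p(2) by simp
qed

text \<open>Complex conjugation raises \<open>zeta N\<close> to the power \<open>N - 1\<close>,
  hence commutes with raising it to the power \<open>a\<close>.\<close>

lemma galois_conj_Reals:
  assumes "x \<in> cyclotomic N" "x \<in> \<real>"
  shows "galois_conj N a x \<in> \<real>"
proof -
  have cnj: "cnj (zeta N) = zeta N ^ (N - 1)"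
    using power_Suc[of "zeta N" "N - 1"] N
    by (simp add: cnj_zeta field_simps del: power_Suc)
  obtain p where p: "p \<in> polys_over \<rat>" "x = poly p (zeta N)" using assms(1) cyclotomic_poly by blast
  have poly_cnj: "cnj (poly p z) = poly p (cnj z)" for z
    using p(1) by (induction p) (auto elim!: Rats_cases')
  have *: "poly p (cnj (zeta N)) = x"
    using assms(2) by (simp add: p(2) poly_cnj[symmetric] Reals_cnj_iff)
  have "pcompose p (monom 1 (N - 1)) \<in> polys_over \<rat>" using p(1) by auto
  from galois_conj_poly[OF this] have "galois_conj N a x = poly p ((zeta N ^ a) ^ (N - 1))"
    using * by (simp add: poly_pcompose poly_monom cnj)
  also have "(zeta N ^ a) ^ (N - 1) = cnj (zeta N ^ a)"
    by (simp add: cnj mult.commute flip: power_mult)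
  also have "poly p (cnj (zeta N ^ a)) = cnj (galois_conj N a x)"
    by (simp only: poly_cnj[symmetric] p(2) galois_conj_poly[OF p(1)])
  finally show ?thesis by (simp add: Reals_cnj_iff)
qed

end

lemma galois_conj_cong:
  assumes "N > 0" "coprime a N" "coprime b N" "d dvd N" "x \<in> cyclotomic d" "[a = b] (mod d)"
  shows "galois_conj N a x = galois_conj N b x"
proof -
  have d: "d > 0" using assms(1,4) by (auto intro: dvd_pos_nat)
  obtain p where p: "p \<in> polys_over \<rat>" "x = poly p (zeta d)"
    using assms(5) by (auto simp: cyclotomic_eq_poly_values[OF d] poly_values_def)
  then show ?thesis using assms d
    by (simp add: galois_conj_cyclotomic zeta_power_eq_iff flip: zeta_power_eq_iff)
qed

lemma galois_conj_fixed:
  assumes "N > 0" "coprime a N" "d dvd N" "x \<in> cyclotomic d" "[a = 1] (mod d)"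
  shows "galois_conj N a x = x"
proof -
  have d: "d > 0" using assms(1,3) by (auto intro: dvd_pos_nat)
  obtain p where p: "p \<in> polys_over \<rat>" "x = poly p (zeta d)"
    using assms(4) by (auto simp: cyclotomic_eq_poly_values[OF d] poly_values_def)
  have "zeta d ^ a = zeta d ^ 1" using d assms(5) by (simp only: zeta_power_eq_iff)
  with p assms show ?thesis by (simp add: galois_conj_cyclotomic)
qed

text \<open>The minimal polynomial of \<open>zeta N\<close> over \<open>cyclotomic d\<close> is squarefree with roots among the
  conjugates fixing \<open>cyclotomic d\<close>. A fixed element is the value of a polynomial of smaller degree
  that is constant on these roots, hence constant.\<close>

lemma galois_conj_fixed_imp:
  assumes N: "N > 0" and d: "d dvd N" and y: "y \<in> cyclotomic N"
    and fixed: "\<And>a. coprime a N \<Longrightarrow> [a = 1] (mod d) \<Longrightarrow> galois_conj N a y = y"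
  shows "y \<in> cyclotomic d"
proof -
  have d0: "d > 0" using d N by (auto intro: dvd_pos_nat)
  obtain m where m: "is_min_poly (cyclotomic d) (zeta N) m" and mdvd: "m dvd monom 1 N - 1"
    using min_poly_zeta_exists[OF N field_subset_adjoin] by blast
  obtain p where p: "p \<in> polys_over \<rat>" "y = poly p (zeta N)"
    using y by (auto simp: cyclotomic_eq_poly_values[OF N] poly_values_def)
  have "p \<in> polys_over (cyclotomic d)"
    using p(1) polys_over_mono[OF adjoin.Rats_subset] by blast
  then obtain u r where ur: "u \<in> polys_over (cyclotomic d)" "r \<in> polys_over (cyclotomic d)"
      "p = u * m + r" "degree r < degree m"
    using adjoin.polys_over_division[of p "{zeta d}" m] m adjoin.min_poly_degree_pos[OF m]
    unfolding is_min_poly_def by metis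
  have root: "poly r z = y" if z: "poly m z = 0" for z
  proof -
    have "poly (monom 1 N - 1) z = 0" using mdvd z by (rule poly_dvd_root)
    then have "z ^ N = 1" by (simp add: poly_monom)
    then obtain a where a: "z = zeta N ^ a" using root_of_unity_zeta N by blast
    define c where "c = N div d"
    have cd: "N = c * d" using d by (simp add: c_def)
    \<comment> \<open>This polynomial vanishes at \<open>zeta N\<close>, hence at every root
      \<open>z\<close> of \<open>m\<close>, which forces the exponent \<open>a\<close> of
      \<open>z\<close> to be 1 modulo \<open>d\<close>.\<close>
    have "monom 1 c - [:zeta d:] \<in> polys_over (cyclotomic d)"
      by (intro adjoin.polys_over_diff adjoin.polys_over_monom) (auto intro: in_adjoin)
    moreover have "poly (monom 1 c - [:zeta d:]) (zeta N) = 0"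
      using zeta_power_div[OF d N] by (simp add: poly_monom c_def)
    ultimately have "m dvd monom 1 c - [:zeta d:]" using m by (auto simp: is_min_poly_def)
    then have "z ^ c = zeta d" using poly_dvd_root[OF _ z] by (fastforce simp: poly_monom)
    then have "zeta d ^ a = zeta d ^ 1"
      using zeta_power_div[OF d N] by (simp add: a c_def mult.commute flip: power_mult)
        (metis mult.commute power_mult)
    then have a1: "[a = 1] (mod d)" using d0 by (simp only: zeta_power_eq_iff)
    \<comment> \<open>\<open>m\<close> is also the minimal polynomial of \<open>z\<close>, so a
      relation \<open>z ^ e = 1\<close> carries over to \<open>zeta N\<close>, whose order is
      \<open>N\<close>.\<close>
    have cop: "coprime a N"
    proof (rule Rings.coprimeI)
      fix q assume q: "q dvd a" "q dvd N"
      then have q0: "q > 0" using N by (auto intro: dvd_pos_nat)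
      define e where "e = N div q"
      have eN: "N = e * q" using q by (simp add: e_def)
      have ze: "zeta N ^ e = zeta q" using zeta_power_div[OF q(2) N] by (simp add: e_def)
      have "z ^ e = 1"
      proof -
        have "z ^ e = zeta q ^ a" by (metis a ze mult.commute power_mult)
        also have "\<dots> = zeta q ^ 0"
          using q(1) q0 by (subst zeta_power_eq_iff) (auto simp: cong_0_iff)
        finally show ?thesis by simp
      qed
      then have "poly (monom 1 e - 1) z = 0" by (simp add: poly_monom)
      moreover have "is_min_poly (cyclotomic d) z m"
        using min_poly_of_root[OF field_subset_adjoin m z] .
      moreover have "monom 1 e - 1 \<in> polys_over (cyclotomic d)" by auto
      ultimately have "m dvd monom 1 e - 1" by (simp add: is_min_poly_def)
      then have "poly (monom 1 e - 1) (zeta N) = 0"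
        by (rule poly_dvd_root) (use m in \<open>simp add: is_min_poly_def\<close>)
      then have "zeta q = 1" by (simp add: poly_monom ze)
      then have "zeta q ^ 1 = zeta q ^ 0" by simp
      then have "[1 = 0] (mod q)" using q0 by (simp only: zeta_power_eq_iff)
      then show "is_unit q" by (simp add: cong_0_iff)
    qed
    have "poly r z = poly p z" using z by (simp add: ur(3))
    also have "\<dots> = galois_conj N a y" by (simp add: a p galois_conj_poly[OF N cop])
    finally show ?thesis using fixed[OF cop a1] by simp
  qed
  have "card {z. poly m z = 0} = degree m"
  proof -
    have "rsquarefree (monom 1 N - 1 :: complex poly)"
      using N by (auto simp: rsquarefree_roots poly_monom pderiv_diff pderiv_monom power_0_left)
    moreover obtain k where "monom 1 N - 1 = m * k" using mdvd by (rule dvdE)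
    ultimately have "rsquarefree m"
      unfolding rsquarefree_roots
      by (metis add.right_neutral mult_zero_left mult_zero_right pderiv_mult poly_add poly_mult)
    then have "smult (lead_coeff m) (\<Prod>z|poly m z = 0. [:-z, 1:]) = m"
      by (rule complex_poly_decompose_rsquarefree)
    then have "m = (\<Prod>z|poly m z = 0. [:-z, 1:])" using m by (simp add: is_min_poly_def)
    then have "degree m = degree (\<Prod>z|poly m z = 0. [:-z, 1:])" by simp
    also have "\<dots> = card {z. poly m z = 0}" by (subst degree_prod_sum_eq) auto
    finally show ?thesis ..
  qed
  moreover have "finite {z. poly (r - [:y:]) z = 0} \<Longrightarrow> card {z. poly m z = 0} \<le> card {z. poly (r - [:y:]) z = 0}"
    using root by (intro card_mono) auto
  moreover have "degree (r - [:y:]) < degree m"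
    using ur(4) by (intro degree_diff_less) auto
  ultimately have "r - [:y:] = 0"
    using poly_roots_degree[of "r - [:y:]"] poly_roots_finite[of "r - [:y:]"] by fastforce
  then have "coeff r 0 = y" by (metis coeff_pCons_0 eq_iff_diff_eq_0)
  then show ?thesis using ur(2) by (auto simp: polys_over_def)
qed


section \<open>Intersections of cyclotomic fields\<close>

text \<open>The Chinese remainder theorem for moduli with a common factor: by Bezout,
  \<open>a - 1\<close> splits into a multiple of \<open>f\<close> and a multiple of
  \<open>n\<close>.\<close>

lemma cong_gcd_obtain:
  fixes a f n :: nat
  assumes "f > 0" "n > 0" "[a = 1] (mod gcd f n)"
  obtains b where "[b = 1] (mod f)" "[b = a] (mod n)"
proof -
  have "[int a = 1] (mod int (gcd f n))"
    using assms(3) cong_int_iff[of a 1] by simp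
  then have "int (gcd f n) dvd int a - 1" by (simp add: cong_iff_dvd_diff)
  then obtain c where c: "int a - 1 = gcd (int f) (int n) * c" by (auto simp: gcd_int_int_eq)
  obtain x y where "x * int f + y * int n = gcd (int f) (int n)" using bezout_int by blast
  then have xy: "int a - 1 = x * c * int f + y * c * int n"
    unfolding c by (metis distrib_right mult.assoc mult.commute)
  \<comment> \<open>Reduction modulo \<open>f * n\<close> turns the possibly negative witness into a
    natural number.\<close>
  define b where "b = nat ((1 + x * c * int f) mod (int f * int n))"
  have ib: "int b = (1 + x * c * int f) mod (int f * int n)"
    using assms(1,2) by (simp add: b_def)
  have "[int b = 1 + x * c * int f] (mod (int f * int n))" by (simp add: ib cong_def)
  then have "[int b = 1 + x * c * int f] (mod int f)" "[int b = 1 + x * c * int f] (mod int n)"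
    by (auto intro: cong_modulus_mult cong_modulus_mult[of _ _ "int n" "int f"] simp: mult.commute)
  moreover have "[1 + x * c * int f = 1] (mod int f)" by (simp add: cong_def)
  moreover have "1 + x * c * int f = int a - y * c * int n" using xy by simp
  then have "[1 + x * c * int f = int a] (mod int n)" by (simp add: cong_iff_dvd_diff)
  ultimately have "[int b = int 1] (mod int f)" "[int b = int a] (mod int n)"
    by (auto intro: cong_trans)
  then show thesis using that cong_int_iff by blast
qed

text \<open>Let \<open>a\<close> be 1 modulo the gcd, and choose \<open>b\<close> to be 1 modulo
  \<open>f\<close> and \<open>a\<close> modulo \<open>n\<close>. On \<open>cyclotomic n\<close> the
  two conjugations agree, and on \<open>cyclotomic f\<close> the second is trivial.\<close>

theorem cyclotomic_Int:
  assumes "f > 0" "n > 0"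
  shows "cyclotomic f \<inter> cyclotomic n = cyclotomic (gcd f n)"
proof
  show "cyclotomic (gcd f n) \<subseteq> cyclotomic f \<inter> cyclotomic n"
    using assms by (simp add: cyclotomic_mono)
  show "cyclotomic f \<inter> cyclotomic n \<subseteq> cyclotomic (gcd f n)"
  proof
    fix x assume x: "x \<in> cyclotomic f \<inter> cyclotomic n"
    define N where "N = lcm f n"
    have N: "N > 0" "f dvd N" "n dvd N" using assms by (auto simp: N_def lcm_pos_nat)
    show "x \<in> cyclotomic (gcd f n)"
    proof (rule galois_conj_fixed_imp)
      show "N > 0" by fact
      show "gcd f n dvd N" using N(2) by (meson dvd_trans gcd_dvd1)
      show "x \<in> cyclotomic N" using x cyclotomic_mono[OF N(2,1)] by auto
      fix a assume a: "coprime a N" "[a = 1] (mod gcd f n)"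
      obtain b where b: "[b = 1] (mod f)" "[b = a] (mod n)"
        using cong_gcd_obtain[OF assms a(2)] .
      have "coprime a n" using a(1) N(3) by (meson coprime_divisors dvd_refl)
      then have "coprime b n" using b(2) by (metis cong_imp_coprime cong_sym)
      moreover have "coprime b f" using b(1) by (metis cong_imp_coprime cong_sym coprime_1_left)
      ultimately have "coprime b (f * n)" by simp
      moreover have "N dvd f * n" by (simp add: N_def lcm_least)
      ultimately have cop: "coprime b N" by (meson coprime_divisors dvd_refl)
      have "galois_conj N a x = galois_conj N b x"
        using x a cop N b(2) by (intro galois_conj_cong[of N a b n]) (auto simp: cong_sym_eq)
      also have "\<dots> = x" using x cop N b(1) by (intro galois_conj_fixed[of N b f]) auto
      finally show "galois_conj N a x = x" .
    qed
  qed
qed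

lemma zeta_double_power: "n > 0 \<Longrightarrow> zeta (2 * n) ^ n = -1"
  using zeta_power_div[of 2 "2 * n"] by simp

text \<open>Conjugation by \<open>n + 1\<close> fixes \<open>zeta n\<close> but negates
  \<open>zeta (2 * n)\<close>; evenness of \<open>n\<close> makes \<open>n + 1\<close> coprime to
  \<open>2 * n\<close>.\<close>

lemma zeta_double_notin_cyclotomic:
  assumes "even n" "n > 0"
  shows "zeta (2 * n) \<notin> cyclotomic n"
proof
  assume z: "zeta (2 * n) \<in> cyclotomic n"
  have cop: "coprime (Suc n) (2 * n)" using assms(1) by (simp add: coprime_Suc_left_nat)
  have "galois_conj (2 * n) (Suc n) (zeta (2 * n)) = zeta (2 * n)"
    using assms z cop cong_add_rcancel_0_nat[of n 1 n]
    by (intro galois_conj_fixed[of _ _ n]) (auto simp: cong_0_iff)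
  moreover have "galois_conj (2 * n) (Suc n) (zeta (2 * n)) = - zeta (2 * n)"
    using assms galois_conj_zeta[OF _ cop] zeta_double_power[of n] by simp
  ultimately have "zeta (2 * n) = - zeta (2 * n)" by (simp only:)
  then have "2 * zeta (2 * n) = 0" by (simp only: eq_neg_iff_add_eq_0 mult_2)
  then show False by simp
qed

text \<open>Complex conjugation is central in the Galois group, so the conjugates of \<open>r\<close> are real.\<close>

lemma real_radical_in_cyclotomic:
  assumes N: "N > 0" and r: "complex_of_real r \<in> cyclotomic N" and n: "n > 0"
    and rat: "complex_of_real r ^ n \<in> \<rat>"
  shows "complex_of_real r ^ 2 \<in> \<rat>"
proof -
  have "complex_of_real r ^ 2 \<in> cyclotomic 1"
  proof (rule galois_conj_fixed_imp[OF N])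
    show "complex_of_real r ^ 2 \<in> cyclotomic N" using r by (rule adjoin.power_mem)
    fix a assume a: "coprime a N"
    obtain t where t: "galois_conj N a (of_real r) = complex_of_real t"
      using galois_conj_Reals[OF N a r] by (auto elim: Reals_cases)
    have "complex_of_real t ^ n = complex_of_real r ^ n"
      using galois_conj_power[OF N a r, of n] galois_conj_Rats[OF N a rat] t by simp
    then have "norm (complex_of_real t ^ n) = norm (complex_of_real r ^ n)" by simp
    then have "\<bar>t\<bar> = \<bar>r\<bar>"
      using n by (simp add: norm_power power_eq_iff_eq_base)
    then have "t\<^sup>2 = r\<^sup>2" by (simp add: power2_eq_iff abs_eq_iff)
    then show "galois_conj N a (complex_of_real r ^ 2) = complex_of_real r ^ 2"
      using galois_conj_power[OF N a r, of 2] t by (metis of_real_power)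
  qed simp
  then show ?thesis by (simp only: cyclotomic_1)
qed

text \<open>If \<open>\<delta>\<close> lies outside \<open>cyclotomic n\<close>, the coordinates in
  \<open>x = u + v * \<delta>\<close> are unique. A conjugation that fixes
  \<open>cyclotomic f\<close> fixes \<open>x\<close> and \<open>\<delta>\<close> and maps
  \<open>cyclotomic n\<close> into itself, so it fixes \<open>u\<close> and
  \<open>v\<close>.\<close>

lemma cyclotomic_Int_adjoin_root:
  assumes "f > 0" "n > 0" and \<delta>: "\<delta> \<in> cyclotomic f" "\<delta>\<^sup>2 \<in> cyclotomic n"
  shows "cyclotomic f \<inter> adjoin {zeta n, \<delta>} = adjoin {zeta (gcd f n), \<delta>}"
proof
  have g: "zeta (gcd f n) \<in> cyclotomic f" "zeta (gcd f n) \<in> cyclotomic n"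
    using assms(1,2) by (auto intro: zeta_in_cyclotomic)
  show "adjoin {zeta (gcd f n), \<delta>} \<subseteq> cyclotomic f \<inter> adjoin {zeta n, \<delta>}"
    using g \<delta>(1) subsetD[OF adjoin_mono[of "{zeta n}" "{zeta n, \<delta>}"] g(2)]
    by (auto simp: adjoin_subset_iff intro!: in_adjoin[of \<delta>])
  show "cyclotomic f \<inter> adjoin {zeta n, \<delta>} \<subseteq> adjoin {zeta (gcd f n), \<delta>}"
  proof
    fix x assume x: "x \<in> cyclotomic f \<inter> adjoin {zeta n, \<delta>}"
    have sub: "cyclotomic (gcd f n) \<subseteq> adjoin {zeta (gcd f n), \<delta>}" by (intro adjoin_mono) auto
    show "x \<in> adjoin {zeta (gcd f n), \<delta>}"
    proof (cases "\<delta> \<in> cyclotomic n")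
      case True
      then have "adjoin {zeta n, \<delta>} = cyclotomic n"
        using adjoin_insert_mem[of \<delta> "{zeta n}"] by (simp add: insert_commute)
      then show ?thesis using x cyclotomic_Int[OF assms(1,2)] sub by blast
    next
      case False
      define N where "N = lcm f n"
      have N: "N > 0" "f dvd N" "n dvd N" using assms by (auto simp: N_def lcm_pos_nat)
      have fN: "cyclotomic f \<subseteq> cyclotomic N" and nN: "cyclotomic n \<subseteq> cyclotomic N"
        using N by (simp_all add: cyclotomic_mono)
      obtain u v where uv: "x = u + v * \<delta>" "u \<in> cyclotomic n" "v \<in> cyclotomic n"
        using x adjoin_insert_square[OF \<delta>(2)] by (auto simp: insert_commute)
      have fixed: "galois_conj N a u = u \<and> galois_conj N a v = v"
        if a: "coprime a N" "[a = 1] (mod f)" for a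
      proof -
        define u' v' where "u' = galois_conj N a u" and "v' = galois_conj N a v"
        have u'v': "u' \<in> cyclotomic n" "v' \<in> cyclotomic n"
          using galois_conj_closed[OF N(1) a(1) N(3)] uv by (auto simp: u'_def v'_def)
        have fix_f: "galois_conj N a y = y" if "y \<in> cyclotomic f" for y
          using galois_conj_fixed[OF N(1) a(1) N(2) that a(2)] .
        have "x = galois_conj N a (u + v * \<delta>)" using fix_f x uv by simp
        also have "\<dots> = galois_conj N a u + galois_conj N a (v * \<delta>)"
          using uv \<delta>(1) fN nN by (intro galois_conj_add[OF N(1) a(1)]) auto
        also have "galois_conj N a (v * \<delta>) = galois_conj N a v * galois_conj N a \<delta>"
          using uv \<delta>(1) fN nN by (intro galois_conj_mult[OF N(1) a(1)]) auto
        finally have "u + v * \<delta> = u' + v' * \<delta>"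
          using fix_f[OF \<delta>(1)] uv by (simp add: u'_def v'_def)
        then have *: "(v - v') * \<delta> = u' - u" by (simp add: algebra_simps)
        have "v = v'"
        proof (rule ccontr)
          assume "v \<noteq> v'"
          moreover have "(v - v') * \<delta> \<in> cyclotomic n" using * u'v' uv by (simp add: adjoin.diff_mem)
          ultimately have "\<delta> \<in> cyclotomic n"
            using adjoin.mult_mem_iff[of "v - v'" "{zeta n}" \<delta>] u'v' uv by (simp add: adjoin.diff_mem)
          with False show False ..
        qed
        with * have "u' = u" "v' = v" by simp_all
        then show ?thesis unfolding u'_def v'_def by blast
      qed
      have "u \<in> cyclotomic f" "v \<in> cyclotomic f"
        using uv nN fixed by (auto intro!: galois_conj_fixed_imp[OF N(1,2)])
      then have "u \<in> cyclotomic (gcd f n)" "v \<in> cyclotomic (gcd f n)"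
        using uv cyclotomic_Int[OF assms(1,2)] by blast+
      then show ?thesis
        unfolding uv(1) using sub by (intro adjoin.add_mem adjoin.mult_mem in_adjoin[of \<delta>]) auto
    qed
  qed
qed

text \<open>In \<open>x = u + v * \<beta>\<close> everything but \<open>\<beta>\<close> lies in the
  cyclotomic field of order \<open>lcm f n\<close>, so \<open>v\<close> vanishes.\<close>

lemma cyclotomic_Int_adjoin_nonmember:
  assumes "f > 0" "n > 0" and \<beta>: "\<beta>\<^sup>2 \<in> cyclotomic n" "\<beta> \<notin> cyclotomic (lcm f n)"
  shows "cyclotomic f \<inter> adjoin {zeta n, \<beta>} = cyclotomic (gcd f n)"
proof
  show "cyclotomic (gcd f n) \<subseteq> cyclotomic f \<inter> adjoin {zeta n, \<beta>}"
    using cyclotomic_Int[OF assms(1,2)] adjoin_mono[of "{zeta n}" "{zeta n, \<beta>}"] by blast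
  show "cyclotomic f \<inter> adjoin {zeta n, \<beta>} \<subseteq> cyclotomic (gcd f n)"
  proof
    fix x assume x: "x \<in> cyclotomic f \<inter> adjoin {zeta n, \<beta>}"
    then obtain u v where uv: "x = u + v * \<beta>" "u \<in> cyclotomic n" "v \<in> cyclotomic n"
      using adjoin_insert_square[OF \<beta>(1)] by (auto simp: insert_commute)
    have "cyclotomic f \<subseteq> cyclotomic (lcm f n)" "cyclotomic n \<subseteq> cyclotomic (lcm f n)"
      using assms(1,2) by (simp_all add: cyclotomic_mono lcm_pos_nat)
    then have mem: "x \<in> cyclotomic (lcm f n)" "u \<in> cyclotomic (lcm f n)" "v \<in> cyclotomic (lcm f n)"
      using x uv by auto
    have "v * \<beta> = x - u" using uv by simp
    then have "v * \<beta> \<in> cyclotomic (lcm f n)" using mem by (simp add: adjoin.diff_mem)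
    then have "v = 0" using mem \<beta>(2) adjoin.mult_mem_iff by blast
    then show "x \<in> cyclotomic (gcd f n)" using uv x cyclotomic_Int[OF assms(1,2)] by auto
  qed
qed


section \<open>Radical extensions\<close>

lemma of_real_of_rat: "of_real (of_rat q) = (of_rat q :: complex)"
  by (cases q) (simp add: of_rat_rat)

text \<open>Up to sign the constant term is the product of the roots with multiplicity; the
  induction splits off one root at a time.\<close>

lemma monic_roots_power:
  fixes p :: "complex poly"
  assumes "lead_coeff p = 1" "\<And>z. poly p z = 0 \<Longrightarrow> z ^ n = c"
  shows "((-1) ^ degree p * poly p 0) ^ n = c ^ degree p"
  using assms
proof (induction "degree p" arbitrary: p)
  case 0
  then show ?case by (auto elim!: degree_eq_zeroE)
next
  case (Suc d)
  then have "\<not> constant (poly p)" by (simp add: constant_degree)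
  then obtain z where z: "poly p z = 0" using fundamental_theorem_of_algebra by blast
  then obtain q where q: "p = [:- z, 1:] * q" by (auto simp: poly_eq_0_iff_dvd elim!: dvdE)
  have q0: "q \<noteq> 0" using Suc.prems(1) q by auto
  have deg: "degree p = Suc (degree q)" unfolding q using q0 by (subst degree_mult_eq) auto
  have "lead_coeff q = 1" using Suc.prems(1) lead_coeff_mult[of "[:- z, 1:]" q] by (simp add: q)
  moreover have "degree q = d" using deg Suc.hyps(2) by simp
  moreover have "y ^ n = c" if "poly q y = 0" for y using Suc.prems(2) that by (simp add: q)
  ultimately have IH: "((-1) ^ degree q * poly q 0) ^ n = c ^ degree q" using Suc.hyps(1) by blast
  have "(-1) ^ degree p * poly p 0 = z * ((-1) ^ degree q * poly q 0)"
    unfolding deg by (simp add: q)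
  then show ?case
    using IH Suc.prems(2)[OF z] by (simp only: power_mult_distrib) (simp add: deg)
qed

text \<open>Every conjugate of \<open>\<alpha>\<close> is \<open>\<alpha>\<close> times an
  \<open>n\<close>-th root of unity. Their product lies in \<open>M\<close> and is
  \<open>\<alpha> ^ degree m\<close> times such a root, which can be removed inside
  \<open>M\<close>.\<close>

lemma radical_degree:
  assumes "field_subset M" "zeta n \<in> M" "n > 0" "\<alpha> ^ n \<in> M" "\<alpha> \<noteq> 0"
    and "is_min_poly M \<alpha> m"
  shows "\<alpha> ^ degree m \<in> M"
proof -
  interpret field_subset M by fact
  have "monom 1 n - [:\<alpha> ^ n:] \<in> polys_over M" using assms(4) by (intro polys_over_diff polys_over_monom) auto
  moreover have "poly (monom 1 n - [:\<alpha> ^ n:]) \<alpha> = 0" by (simp add: poly_monom)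
  ultimately have dvd: "m dvd monom 1 n - [:\<alpha> ^ n:]" using assms(6) by (auto simp: is_min_poly_def)
  have root: "z ^ n = \<alpha> ^ n" if "poly m z = 0" for z
    using poly_dvd_root[OF dvd that] by (simp add: poly_monom)
  define d where "d = degree m"
  define b where "b = (-1) ^ d * poly m 0"
  have b: "b \<in> M" using assms(6) by (auto simp: b_def is_min_poly_def intro!: poly_mem)
  have "b ^ n = (\<alpha> ^ n) ^ d"
    unfolding b_def d_def using monic_roots_power[OF _ root] assms(6) unfolding is_min_poly_def by blast
  then have "b ^ n = (\<alpha> ^ d) ^ n" by (simp add: mult.commute flip: power_mult)
  then have "(b / \<alpha> ^ d) ^ n = 1" using assms(5) by (simp add: power_divide)
  then obtain j where j: "b / \<alpha> ^ d = zeta n ^ j" using root_of_unity_zeta assms(3) by blast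
  then have "\<alpha> ^ d = b / zeta n ^ j" using assms(5) by (auto simp: field_simps)
  then show ?thesis using b assms(2) by (auto simp: d_def[symmetric])
qed

text \<open>The monomials of \<open>p\<close> are sorted by their exponents modulo
  \<open>s\<close>.\<close>

lemma poly_residue_decomposition:
  assumes "ring_subset E" "p \<in> polys_over E" "s > 0"
  shows "\<exists>P. (\<forall>r. P r \<in> polys_over E) \<and> (\<forall>x. poly p x = (\<Sum>r\<in>{..<s}. x ^ r * poly (P r) (x ^ s)))"
  using assms(2)
proof (induction p)
  case 0
  interpret ring_subset E by fact
  show ?case by (intro exI[of _ "\<lambda>_. 0"]) auto
next
  case (pCons a p)
  interpret ring_subset E by fact
  from pCons obtain P where P: "\<And>r. P r \<in> polys_over E"
      "\<And>x. poly p x = (\<Sum>r\<in>{..<s}. x ^ r * poly (P r) (x ^ s))" by auto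
  obtain t where t: "s = Suc t" using assms(3) by (cases s) auto
  \<comment> \<open>Multiplication by \<open>x\<close> shifts the classes cyclically: class
    \<open>t = s - 1\<close> wraps around to class 0 with a factor \<open>x ^ s\<close>, where it
    meets the new constant term.\<close>
  define P' where "P' = (\<lambda>r. if r = 0 then pCons a (P t) else P (r - 1))"
  have "P' r \<in> polys_over E" for r using P(1) pCons.prems by (auto simp: P'_def)
  moreover have "poly (pCons a p) x = (\<Sum>r\<in>{..<s}. x ^ r * poly (P' r) (x ^ s))" for x
  proof -
    have "(\<Sum>r\<in>{..<s}. x ^ r * poly (P' r) (x ^ s)) =
        poly (P' 0) (x ^ s) + (\<Sum>r\<in>{..<t}. x ^ Suc r * poly (P' (Suc r)) (x ^ s))"
      unfolding t by (subst sum.lessThan_Suc_shift) simp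
    also have "\<dots> = a + x ^ s * poly (P t) (x ^ s) + (\<Sum>r\<in>{..<t}. x ^ Suc r * poly (P r) (x ^ s))"
      by (simp add: P'_def)
    also have "\<dots> = a + x * (\<Sum>r\<in>{..<s}. x ^ r * poly (P r) (x ^ s))"
      by (simp add: t sum_distrib_left algebra_simps)
    finally show ?thesis by (simp add: P(2))
  qed
  ultimately show ?case by blast
qed

text \<open>For the least \<open>s\<close> with \<open>\<alpha> ^ s\<close> in \<open>M\<close>, the
  degree of \<open>\<alpha>\<close> over \<open>M\<close> is at least \<open>s\<close>, as
  \<open>\<alpha> ^ degree m\<close> lies in \<open>M\<close>. So the powers of
  \<open>\<alpha>\<close> below \<open>s\<close> are independent over \<open>M\<close>, and in an
  element of \<open>M\<close> only the exponents divisible by \<open>s\<close> contribute.\<close>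

lemma radical_extension_Int:
  assumes "field_subset E" "field_subset M" "E \<subseteq> M" "zeta n \<in> E" "n > 0" "\<alpha> ^ n \<in> E" "\<alpha> \<noteq> 0"
  obtains s where "s > 0" "\<alpha> ^ s \<in> M" "poly_values E \<alpha> \<inter> M \<subseteq> poly_values E (\<alpha> ^ s)"
proof -
  interpret E: field_subset E by fact
  interpret M: field_subset M by fact
  define s where "s = (LEAST j. j > 0 \<and> \<alpha> ^ j \<in> M)"
  have "n > 0 \<and> \<alpha> ^ n \<in> M" using assms by blast
  then have s: "s > 0" "\<alpha> ^ s \<in> M"
    using LeastI[of "\<lambda>j. j > 0 \<and> \<alpha> ^ j \<in> M" n] by (simp_all add: s_def)
  have least: "s \<le> j" if "j > 0" "\<alpha> ^ j \<in> M" for j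
    using Least_le[of "\<lambda>j. j > 0 \<and> \<alpha> ^ j \<in> M" j] that by (simp add: s_def)
  have nz: "monom 1 s - [:\<alpha> ^ s:] \<noteq> 0"
  proof
    assume "monom 1 s - [:\<alpha> ^ s:] = 0"
    then have "poly (monom 1 s - [:\<alpha> ^ s:]) 0 = 0" by simp
    with s(1) assms(7) show False by (simp add: poly_monom power_0_left)
  qed
  have "monom 1 s - [:\<alpha> ^ s:] \<in> polys_over M"
    using s(2) by (intro M.polys_over_diff M.polys_over_monom) auto
  moreover have "poly (monom 1 s - [:\<alpha> ^ s:]) \<alpha> = 0" by (simp add: poly_monom)
  ultimately obtain m where m: "is_min_poly M \<alpha> m" using nz M.min_poly_exists by blast
  have "\<alpha> ^ degree m \<in> M" using assms m by (intro radical_degree[of M n]) auto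
  then have deg: "s \<le> degree m" using least M.min_poly_degree_pos[OF m] by blast
  have "x \<in> poly_values E (\<alpha> ^ s)" if x: "x \<in> poly_values E \<alpha>" "x \<in> M" for x
  proof -
    obtain p where p: "p \<in> polys_over E" "x = poly p \<alpha>" using x(1) by (auto simp: poly_values_def)
    obtain P where P: "\<And>r. P r \<in> polys_over E" "\<And>y. poly p y = (\<Sum>r\<in>{..<s}. y ^ r * poly (P r) (y ^ s))"
      using poly_residue_decomposition[OF E.ring_subset_axioms p(1) s(1)] by blast
    define C where "C = (\<lambda>r. poly (P r) (\<alpha> ^ s))"
    have C: "C r \<in> M" for r
      using P(1) polys_over_mono[OF assms(3)] s(2) by (auto simp: C_def intro!: M.poly_mem)
    define Q where "Q = (\<Sum>r\<in>{..<s}. monom (C r) r) - [:x:]"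
    have "poly Q \<alpha> = 0"
      by (simp add: Q_def poly_sum poly_monom p(2) P(2) C_def mult.commute)
    moreover have "Q \<in> polys_over M"
      unfolding Q_def using C x(2) by (intro M.polys_over_diff M.polys_over_sum M.polys_over_monom) auto
    moreover have "coeff Q i = 0" if "i \<ge> s" for i
      using that s(1) by (simp add: Q_def coeff_sum coeff_pCons split: nat.split)
    then have "degree Q < s" using s(1) by (intro degree_lessI) auto
    ultimately have "Q = 0" using M.min_poly_eq_0[OF m] deg by (meson le_less_trans less_le_trans)
    moreover have "coeff Q 0 = C 0 - x"
      using s(1) by (simp add: Q_def coeff_sum sum.delta)
    ultimately have "x = C 0" by simp
    then show ?thesis using P(1) by (auto simp: C_def poly_values_def)
  qed
  with s that show thesis by blast
qed

text \<open>Dividing both exponents by their gcd gives \<open>q ^ n' = g ^ m'\<close> with coprime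
  exponents. From \<open>m' * u = n' * v + 1\<close> the number \<open>g\<close> itself becomes an
  \<open>n'\<close>-th power, so \<open>n' = 1\<close>.\<close>

lemma power_eq_imp_dvd:
  fixes g q :: rat
  assumes "g > 0" "\<not> (\<exists>r :: rat. \<exists>k :: nat. k \<ge> 2 \<and> g = r ^ k)" "q > 0" "n > 0" "q ^ n = g ^ m"
  shows "n dvd m"
proof -
  define d where "d = gcd n m"
  have d: "d > 0" using assms(4) by (simp add: d_def)
  define n' m' where "n' = n div d" and "m' = m div d"
  have nm: "n = d * n'" "m = d * m'" by (simp_all add: n'_def m'_def d_def)
  have cop: "coprime m' n'"
    using div_gcd_coprime[of m n] assms(4) by (simp add: n'_def m'_def d_def gcd.commute)
  have "(q ^ n') ^ d = (g ^ m') ^ d"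
    using assms(5) by (metis nm mult.commute power_mult)
  then have eq: "q ^ n' = g ^ m'" using d assms by (subst (asm) power_eq_iff_eq_base) auto
  have "n' > 0" using assms(4) nm by auto
  have "\<not> n' \<ge> 2"
  proof
    assume n': "n' \<ge> 2"
    obtain u where "[m' * u = 1] (mod n')"
      using cong_solve_coprime_nat[of m' n'] cop by auto
    then have "(m' * u) mod n' = 1" using n' by (simp add: cong_def)
    then obtain v where v: "m' * u = n' * v + 1" by (metis mult_div_mod_eq)
    have "(q ^ u) ^ n' = (q ^ n') ^ u" by (simp add: mult.commute flip: power_mult)
    also have "\<dots> = g ^ (m' * u)" by (simp add: eq power_mult)
    also have "\<dots> = g * (g ^ v) ^ n'" unfolding v by (simp add: mult.commute flip: power_mult)
    finally have "g = (q ^ u / g ^ v) ^ n'" using assms(1) by (simp add: power_divide)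
    with n' assms(2) show False by blast
  qed
  with \<open>n' > 0\<close> have "n' = 1" by simp
  then show ?thesis by (simp add: nm)
qed

lemma div_gcd_dvd:
  fixes n m s :: nat
  assumes "n dvd m * s" "n > 0"
  shows "n div gcd n m dvd s"
proof -
  define e where "e = gcd n m"
  define n' m' where "n' = n div e" and "m' = m div e"
  have e: "e > 0" using assms(2) by (simp add: e_def)
  have nm: "n = e * n'" "m = e * m'" by (simp_all add: n'_def m'_def e_def)
  have cop: "coprime n' m'"
    using div_gcd_coprime[of n m] assms(2) by (simp add: n'_def m'_def e_def)
  have "e * n' dvd e * (m' * s)" using assms(1) by (simp add: nm mult.assoc)
  then have "n' dvd m' * s" using e by simp
  then show ?thesis using cop by (simp add: coprime_dvd_mult_right_iff n'_def e_def)
qed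

text \<open>The factor \<open>\<eta>\<close> absorbs the sign of the radicand, so that the argument
  on real radicals applies to \<open>r\<close>. The factor 2 in \<open>k\<close> appears because
  that argument makes only the square of \<open>r ^ s\<close> rational.\<close>

lemma cyclotomic_Int_radical:
  fixes g :: rat and r :: real
  assumes "f > 0" "n > 0" and g: "g > 0" "\<not> (\<exists>r :: rat. \<exists>k :: nat. k \<ge> 2 \<and> g = r ^ k)"
    and r: "r > 0" "r ^ n = of_rat g ^ h" and \<eta>: "\<eta> \<in> cyclotomic (2 * n)" "\<eta> ^ n \<in> \<rat>" "\<eta> \<noteq> 0"
    and k: "k = n div gcd n (2 * h)"
  shows "cyclotomic f \<inter> adjoin {zeta n, \<eta> * of_real r} =
    cyclotomic f \<inter> adjoin {zeta n, (\<eta> * of_real r) ^ k}"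
proof
  define \<alpha> where "\<alpha> = \<eta> * complex_of_real r"
  have \<alpha>0: "\<alpha> \<noteq> 0" using r(1) \<eta>(3) by (simp add: \<alpha>_def)
  have rn: "complex_of_real r ^ n = of_rat (g ^ h)"
    using r(2) by (metis of_rat_power of_real_of_rat of_real_power)
  show "cyclotomic f \<inter> adjoin {zeta n, \<alpha> ^ k} \<subseteq> cyclotomic f \<inter> adjoin {zeta n, \<alpha>}"
    using in_adjoin[of _ "{zeta n, \<alpha>}"] adjoin.power_mem
    by (intro Int_mono subset_refl) (auto simp: adjoin_subset_iff)
  show "cyclotomic f \<inter> adjoin {zeta n, \<alpha>} \<subseteq> cyclotomic f \<inter> adjoin {zeta n, \<alpha> ^ k}"
  proof
    fix x assume x: "x \<in> cyclotomic f \<inter> adjoin {zeta n, \<alpha>}"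
    define N where "N = lcm f n"
    have N: "N > 0" "f dvd N" "n dvd N" using assms by (auto simp: N_def lcm_pos_nat)
    have fN: "cyclotomic f \<subseteq> cyclotomic N" and nN: "cyclotomic n \<subseteq> cyclotomic N"
      using N by (simp_all add: cyclotomic_mono)
    have \<alpha>n: "\<alpha> ^ n \<in> \<rat>" using \<eta>(2) by (simp add: \<alpha>_def power_mult_distrib rn)
    then have \<alpha>n': "\<alpha> ^ n \<in> cyclotomic n" using adjoin.Rats_subset by blast
    have adj: "adjoin {zeta n, \<beta>} = poly_values (cyclotomic n) \<beta>"
      if "\<beta> ^ n \<in> cyclotomic n" "\<beta> \<noteq> 0" for \<beta>
    proof -
      have "monom 1 n - [:\<beta> ^ n:] \<noteq> 0"
      proof
        assume "monom 1 n - [:\<beta> ^ n:] = 0"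
        then have "poly (monom 1 n - [:\<beta> ^ n:]) 0 = 0" by simp
        with assms(2) that(2) show False by (simp add: poly_monom power_0_left)
      qed
      moreover have "monom 1 n - [:\<beta> ^ n:] \<in> polys_over (cyclotomic n)"
        using that(1) by (intro adjoin.polys_over_diff adjoin.polys_over_monom) auto
      ultimately show ?thesis
        using adjoin_insert[of "monom 1 n - [:\<beta> ^ n:]" "{zeta n}" \<beta>]
        by (simp add: poly_monom insert_commute)
    qed
    obtain s where s: "s > 0" "\<alpha> ^ s \<in> cyclotomic N"
        "poly_values (cyclotomic n) \<alpha> \<inter> cyclotomic N \<subseteq> poly_values (cyclotomic n) (\<alpha> ^ s)"
      using radical_extension_Int[OF field_subset_adjoin field_subset_adjoin nN in_adjoin assms(2) \<alpha>n' \<alpha>0]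
      by auto
    have "(\<alpha> ^ s) ^ n = (\<alpha> ^ n) ^ s" by (simp add: mult.commute flip: power_mult)
    then have "(\<alpha> ^ s) ^ n \<in> cyclotomic n" using \<alpha>n' by (simp add: adjoin.power_mem)
    then have x_s: "x \<in> adjoin {zeta n, \<alpha> ^ s}"
      using x s(3) fN adj[OF \<alpha>n' \<alpha>0] adj[of "\<alpha> ^ s"] \<alpha>0 by auto
    \<comment> \<open>Removing \<open>\<eta> ^ s\<close> may double the order of the cyclotomic
      field; real radicals have rational squares in every order.\<close>
    have "cyclotomic N \<subseteq> cyclotomic (2 * N)" "cyclotomic (2 * n) \<subseteq> cyclotomic (2 * N)"
      using N by (simp_all add: cyclotomic_mono)
    then have "\<alpha> ^ s / \<eta> ^ s \<in> cyclotomic (2 * N)"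
      using s(2) \<eta>(1) by (meson adjoin.divide_mem adjoin.power_mem subsetD)
    then have rs: "complex_of_real (r ^ s) \<in> cyclotomic (2 * N)"
      using \<eta>(3) by (simp add: \<alpha>_def power_mult_distrib)
    have "complex_of_real (r ^ s) ^ n = (complex_of_real r ^ n) ^ s"
      by (simp add: mult.commute flip: power_mult)
    then have "complex_of_real (r ^ s) ^ n \<in> \<rat>" by (simp add: rn)
    from real_radical_in_cyclotomic[OF _ rs assms(2) this] N(1)
    have "complex_of_real (r ^ s) ^ 2 \<in> \<rat>" by simp
    then obtain q where q: "complex_of_real (r ^ s) ^ 2 = of_rat q" by (auto elim: Rats_cases)
    then have q': "(r ^ s) ^ 2 = real_of_rat q"
      by (metis of_real_eq_iff of_real_of_rat of_real_power)
    have "real_of_rat q > 0" unfolding q'[symmetric] using r(1) by simp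
    then have "q > 0" by simp
    have "real_of_rat (q ^ n) = (r ^ n) ^ (2 * s)"
      unfolding of_rat_power q'[symmetric] by (simp add: mult_ac flip: power_mult)
    also have "\<dots> = real_of_rat (g ^ (2 * h * s))"
      unfolding r(2) of_rat_power by (simp add: mult_ac flip: power_mult)
    finally have "q ^ n = g ^ (2 * h * s)" by simp
    then have "n dvd 2 * h * s" using power_eq_imp_dvd g \<open>q > 0\<close> assms(2) by blast
    then have "k dvd s" unfolding k using assms(2) by (rule div_gcd_dvd)
    then obtain t where "s = k * t" by auto
    then have s_eq: "\<alpha> ^ s = (\<alpha> ^ k) ^ t" by (simp add: power_mult)
    have "\<alpha> ^ k \<in> adjoin {zeta n, \<alpha> ^ k}" by (simp add: in_adjoin)
    from adjoin.power_mem[OF this, of t]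
    have "adjoin {zeta n, \<alpha> ^ s} \<subseteq> adjoin {zeta n, \<alpha> ^ k}"
      by (simp add: adjoin_subset_iff s_eq in_adjoin)
    with x x_s show "x \<in> cyclotomic f \<inter> adjoin {zeta n, \<alpha> ^ k}" by auto
  qed
qed


section \<open>Quadratic subfields of cyclotomic fields\<close>

text \<open>Both sides are the derivative of \<open>X ^ m - 1\<close> at 1, the left one computed
  from the factorisation.\<close>

lemma prod_one_minus_roots_of_unity:
  assumes "m > 0"
  shows "(\<Prod>j\<in>{1..<m}. 1 - zeta m ^ j) = of_nat m"
proof -
  define A where "A = {z :: complex. z ^ m = 1}"
  have fin: "finite A" using assms finite_roots_unity[of m] by (simp add: A_def)
  have A: "A = (\<lambda>j. zeta m ^ j) ` {..<m}"
  proof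
    show "A \<subseteq> (\<lambda>j. zeta m ^ j) ` {..<m}"
    proof
      fix z assume "z \<in> A"
      then obtain j where "z = zeta m ^ j" using root_of_unity_zeta[of z m] assms by (auto simp: A_def)
      then have "z = zeta m ^ (j mod m)" using assms by (simp add: zeta_power_eq_iff)
      then show "z \<in> (\<lambda>j. zeta m ^ j) ` {..<m}" using assms by auto
    qed
    show "(\<lambda>j. zeta m ^ j) ` {..<m} \<subseteq> A"
    proof clarify
      fix j
      have "(zeta m ^ j) ^ m = (zeta m ^ m) ^ j" by (simp add: mult.commute flip: power_mult)
      then show "zeta m ^ j \<in> A" using assms by (simp add: A_def)
    qed
  qed
  have inj: "inj_on (\<lambda>j. zeta m ^ j) {..<m}"
    using assms by (auto simp: inj_on_def zeta_power_eq_iff cong_def)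
  have "rsquarefree (monom 1 m - 1 :: complex poly)"
    using assms by (auto simp: rsquarefree_roots poly_monom pderiv_diff pderiv_monom power_0_left)
  from complex_poly_decompose_rsquarefree[OF this]
  have "smult (lead_coeff (monom 1 m - 1)) (\<Prod>z\<in>A. [:-z, 1:]) = monom 1 m - 1"
    by (simp add: A_def poly_monom)
  moreover have "lead_coeff (monom 1 m - 1 :: complex poly) = 1"
  proof -
    have "degree (monom 1 m - 1 :: complex poly) = m"
      using degree_add_eq_left[of "-1" "monom 1 m :: complex poly"] assms
      by (simp add: Polynomial.degree_monom_eq)
    then show ?thesis using assms by simp
  qed
  ultimately have "(\<Prod>z\<in>A. [:-z, 1:]) = monom 1 m - 1" by simp
  also have "(\<Prod>z\<in>A. [:-z, 1:]) = (\<Prod>j\<in>{..<m}. [:- (zeta m ^ j), 1:])"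
    unfolding A by (subst prod.reindex[OF inj]) simp
  also have "{..<m} = insert 0 {1..<m}" using assms by auto
  finally have "[:-1, 1:] * (\<Prod>j\<in>{1..<m}. [:- (zeta m ^ j), 1:]) = monom 1 m - 1" by simp
  then have "poly (pderiv ([:-1, 1:] * (\<Prod>j\<in>{1..<m}. [:- (zeta m ^ j), 1:]))) 1 =
      poly (pderiv (monom 1 m - 1)) 1" by simp
  then show ?thesis
    by (simp add: pderiv_mult pderiv_pCons pderiv_diff pderiv_monom poly_monom poly_prod)
qed

text \<open>An explicit root without Gauss sums: the product of all \<open>1 - zeta m ^ j\<close> is
  \<open>m\<close>, and the factors for \<open>j\<close> and \<open>m - j\<close> combine to the
  negative of a square.\<close>

lemma sqrt_odd_in_cyclotomic:
  "\<exists>y\<in>cyclotomic (2 * k + 1). y\<^sup>2 = (-1) ^ k * of_nat (2 * k + 1)"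
proof -
  define m where "m = 2 * k + 1"
  \<comment> \<open>A square root of \<open>zeta m\<close> inside the field, as
    \<open>2 * (k + 1) = m + 1\<close>.\<close>
  define w where "w = zeta m ^ (k + 1)"
  have m: "m > 0" by (simp add: m_def)
  have w0: "w \<noteq> 0" by (simp add: w_def)
  have "w\<^sup>2 = zeta m ^ ((k + 1) * 2)" unfolding w_def by (rule power_mult[symmetric])
  also have "(k + 1) * 2 = m + 1" by (simp add: m_def)
  finally have w2: "w\<^sup>2 = zeta m" using m by (simp add: power_add)
  define y where "y = (\<Prod>j\<in>{1..k}. w ^ j - inverse w ^ j)"
  have "w \<in> cyclotomic m" unfolding w_def by (intro adjoin.power_mem in_adjoin) simp
  then have y: "y \<in> cyclotomic m"
    unfolding y_def by (intro adjoin.prod_mem adjoin.diff_mem adjoin.power_mem adjoin.inverse_mem)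
  have "of_nat m = (\<Prod>j\<in>{1..<m}. 1 - zeta m ^ j)"
    using prod_one_minus_roots_of_unity[OF m] by simp
  also have "{1..<m} = {1..k} \<union> (\<lambda>j. m - j) ` {1..k}"
  proof
    show "{1..<m} \<subseteq> {1..k} \<union> (\<lambda>j. m - j) ` {1..k}"
    proof
      fix j assume j: "j \<in> {1..<m}"
      show "j \<in> {1..k} \<union> (\<lambda>j. m - j) ` {1..k}"
      proof (cases "j \<le> k")
        case False
        then have "j = m - (m - j)" "m - j \<in> {1..k}" using j by (auto simp: m_def)
        then show ?thesis by blast
      qed (use j in auto)
    qed
  qed (auto simp: m_def)
  also have "(\<Prod>j\<in>\<dots>. 1 - zeta m ^ j) =
      (\<Prod>j\<in>{1..k}. 1 - zeta m ^ j) * (\<Prod>j\<in>(\<lambda>j. m - j) ` {1..k}. 1 - zeta m ^ j)"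
    by (intro prod.union_disjoint) (auto simp: m_def)
  also have "(\<Prod>j\<in>(\<lambda>j. m - j) ` {1..k}. 1 - zeta m ^ j) = (\<Prod>j\<in>{1..k}. 1 - zeta m ^ (m - j))"
    by (subst prod.reindex) (auto simp: inj_on_def m_def)
  also have "(\<Prod>j\<in>{1..k}. 1 - zeta m ^ j) * (\<Prod>j\<in>{1..k}. 1 - zeta m ^ (m - j)) =
      (\<Prod>j\<in>{1..k}. (1 - zeta m ^ j) * (1 - zeta m ^ (m - j)))"
    by (simp add: prod.distrib)
  also have "\<dots> = (\<Prod>j\<in>{1..k}. - ((w ^ j - inverse w ^ j)\<^sup>2))"
  proof (intro prod.cong refl)
    fix j assume j: "j \<in> {1..k}"
    have 1: "zeta m ^ j = (w ^ j)\<^sup>2" by (simp add: mult.commute flip: w2 power_mult)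
    have "zeta m ^ (m - j) * zeta m ^ j = zeta m ^ (m - j + j)" by (rule power_add[symmetric])
    also have "m - j + j = m" using j by (simp add: m_def)
    finally have "zeta m ^ (m - j) * zeta m ^ j = 1" using m by simp
    then have 2: "zeta m ^ (m - j) = inverse ((w ^ j)\<^sup>2)" unfolding 1 using w0 by (simp add: field_simps)
    define v where "v = w ^ j"
    have "v \<noteq> 0" using w0 by (simp add: v_def)
    then show "(1 - zeta m ^ j) * (1 - zeta m ^ (m - j)) = - ((w ^ j - inverse w ^ j)\<^sup>2)"
      unfolding 1 2 power_inverse v_def[symmetric] by (simp add: field_simps power2_eq_square)
  qed
  also have "\<dots> = (-1) ^ k * y\<^sup>2"
    by (simp add: y_def prod_power_distrib flip: prod_uminus)
      (simp add: prod_uminus prod_power_distrib)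
  finally have "y\<^sup>2 = (-1) ^ k * of_nat m" by (simp flip: mult.assoc power_add)
  with y show ?thesis unfolding m_def by blast
qed

text \<open>A subfield contains both square roots of a number or neither, so membership does not
  depend on the branch, and \<open>csqrt\<close> may be treated as multiplicative.\<close>

lemma csqrt_in_adjoin_iff: "y\<^sup>2 = c \<Longrightarrow> csqrt c \<in> adjoin S \<longleftrightarrow> y \<in> adjoin S"
  using adjoin.square_eq_mem[of "csqrt c" y] by simp

lemma csqrt_mult_in_adjoin:
  assumes "csqrt a \<in> adjoin S" "csqrt b \<in> adjoin S"
  shows "csqrt (a * b) \<in> adjoin S"
  using assms by (subst csqrt_in_adjoin_iff[of "csqrt a * csqrt b"]) (auto simp: power_mult_distrib)

lemma csqrt_power_in_adjoin: "csqrt a \<in> adjoin S \<Longrightarrow> csqrt (a ^ k) \<in> adjoin S"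
  by (induction k) (simp_all add: csqrt_mult_in_adjoin)

lemma csqrt_mult_in_adjoin_iff:
  assumes "csqrt a \<in> adjoin S" "a \<noteq> 0"
  shows "csqrt (a * b) \<in> adjoin S \<longleftrightarrow> csqrt b \<in> adjoin S"
  using assms adjoin.mult_mem_iff[of "csqrt a" S "csqrt b"]
  by (subst csqrt_in_adjoin_iff[of "csqrt a * csqrt b"]) (auto simp: power_mult_distrib)

lemma csqrt_square_in_adjoin: "a \<in> adjoin S \<Longrightarrow> csqrt (a\<^sup>2) \<in> adjoin S"
  by (subst csqrt_in_adjoin_iff[of a]) auto

lemma csqrt_four_mult_in_adjoin_iff: "csqrt (4 * a) \<in> adjoin S \<longleftrightarrow> csqrt a \<in> adjoin S"
  using csqrt_square_in_adjoin[of 2 S] adjoin.of_nat_mem[of 2 S]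
  by (intro csqrt_mult_in_adjoin_iff) auto

text \<open>The sign in \<open>sqrt_odd_in_cyclotomic\<close> is the one that makes the radicand 1
  modulo 4.\<close>

lemma sqrt_1_mod_4_in_cyclotomic:
  assumes "s mod 4 = (1 :: int)"
  shows "csqrt (of_int s) \<in> cyclotomic (nat \<bar>s\<bar>)"
proof -
  define k where "k = nat ((\<bar>s\<bar> - 1) div 2)"
  have odd: "odd s" using assms by presburger
  then have "odd \<bar>s\<bar>" by simp
  then obtain t where t: "\<bar>s\<bar> = 2 * t + 1" by (elim oddE)
  moreover from this have "t \<ge> 0" by linarith
  ultimately have abs: "\<bar>s\<bar> = 2 * int k + 1" by (simp add: k_def)
  have "s = (-1) ^ k * \<bar>s\<bar>"
  proof (cases "s > 0")
    case True
    then have "s = 2 * int k + 1" using abs by simp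
    with assms have "even k" by presburger
    with True show ?thesis by simp
  next
    case False
    then have "s = - (2 * int k + 1)" using abs by simp
    with assms have "odd k" by presburger
    with False show ?thesis by simp
  qed
  then have s: "s = (-1) ^ k * (2 * int k + 1)" using abs by simp
  obtain y where y: "y \<in> cyclotomic (2 * k + 1)" "y\<^sup>2 = (-1) ^ k * of_nat (2 * k + 1)"
    using sqrt_odd_in_cyclotomic by blast
  have "nat \<bar>s\<bar> = 2 * k + 1" using abs by simp
  moreover have "y\<^sup>2 = of_int s" using y(2) s by simp
  ultimately show ?thesis using y(1) csqrt_in_adjoin_iff by metis
qed

lemma csqrt_minus_1_in_cyclotomic_4: "csqrt (- 1) \<in> cyclotomic 4"
  by (subst csqrt_in_adjoin_iff[of \<i>]) (auto intro: in_adjoin)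

lemma csqrt_2_in_cyclotomic_8: "csqrt 2 \<in> cyclotomic 8"
proof (subst csqrt_in_adjoin_iff)
  have "zeta 8 ^ 2 = \<i>" using zeta_power_div[of 4 8] by simp
  then show "(zeta 8 + inverse (zeta 8))\<^sup>2 = 2"
    by (simp add: power2_sum power_inverse)
  show "zeta 8 + inverse (zeta 8) \<in> cyclotomic 8"
    by (intro adjoin.add_mem adjoin.inverse_mem in_adjoin) auto
qed

text \<open>For \<open>D = 4 * s\<close> the field contains \<i>, so the sign of the odd part of
  \<open>s\<close> does not matter; for even \<open>s\<close> it contains \<open>zeta 8\<close> and
  with it \<surd>2. In this generality the lemma also covers the two factors of a fundamental
  discriminant.\<close>

lemma sqrt_discriminant_in_cyclotomic:
  assumes "D \<noteq> 0" "D mod 4 = 0 \<or> D mod 4 = (1 :: int)"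
  shows "csqrt (of_int D) \<in> cyclotomic (nat \<bar>D\<bar>)"
proof (cases "D mod 4 = 1")
  case False
  then obtain s where s: "D = 4 * s" using assms(2) by auto
  have s0: "s \<noteq> 0" using assms(1) s by simp
  have pos: "nat \<bar>D\<bar> > 0" using assms(1) by simp
  have "\<exists>e o'. s = 2 ^ e * o' \<and> odd o'"
    using s0 multiplicity_decompose'[of s 2] by fastforce
  then obtain e o' where o': "s = 2 ^ e * o'" "odd o'" by blast
  have sub: "cyclotomic (nat \<bar>d\<bar>) \<subseteq> cyclotomic (nat \<bar>D\<bar>)" if "d dvd D" for d
    using that pos by (intro cyclotomic_mono) (auto simp: nat_dvd_iff)
  have i: "csqrt (- 1) \<in> cyclotomic (nat \<bar>D\<bar>)"
    using csqrt_minus_1_in_cyclotomic_4 sub[of 4] s by auto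
  have "csqrt (of_int o') \<in> cyclotomic (nat \<bar>D\<bar>)"
  proof (cases "o' mod 4 = 1")
    case True
    then show ?thesis using sqrt_1_mod_4_in_cyclotomic sub[of o'] s o' by auto
  next
    case False
    then have "(- o') mod 4 = 1" using o'(2) by presburger
    then have "csqrt (of_int (- o')) \<in> cyclotomic (nat \<bar>D\<bar>)"
      using sqrt_1_mod_4_in_cyclotomic[of "- o'"] sub[of "- o'"] s o' by auto
    then show ?thesis using csqrt_mult_in_adjoin[OF i] by force
  qed
  moreover have "csqrt (2 ^ e) \<in> cyclotomic (nat \<bar>D\<bar>)"
  proof (cases "e = 0")
    case False
    then have "(8 :: int) dvd D" unfolding s o' by (cases e) auto
    then have "csqrt 2 \<in> cyclotomic (nat \<bar>D\<bar>)" using csqrt_2_in_cyclotomic_8 sub[of 8] by auto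
    then show ?thesis by (rule csqrt_power_in_adjoin)
  qed auto
  ultimately have "csqrt (of_int s) \<in> cyclotomic (nat \<bar>D\<bar>)"
    using csqrt_mult_in_adjoin o' by simp
  then show ?thesis using csqrt_four_mult_in_adjoin_iff by (simp add: s)
qed (use sqrt_1_mod_4_in_cyclotomic in simp)

lemma rational_sqrt_int:
  fixes y :: "'a::field_char_0"
  assumes "y \<in> \<rat>" "y\<^sup>2 = of_int c"
  obtains z where "c = z\<^sup>2"
proof -
  have "algebraic_int y"
  proof (rule algebraic_int.intros)
    show "lead_coeff [:- of_int c, 0, 1 :: 'a:] = 1" by simp
    show "poly [:- of_int c, 0, 1:] y = 0" using assms(2) by (simp add: power2_eq_square)
  qed (auto simp: coeff_pCons split: nat.splits)
  then have "y \<in> \<int>" using rational_algebraic_int_is_int assms(1) by blast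
  then obtain z where "y = of_int z" by (elim Ints_cases)
  with assms(2) have "of_int c = (of_int (z\<^sup>2) :: 'a)" by simp
  then show thesis using that by (simp only: of_int_eq_iff)
qed

text \<open>The classical discriminant of the field generated by \<surd>s for squarefree
  \<open>s\<close>, with value 1 at \<open>s = 1\<close>.\<close>

definition sqfree_disc :: "int \<Rightarrow> int" where
  "sqfree_disc s = (if s mod 4 = 1 then s else 4 * s)"

lemma csqrt_sqfree_disc_in_adjoin_iff:
  "csqrt (of_int (sqfree_disc s)) \<in> adjoin S \<longleftrightarrow> csqrt (of_int s) \<in> adjoin S"
  by (simp add: sqfree_disc_def csqrt_four_mult_in_adjoin_iff)

text \<open>If \<open>D\<close> did not divide \<open>N\<close>, then \<open>\<surd>s\<close> would lie in \<open>cyclotomic (\<bar>D\<bar> / p)\<close> for a prime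
  \<open>p\<close>, which forces one of \<open>\<surd>(\<plusminus>p)\<close>, \<open>\<i>\<close>, \<open>\<surd>2\<close> into a cyclotomic field that is too small.\<close>

theorem csqrt_in_cyclotomic_imp_dvd:
  assumes sqf: "squarefree s" and N: "N > 0" and mem: "csqrt (of_int s) \<in> cyclotomic N"
  shows "sqfree_disc s dvd int N"
proof (rule ccontr)
  assume ndvd: "\<not> sqfree_disc s dvd int N"
  define D where "D = sqfree_disc s"
  have s0: "s \<noteq> 0" using sqf by auto
  have D0: "D \<noteq> 0" using s0 by (simp add: D_def sqfree_disc_def)
  define d where "d = gcd (nat \<bar>D\<bar>) N"
  have "d dvd nat \<bar>D\<bar>" unfolding d_def by (rule gcd_dvd1)
  then obtain c where c: "nat \<bar>D\<bar> = d * c" by (elim dvdE)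
  have "c \<noteq> 1"
  proof
    assume "c = 1"
    then have "nat \<bar>D\<bar> = d" using c by simp
    moreover have "d dvd N" unfolding d_def by (rule gcd_dvd2)
    ultimately have "nat \<bar>D\<bar> dvd N" by (simp only:)
    then have "D dvd int N" by (simp add: nat_abs_dvd_iff)
    with ndvd show False by (simp add: D_def)
  qed
  then obtain p where p: "prime p" "p dvd c" using prime_factor_nat by blast
  then obtain c' where c': "c = p * c'" by (elim dvdE)
  define M where "M = d * c'"
  have M: "nat \<bar>D\<bar> = p * M" "d dvd M" by (simp_all add: c c' M_def)
  have M0: "M > 0" using M(1) D0 by (intro Nat.gr0I) auto
  have Dmod: "D mod 4 = 0 \<or> D mod 4 = 1" by (auto simp: D_def sqfree_disc_def)
  have "csqrt (of_int s) \<in> cyclotomic (nat \<bar>D\<bar>)"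
    using sqrt_discriminant_in_cyclotomic[OF D0 Dmod] csqrt_sqfree_disc_in_adjoin_iff by (simp add: D_def)
  then have "csqrt (of_int s) \<in> cyclotomic d"
    using cyclotomic_Int[of "nat \<bar>D\<bar>" N] mem N D0 by (auto simp: d_def)
  then have sM: "csqrt (of_int s) \<in> cyclotomic M" using cyclotomic_mono[OF M(2) M0] by blast
  have not_Rats: "csqrt (of_int q) \<notin> \<rat>" if "\<bar>q\<bar> = int p" for q
  proof
    assume "csqrt (of_int q) \<in> \<rat>"
    then obtain z where z: "q = z\<^sup>2" using rational_sqrt_int[of "csqrt (of_int q)" q] by auto
    then have zz: "\<bar>z\<bar> * \<bar>z\<bar> = int p" using that by (simp add: power2_eq_square abs_mult)
    have "prime (int p)" using p(1) by simp
    then have "\<bar>z\<bar> = 1" using zz by (metis abs_ge_zero dvd_triv_left mult_cancel_left1 prime_int_iff mult.right_neutral not_prime_0 mult_zero_left)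
    with zz p(1) show False by auto
  qed
  show False
  proof (cases "p = 2")
    case False
    then have oddp: "odd p" using p(1) prime_odd_nat prime_ge_2_nat by (metis le_neq_implies_less)
    \<comment> \<open>The sign puts \<surd>q into \<open>cyclotomic p\<close>. From
      \<open>D = q * D'\<close> it also lies in \<open>cyclotomic M\<close>, where \<open>p\<close>
      does not divide \<open>M\<close>, so it would be rational.\<close>
    define q where "q = (if p mod 4 = 1 then int p else - int p)"
    have q: "q mod 4 = 1" "\<bar>q\<bar> = int p"
    proof -
      have "p mod 4 = 1 \<or> p mod 4 = 3" using oddp by presburger
      then show "q mod 4 = 1" unfolding q_def by presburger
    qed (auto simp: q_def)
    have np4: "\<not> int p dvd 4"
    proof
      assume "int p dvd 4"
      then have "int p dvd 2 ^ 2" by simp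
      then have "p dvd 2" using p(1) prime_dvd_power_int by (metis int_dvd_int_iff of_nat_numeral prime_nat_int_transfer)
      with \<open>p \<noteq> 2\<close> p(1) show False by (meson primes_dvd_imp_eq two_is_prime_nat)
    qed
    have "int p dvd D" by (metis M(1) dvd_nat_abs_iff dvd_triv_left)
    then have "int p dvd s"
    proof (cases "s mod 4 = 1")
      case False
      assume "int p dvd D"
      then show ?thesis using False np4 p(1) by (simp add: D_def sqfree_disc_def prime_dvd_mult_iff)
    qed (simp add: D_def sqfree_disc_def)
    then have "q dvd s" using q(2) by (metis abs_dvd_iff)
    then obtain s' where s': "s = q * s'" by (elim dvdE)
    have nps': "\<not> int p dvd s'"
    proof
      assume "int p dvd s'"
      then have "q dvd s'" using q(2) by (metis abs_dvd_iff)
      then have "q\<^sup>2 dvd s" by (simp add: s' power2_eq_square)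
      then have "is_unit q" using sqf by (simp add: squarefree_def)
      with q(2) p(1) show False by auto
    qed
    have mod_iff: "s mod 4 = 1 \<longleftrightarrow> s' mod 4 = 1"
      unfolding s' by (subst mod_mult_left_eq[symmetric]) (simp add: q(1))
    define D' where "D' = sqfree_disc s'"
    have DD': "D = q * D'" using mod_iff by (simp add: D_def D'_def sqfree_disc_def s')
    have D'0: "D' \<noteq> 0" using D0 DD' by auto
    have MD': "M = nat \<bar>D'\<bar>"
    proof -
      have "int p * \<bar>D'\<bar> = int p * int M" using M(1) D0 q(2)
        by (metis DD' abs_mult int_nat_eq abs_ge_zero of_nat_mult)
      then show ?thesis using p(1) by auto
    qed
    have "D' mod 4 = 0 \<or> D' mod 4 = 1" by (auto simp: D'_def sqfree_disc_def)
    then have "csqrt (of_int D') \<in> cyclotomic M"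
      unfolding MD' by (rule sqrt_discriminant_in_cyclotomic[OF D'0])
    then have "csqrt (of_int s') \<in> cyclotomic M"
      unfolding D'_def by (simp only: csqrt_sqfree_disc_in_adjoin_iff)
    moreover have "s' \<noteq> 0" using s0 s' by auto
    moreover have "csqrt (of_int s' * of_int q) \<in> cyclotomic M" using sM by (simp add: s' mult.commute)
    ultimately have qM: "csqrt (of_int q) \<in> cyclotomic M"
      using csqrt_mult_in_adjoin_iff by (metis of_int_eq_0_iff)
    have qp: "csqrt (of_int q) \<in> cyclotomic p" using sqrt_1_mod_4_in_cyclotomic[OF q(1)] q(2) by simp
    have "\<not> p dvd M"
    proof
      assume "p dvd M"
      then have "int p dvd D'" using MD' by (metis dvd_nat_abs_iff)
      then have "int p dvd 4 * s'" by (auto simp: D'_def sqfree_disc_def split: if_splits)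
      then show False using nps' np4 p(1) by (simp add: prime_dvd_mult_iff)
    qed
    then have "coprime p M" using p(1) by (rule prime_imp_coprime[rotated])
    then have "cyclotomic p \<inter> cyclotomic M = \<rat>"
      using cyclotomic_Int[of p M] prime_gt_0_nat[OF p(1)] M0 by (simp only: coprime_imp_gcd_eq_1 cyclotomic_1)
    then show False using qM qp not_Rats[OF q(2)] by blast
  next
    case True
    have ns1: "s mod 4 \<noteq> 1"
    proof
      assume "s mod 4 = 1"
      then have "D = s" "odd s" by (simp add: D_def sqfree_disc_def, presburger)
      then have "odd (nat \<bar>D\<bar>)" by (simp add: even_nat_iff)
      with M(1) True show False by simp
    qed
    then have D: "D = 4 * s" by (simp add: D_def sqfree_disc_def)
    have M': "M = 2 * nat \<bar>s\<bar>" using M(1) True D by (simp add: nat_mult_distrib abs_mult)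
    have sub: "cyclotomic (nat \<bar>t\<bar>) \<subseteq> cyclotomic M" if "t dvd 2 * s" for t
    proof (rule cyclotomic_mono[OF _ M0])
      have "int M = \<bar>2 * s\<bar>" using M' by (simp add: abs_mult)
      then have "t dvd int M" using that by (simp only: dvd_abs_iff)
      then show "nat \<bar>t\<bar> dvd M" by simp
    qed
    show False
    proof (cases "even s")
      case False
      \<comment> \<open>\<surd>(-s) lies in \<open>cyclotomic M\<close>, so \<surd>s would bring
        \<i> there; as \<open>M\<close> is twice an odd number, \<i> would lie in
        \<open>cyclotomic 2\<close>.\<close>
      with ns1 have ms: "(- s) mod 4 = 1" by presburger
      then have "csqrt (of_int (- s)) \<in> cyclotomic M"
        using sqrt_1_mod_4_in_cyclotomic[OF ms] sub[of "- s"] by auto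
      moreover have "csqrt (of_int (- s) * (- 1)) \<in> cyclotomic M" using sM by simp
      ultimately have "csqrt (- 1) \<in> cyclotomic M"
        using csqrt_mult_in_adjoin_iff s0 by (metis neg_equal_0_iff_equal of_int_eq_0_iff)
      then have "\<i> \<in> cyclotomic M" by (subst (asm) csqrt_in_adjoin_iff[of \<i>]) auto
      moreover have "\<i> \<in> cyclotomic 4" using in_adjoin[of "zeta 4" "{zeta 4}"] by simp
      moreover have "gcd M 4 = 2"
      proof -
        have "odd (nat \<bar>s\<bar>)" using False by (simp add: even_nat_iff)
        then have "gcd (nat \<bar>s\<bar>) 2 = 1" by simp
        then show ?thesis using gcd_mult_distrib_nat[of 2 "nat \<bar>s\<bar>" 2] M' by simp
      qed
      ultimately have "\<i> \<in> cyclotomic 2" using cyclotomic_Int[of M 4] M0 by auto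
      then show False using zeta_double_notin_cyclotomic[of 2] by simp
    next
      case True
      then obtain s' where s': "s = 2 * s'" by (elim evenE)
      have odd': "odd s'"
      proof
        assume "even s'"
        then have "2\<^sup>2 dvd s" by (auto simp: s')
        then have "is_unit (2 :: int)" using sqf unfolding squarefree_def by blast
        then show False by simp
      qed
      have s'0: "s' \<noteq> 0" using odd' by auto
      \<comment> \<open>With \<surd>s' in \<open>cyclotomic M\<close>, \<surd>s would bring \<surd>2
        there; as \<open>gcd M 8 = 4\<close>, it would lie in \<open>cyclotomic 4\<close>, and
        \<open>zeta 8\<close> with it.\<close>
      have "csqrt (of_int (4 * s')) \<in> cyclotomic (nat \<bar>4 * s'\<bar>)"
        using s'0 by (intro sqrt_discriminant_in_cyclotomic) auto
      then have "csqrt (of_int s') \<in> cyclotomic M"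
        using csqrt_four_mult_in_adjoin_iff sub[of "4 * s'"] by (auto simp: s')
      moreover have "csqrt (of_int s' * 2) \<in> cyclotomic M" using sM by (simp add: s' mult.commute)
      ultimately have 2: "csqrt 2 \<in> cyclotomic M"
        using csqrt_mult_in_adjoin_iff s'0 by (metis of_int_eq_0_iff)
      have "gcd M 8 = 4"
      proof -
        have "odd (nat \<bar>s'\<bar>)" using odd' by (simp add: even_nat_iff)
        then have "gcd (nat \<bar>s'\<bar>) 2 = 1" by simp
        moreover have "M = 4 * nat \<bar>s'\<bar>" using M' s' by (simp add: nat_mult_distrib abs_mult)
        ultimately show ?thesis using gcd_mult_distrib_nat[of 4 "nat \<bar>s'\<bar>" 2] by simp
      qed
      then have "csqrt 2 \<in> cyclotomic 4"
        using cyclotomic_Int[of M 8] M0 2 csqrt_2_in_cyclotomic_8 by auto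
      moreover have "(1 + \<i>) \<in> cyclotomic 4" using in_adjoin[of "zeta 4" "{zeta 4}"] by (intro adjoin.add_mem) auto
      ultimately have "(1 + \<i>) / csqrt 2 \<in> cyclotomic 4" by (intro adjoin.divide_mem)
      moreover have "((1 + \<i>) / csqrt 2)\<^sup>2 = zeta 8 ^ 2"
        using zeta_power_div[of 4 8]
        unfolding power_divide power2_csqrt by (simp add: power2_sum)
      ultimately have "zeta 8 \<in> cyclotomic 4" using adjoin.square_eq_mem by blast
      then show False using zeta_double_notin_cyclotomic[of 4] by simp
    qed
  qed
qed


section \<open>Discriminants of quadratic fields\<close>

lemma det_mat_1: "Determinant.det (mat (Suc 0) (Suc 0) a) = a (0, 0)"
  using det_single[of "mat 1 1 a"] by simp

lemma det_mat_2:
  "Determinant.det (mat 2 2 a) = (a (0, 0) * a (1, 1) - a (0, 1) * a (1, 0) :: 'a::comm_ring_1)"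
proof -
  have "Determinant.det (mat 2 2 a) = (\<Sum>i\<in>{..<2}. mat 2 2 a $$ (i, 0) * cofactor (mat 2 2 a) i 0)"
    by (rule laplace_expansion_column) auto
  also have "{..<2} = {0, 1 :: nat}" by auto
  also have "(\<Sum>i\<in>{0, 1}. mat 2 2 a $$ (i, 0) * cofactor (mat 2 2 a) i 0) =
      a (0, 0) * a (1, 1) - a (0, 1) * a (1, 0)"
    by (simp add: cofactor_def mat_delete_def det_mat_1 mult.commute)
  finally show ?thesis .
qed

lemma squarefree_mult_square_int:
  fixes w :: "'a::field_char_0"
  assumes "squarefree s" "w \<in> \<rat>" "w\<^sup>2 * of_int s \<in> \<int>"
  shows "w \<in> \<int>"
proof -
  obtain a b where ab: "b > 0" "coprime a b" "w = of_int a / of_int b"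
    using assms(2) by (auto elim: Rats_cases')
  obtain c where c: "w\<^sup>2 * of_int s = of_int c" using assms(3) by (elim Ints_cases)
  then have "of_int (a\<^sup>2 * s) = (of_int (c * b\<^sup>2) :: 'a)"
    using ab by (simp add: power_divide field_simps)
  then have "a\<^sup>2 * s = c * b\<^sup>2" by (simp only: of_int_eq_iff)
  then have "b\<^sup>2 dvd a\<^sup>2 * s" by simp
  moreover have "coprime (b\<^sup>2) (a\<^sup>2)" using ab(2) by (simp add: ac_simps)
  ultimately have "b\<^sup>2 dvd s" by (simp add: coprime_dvd_mult_right_iff)
  then have "is_unit b" using assms(1) by (auto simp: squarefree_def)
  then have "b = 1" using ab(1) by simp
  then show ?thesis using ab by simp
qed

lemma square_mod_4_cases:
  fixes x :: int
  obtains y where "even x" "x\<^sup>2 = 4 * y" | y where "odd x" "x\<^sup>2 = 4 * y + 1"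
proof (cases "even x")
  case True
  then obtain k where "x = 2 * k" by (elim evenE)
  then have "x\<^sup>2 = 4 * k\<^sup>2" by (simp add: power2_eq_square)
  with True that show thesis by blast
next
  case False
  then obtain k where "x = 2 * k + 1" by (elim oddE)
  then have "x\<^sup>2 = 4 * (k\<^sup>2 + k) + 1" by (simp add: power2_eq_square algebra_simps)
  with False that show thesis by blast
qed

lemma ring_hom_fixes_Rats:
  assumes "field_subset F"
    and one: "\<phi> 1 = 1" and add: "\<And>x y. x \<in> F \<Longrightarrow> y \<in> F \<Longrightarrow> \<phi> (x + y) = \<phi> x + \<phi> y"
    and mult: "\<And>x y. x \<in> F \<Longrightarrow> y \<in> F \<Longrightarrow> \<phi> (x * y) = \<phi> x * \<phi> y"
    and x: "x \<in> \<rat>"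
  shows "\<phi> x = (x :: complex)"
proof -
  interpret field_subset F by fact
  have zero: "\<phi> 0 = 0" using add[of 0 0] by simp
  have nat: "\<phi> (of_nat k) = of_nat k" for k
    by (induction k) (auto simp: zero one add)
  have int: "\<phi> (of_int k) = of_int k" for k
  proof (cases "k \<ge> 0")
    case True
    then show ?thesis using nat[of "nat k"] by simp
  next
    case False
    then have z: "of_int k + of_nat (nat (- k)) = (0 :: complex)" by simp
    have "\<phi> (of_int k) + of_nat (nat (- k)) = 0"
      using add[OF of_int_mem of_nat_mem, of k "nat (- k)"] by (simp only: z zero nat)
    then show ?thesis using z by (metis add_right_cancel)
  qed
  obtain a b where ab: "b > 0" "x = of_int a / of_int b" using x by (auto elim: Rats_cases')
  have "\<phi> (x * of_int b) = \<phi> x * \<phi> (of_int b)" using x Rats_subset by (intro mult) auto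
  with ab show ?thesis by (simp add: int field_simps)
qed

lemma embeddings_iff:
  "\<phi> \<in> embeddings F \<longleftrightarrow> \<phi> \<in> extensional F \<and> \<phi> 1 = 1 \<and>
    (\<forall>x\<in>F. \<forall>y\<in>F. \<phi> (x + y) = \<phi> x + \<phi> y \<and> \<phi> (x * y) = \<phi> x * \<phi> y)"
  by (auto simp: embeddings_def Ring.ring_hom_def)

section \<open>Embeddings and integers of a quadratic field\<close>

locale quadratic_field =
  fixes \<theta> :: complex and s :: int
  assumes square: "\<theta>\<^sup>2 = of_int s" and irrational: "\<theta> \<notin> \<rat>"
begin

text \<open>The nontrivial automorphism; by \<open>independent\<close> the choice is unique on the
  field, and elsewhere the value is unspecified.\<close>

definition conj :: "complex \<Rightarrow> complex" where
  "conj x = (SOME y. \<exists>u\<in>\<rat>. \<exists>v\<in>\<rat>. x = u + v * \<theta> \<and> y = u - v * \<theta>)"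

lemma field_eq: "adjoin {\<theta>} = {u + v * \<theta> |u v. u \<in> \<rat> \<and> v \<in> \<rat>}"
  using adjoin_insert_square[of \<theta> "{}"] by (simp add: adjoin_empty square)

lemma independent:
  assumes "u \<in> \<rat>" "v \<in> \<rat>" "u' \<in> \<rat>" "v' \<in> \<rat>" "u + v * \<theta> = u' + v' * \<theta>"
  shows "u = u' \<and> v = v'"
proof -
  have *: "(v - v') * \<theta> = u' - u" using assms(5) by (simp add: algebra_simps)
  have "v = v'"
  proof (rule ccontr)
    assume "v \<noteq> v'"
    with * have "\<theta> = (u' - u) / (v - v')" by (simp add: field_simps)
    with assms irrational show False by auto
  qed
  with * show ?thesis by simp
qed

lemma conj_eq:
  assumes "u \<in> \<rat>" "v \<in> \<rat>"
  shows "conj (u + v * \<theta>) = u - v * \<theta>"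
proof -
  have "\<exists>y. \<exists>u'\<in>\<rat>. \<exists>v'\<in>\<rat>. u + v * \<theta> = u' + v' * \<theta> \<and> y = u' - v' * \<theta>" using assms by blast
  from someI_ex[OF this] show ?thesis
    unfolding conj_def using independent assms by blast
qed

lemma theta_in: "\<theta> \<in> adjoin {\<theta>}"
  by (rule in_adjoin) simp

text \<open>An embedding fixes \<rat> and preserves the square of \<open>\<theta>\<close>, so only a
  sign is free.\<close>

lemma embeddings_eq: "embeddings (adjoin {\<theta>}) = {restrict id (adjoin {\<theta>}), restrict conj (adjoin {\<theta>})}"
proof
  define F where "F = adjoin {\<theta>}"
  have F: "field_subset F" unfolding F_def by (rule field_subset_adjoin)
  interpret F: field_subset F by fact
  have RF: "\<rat> \<subseteq> F" by (rule F.Rats_subset)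
  have \<theta>F: "\<theta> \<in> F" unfolding F_def by (rule theta_in)
  show "embeddings (adjoin {\<theta>}) \<subseteq> {restrict id (adjoin {\<theta>}), restrict conj (adjoin {\<theta>})}"
    unfolding F_def[symmetric]
  proof
    fix \<phi> assume "\<phi> \<in> embeddings F"
    then have hom: "\<phi> 1 = 1" "\<And>x y. x \<in> F \<Longrightarrow> y \<in> F \<Longrightarrow> \<phi> (x + y) = \<phi> x + \<phi> y"
        "\<And>x y. x \<in> F \<Longrightarrow> y \<in> F \<Longrightarrow> \<phi> (x * y) = \<phi> x * \<phi> y" and ext: "\<phi> \<in> extensional F"
      by (auto simp: embeddings_iff)
    have rat: "\<phi> x = x" if "x \<in> \<rat>" for x using ring_hom_fixes_Rats[OF F hom that] .
    have val: "\<phi> (u + v * \<theta>) = u + v * \<phi> \<theta>" if "u \<in> \<rat>" "v \<in> \<rat>" for u v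
    proof -
      have "u \<in> F" "v \<in> F" using that RF by auto
      then have "\<phi> (u + v * \<theta>) = \<phi> u + \<phi> v * \<phi> \<theta>" using \<theta>F by (simp add: hom F.mult_mem)
      then show ?thesis using that by (simp add: rat)
    qed
    have "(\<phi> \<theta>)\<^sup>2 = \<phi> (\<theta>\<^sup>2)" using \<theta>F by (simp add: power2_eq_square hom)
    also have "\<dots> = \<theta>\<^sup>2" by (simp add: square rat)
    finally consider "\<phi> \<theta> = \<theta>" | "\<phi> \<theta> = - \<theta>" by (auto simp: power2_eq_iff)
    then show "\<phi> \<in> {restrict id F, restrict conj F}"
    proof cases
      case 1
      have "\<phi> x = restrict id F x" for x
        using val ext 1 by (cases "x \<in> F") (auto simp: F_def field_eq extensional_def)
      then show ?thesis by blast
    next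
      case 2
      have "\<phi> x = restrict conj F x" for x
        using val ext 2 by (cases "x \<in> F") (auto simp: F_def field_eq extensional_def conj_eq)
      then show ?thesis by blast
    qed
  qed
  show "{restrict id (adjoin {\<theta>}), restrict conj (adjoin {\<theta>})} \<subseteq> embeddings (adjoin {\<theta>})"
    unfolding F_def[symmetric]
  proof -
    have "conj (x + y) = conj x + conj y \<and> conj (x * y) = conj x * conj y"
      if xy: "x \<in> F" "y \<in> F" for x y
    proof -
      obtain a b c d where r: "a \<in> \<rat>" "b \<in> \<rat>" "c \<in> \<rat>" "d \<in> \<rat>"
          and eq: "x = a + b * \<theta>" "y = c + d * \<theta>"
        using xy unfolding F_def field_eq by blast
      have "x + y = (a + c) + (b + d) * \<theta>" by (simp add: eq algebra_simps)
      then have 1: "conj (x + y) = (a + c) - (b + d) * \<theta>" using r by (simp only: conj_eq Rats_add)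
      have "x * y = (a * c + b * d * of_int s) + (a * d + b * c) * \<theta>"
        by (simp add: eq flip: square) (simp add: power2_eq_square algebra_simps)
      then have "conj (x * y) = (a * c + b * d * of_int s) - (a * d + b * c) * \<theta>"
        using r by (simp only: conj_eq Rats_add Rats_mult Rats_of_int)
      then have 2: "conj (x * y) = (a - b * \<theta>) * (c - d * \<theta>)"
        by (simp flip: square) (simp add: power2_eq_square algebra_simps)
      have 3: "conj x = a - b * \<theta>" "conj y = c - d * \<theta>"
        using r by (simp_all only: eq conj_eq)
      show ?thesis unfolding 1 2 3 by (simp add: algebra_simps)
    qed
    moreover have "conj 1 = 1" using conj_eq[of 1 0] by simp
    ultimately show "{restrict id F, restrict conj F} \<subseteq> embeddings F"
      by (auto simp: embeddings_iff F.add_mem F.mult_mem)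
  qed
qed

lemma theta_nonzero: "\<theta> \<noteq> 0"
  using irrational by auto

lemma conj_theta: "conj \<theta> = - \<theta>"
  using conj_eq[of 0 1] by simp

lemma restrict_id_neq_conj: "restrict id (adjoin {\<theta>}) \<noteq> restrict conj (adjoin {\<theta>})"
proof
  assume "restrict id (adjoin {\<theta>}) = restrict conj (adjoin {\<theta>})"
  then have "restrict id (adjoin {\<theta>}) \<theta> = restrict conj (adjoin {\<theta>}) \<theta>" by simp
  then have "\<theta> = - \<theta>" using theta_in by (simp only: restrict_apply' id_apply conj_theta)
  then have "2 * \<theta> = 0" by (simp only: eq_neg_iff_add_eq_0 mult_2)
  with theta_nonzero show False by simp
qed

text \<open>The coefficients are the norm and the negated trace. A nonzero rational polynomial of
  degree at most 1 cannot vanish at an irrational number.\<close>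

lemma min_poly:
  assumes "u \<in> \<rat>" "v \<in> \<rat>" "v \<noteq> 0"
  shows "is_min_poly \<rat> (u + v * \<theta>) [:u\<^sup>2 - v\<^sup>2 * of_int s, - 2 * u, 1:]"
proof -
  define x where "x = u + v * \<theta>"
  define m where "m = [:u\<^sup>2 - v\<^sup>2 * of_int s, - 2 * u, 1:]"
  have x: "x \<notin> \<rat>"
  proof
    assume "x \<in> \<rat>"
    then have "(x - u) / v \<in> \<rat>" using assms by auto
    then show False using irrational assms(3) by (simp add: x_def)
  qed
  have m: "m \<in> polys_over \<rat>" "lead_coeff m = 1" using assms by (auto simp: m_def)
  have root: "poly m x = 0"
    by (simp add: m_def x_def flip: square) (simp add: power2_eq_square algebra_simps)
  have "m dvd q" if q: "q \<in> polys_over \<rat>" "poly q x = 0" for q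
  proof -
    have dm: "degree m = 2" by (simp add: m_def)
    obtain a r where ar: "a \<in> polys_over \<rat>" "r \<in> polys_over \<rat>" "q = a * m + r" "degree r < degree m"
      using Rats.polys_over_division[OF q(1) m] dm by auto
    have rx: "poly r x = 0" using q ar root by simp
    have "degree r \<le> 1" using ar(4) dm by simp
    then obtain c d where r: "r = [:c, d:]"
      by (metis degree1_coeffs degree_eq_zeroE le_neq_implies_less less_one pCons_0_0)
    have cd: "c \<in> \<rat>" "d \<in> \<rat>" using ar(2) r by auto
    have "d = 0"
    proof (rule ccontr)
      assume "d \<noteq> 0"
      then have "x = - c / d" using rx r by (simp add: field_simps eq_neg_iff_add_eq_0)
      then show False using x cd by auto
    qed
    then have "r = 0" using rx r by simp
    then show ?thesis by (simp add: ar(3))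
  qed
  with m root show ?thesis by (simp add: is_min_poly_def m_def x_def)
qed

end

text \<open>The definite description requires independence of the basis and of the numbering of the
  embeddings. The length of a basis is no issue, being tied to the number of embeddings.\<close>

lemma field_discriminantI:
  assumes "integral_basis F k \<omega>" "bij_betw \<sigma> {..<k} (embeddings F)"
    and "of_int d = (Determinant.det (mat k k (\<lambda>(i, j). \<sigma> i (\<omega> j))))\<^sup>2"
    and "\<And>k' \<omega>' \<sigma>'. integral_basis F k' \<omega>' \<Longrightarrow> bij_betw \<sigma>' {..<k'} (embeddings F) \<Longrightarrow> k' = k \<Longrightarrow>
      (Determinant.det (mat k' k' (\<lambda>(i, j). \<sigma>' i (\<omega>' j))))\<^sup>2 = of_int d"
  shows "field_discriminant F = d"
  unfolding field_discriminant_def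
proof (rule the_equality)
  show "\<exists>k \<omega> \<sigma>. integral_basis F k \<omega> \<and> bij_betw \<sigma> {..<k} (embeddings F) \<and>
      of_int d = (Determinant.det (mat k k (\<lambda>(i, j). \<sigma> i (\<omega> j))))\<^sup>2"
    using assms(1-3) by blast
  fix d' assume "\<exists>k \<omega> \<sigma>. integral_basis F k \<omega> \<and> bij_betw \<sigma> {..<k} (embeddings F) \<and>
      of_int d' = (Determinant.det (mat k k (\<lambda>(i, j). \<sigma> i (\<omega> j))))\<^sup>2"
  then obtain k' \<omega>' \<sigma>' where *: "integral_basis F k' \<omega>'" "bij_betw \<sigma>' {..<k'} (embeddings F)"
      "of_int d' = (Determinant.det (mat k' k' (\<lambda>(i, j). \<sigma>' i (\<omega>' j))))\<^sup>2" by blast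
  have "k' = k" using bij_betw_same_card[OF *(2)] bij_betw_same_card[OF assms(2)] by simp
  from assms(4)[OF *(1,2) this] *(3) have "of_int d' = (of_int d :: complex)" by simp
  then show "d' = d" by simp
qed

context quadratic_field
begin

text \<open>A change of integral bases has determinant \<open>\<plusminus>1\<close>.\<close>

lemma discriminant:
  assumes \<tau>: "\<tau> = a + b * \<theta>" "a \<in> \<rat>" "b \<in> \<rat>" "b \<noteq> 0" "algebraic_int \<tau>"
    and span: "\<And>x. x \<in> ring_of_integers (adjoin {\<theta>}) \<Longrightarrow> \<exists>y z. x = of_int y + of_int z * \<tau>"
    and d: "of_int d = 4 * b\<^sup>2 * of_int s"
  shows "field_discriminant (adjoin {\<theta>}) = d"
proof -
  define F where "F = adjoin {\<theta>}"
  have F: "field_subset F" unfolding F_def by (rule field_subset_adjoin)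
  interpret F: field_subset F by fact
  have \<tau>F: "\<tau> \<in> F" using \<tau> F.Rats_subset theta_in unfolding F_def[symmetric] by blast
  have ints: "1 \<in> ring_of_integers F" "\<tau> \<in> ring_of_integers F"
    using \<tau>(5) \<tau>F by (auto simp: ring_of_integers_def)
  have indep: "y = y' \<and> z = z'" if eq: "of_int y + of_int z * \<tau> = of_int y' + of_int z' * \<tau>" for y z y' z'
  proof -
    have "(of_int y + of_int z * a) + (of_int z * b) * \<theta> = (of_int y' + of_int z' * a) + (of_int z' * b) * \<theta>"
      using eq by (simp add: \<tau>(1) algebra_simps)
    from independent[OF _ _ _ _ this] \<tau> show ?thesis by auto
  qed
  have conj: "conj (of_int y + of_int z * \<tau>) = of_int y + of_int z * (\<tau> - 2 * b * \<theta>)" for y z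
  proof -
    have "of_int y + of_int z * \<tau> = (of_int y + of_int z * a) + (of_int z * b) * \<theta>"
      by (simp add: \<tau>(1) algebra_simps)
    then have "conj (of_int y + of_int z * \<tau>) = (of_int y + of_int z * a) - (of_int z * b) * \<theta>"
      using \<tau> by (simp only: conj_eq Rats_add Rats_mult Rats_of_int)
    then show ?thesis by (simp add: \<tau>(1) algebra_simps)
  qed
  have lessThan2: "{..<2} = {0, 1 :: nat}" by auto
  define \<omega> where "\<omega> = (\<lambda>j :: nat. if j = 0 then 1 else \<tau>)"
  define \<sigma> where "\<sigma> = (\<lambda>i :: nat. if i = 0 then restrict id F else restrict conj F)"
  have basis: "integral_basis F 2 \<omega>"
    unfolding integral_basis_def
  proof (intro conjI allI impI ballI)
    show "\<omega> j \<in> ring_of_integers F" for j using ints by (simp add: \<omega>_def)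
    fix x assume "x \<in> ring_of_integers F"
    then obtain y z where x: "x = of_int y + of_int z * \<tau>" using span unfolding F_def by blast
    show "\<exists>!c :: nat \<Rightarrow> int. c \<in> extensional {..<2} \<and> x = (\<Sum>j<2. of_int (c j) * \<omega> j)"
    proof (rule ex1I[of _ "restrict (\<lambda>j. if j = 0 then y else z) {..<2}"])
      fix c :: "nat \<Rightarrow> int" assume c: "c \<in> extensional {..<2} \<and> x = (\<Sum>j<2. of_int (c j) * \<omega> j)"
      then have "of_int y + of_int z * \<tau> = of_int (c 0) + of_int (c 1) * \<tau>"
        by (simp add: lessThan2 \<omega>_def x)
      from indep[OF this] have "c 0 = y" "c 1 = z" by simp_all
      with c show "c = restrict (\<lambda>j. if j = 0 then y else z) {..<2}"
        by (intro extensionalityI[of _ "{..<2}"]) (auto simp: lessThan2)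
    qed (simp add: lessThan2 \<omega>_def x)
  qed
  have bij: "bij_betw \<sigma> {..<2} (embeddings F)"
    using restrict_id_neq_conj
    by (auto simp: bij_betw_def inj_on_def lessThan2 \<sigma>_def embeddings_eq F_def)
  \<comment> \<open>\<open>2 * b * \<theta>\<close> is \<open>\<tau>\<close> minus its conjugate, up
    to sign the determinant for the basis 1, \<open>\<tau>\<close>.\<close>
  have d': "of_int d = (2 * b * \<theta>)\<^sup>2" by (simp add: d power_mult_distrib square)
  show "field_discriminant (adjoin {\<theta>}) = d"
    unfolding F_def[symmetric]
  proof (rule field_discriminantI[OF basis bij])
    have "conj 1 = 1" "conj \<tau> = \<tau> - 2 * b * \<theta>" using conj[of 1 0] conj[of 0 1] by simp_all
    then show "of_int d = (Determinant.det (mat 2 2 (\<lambda>(i, j). \<sigma> i (\<omega> j))))\<^sup>2"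
      using \<tau>F by (simp add: det_mat_2 \<sigma>_def \<omega>_def d' power2_commute)
    fix k' \<omega>' \<sigma>' assume basis': "integral_basis F k' \<omega>'" and bij': "bij_betw \<sigma>' {..<k'} (embeddings F)"
      and k': "k' = 2"
    have \<omega>': "\<omega>' 0 \<in> ring_of_integers F" "\<omega>' 1 \<in> ring_of_integers F"
      using basis' k' by (auto simp: integral_basis_def)
    then obtain x0 y0 x1 y1 where w: "\<omega>' 0 = of_int x0 + of_int y0 * \<tau>" "\<omega>' 1 = of_int x1 + of_int y1 * \<tau>"
      using span by (metis F_def)
    have rep: "\<exists>c0 c1. x = of_int c0 * \<omega>' 0 + of_int c1 * \<omega>' 1" if "x \<in> ring_of_integers F" for x
    proof -
      have "\<exists>c :: nat \<Rightarrow> int. x = (\<Sum>j<2. of_int (c j) * \<omega>' j)"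
        using basis' that unfolding integral_basis_def k' by blast
      then show ?thesis by (auto simp: lessThan2)
    qed
    obtain c0 c1 e0 e1 where ce: "1 = of_int c0 * \<omega>' 0 + of_int c1 * \<omega>' 1"
        "\<tau> = of_int e0 * \<omega>' 0 + of_int e1 * \<omega>' 1"
      using rep ints by metis
    have "of_int c0 * \<omega>' 0 + of_int c1 * \<omega>' 1 =
        of_int (c0 * x0 + c1 * x1) + of_int (c0 * y0 + c1 * y1) * \<tau>"
      unfolding w by (simp add: algebra_simps)
    then have "of_int 1 + of_int 0 * \<tau> = of_int (c0 * x0 + c1 * x1) + of_int (c0 * y0 + c1 * y1) * \<tau>"
      by (simp only: ce(1)[symmetric]) simp
    from indep[OF this] have c: "c0 * x0 + c1 * x1 = 1" "c0 * y0 + c1 * y1 = 0" by simp_all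
    have "of_int e0 * \<omega>' 0 + of_int e1 * \<omega>' 1 =
        of_int (e0 * x0 + e1 * x1) + of_int (e0 * y0 + e1 * y1) * \<tau>"
      unfolding w by (simp add: algebra_simps)
    then have "of_int 0 + of_int 1 * \<tau> = of_int (e0 * x0 + e1 * x1) + of_int (e0 * y0 + e1 * y1) * \<tau>"
      by (simp only: ce(2)[symmetric]) simp
    from indep[OF this] have e: "e0 * x0 + e1 * x1 = 0" "e0 * y0 + e1 * y1 = 1" by simp_all
    \<comment> \<open>The two coordinate matrices are inverse to each other, so their integer
      determinants have product 1.\<close>
    have "(c0 * e1 - c1 * e0) * (x0 * y1 - x1 * y0) =
        (c0 * x0 + c1 * x1) * (e0 * y0 + e1 * y1) - (c0 * y0 + c1 * y1) * (e0 * x0 + e1 * x1)"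
      by (simp add: algebra_simps)
    also have "\<dots> = 1" by (simp add: c e)
    finally have "\<bar>x0 * y1 - x1 * y0\<bar> = 1" by (auto simp: zmult_eq_1_iff)
    then have sq: "(x0 * y1 - x1 * y0)\<^sup>2 = 1" by (metis power2_abs power_one)
    have "\<omega>' 0 \<in> F" "\<omega>' 1 \<in> F" using \<omega>' by (auto simp: ring_of_integers_def)
    have img: "\<sigma>' ` {0, 1} = {restrict id F, restrict conj F}"
      using bij' by (simp add: bij_betw_def k' lessThan2 embeddings_eq F_def)
    \<comment> \<open>Interchanging the embeddings changes only the sign of the determinant.\<close>
    then consider "\<sigma>' 0 = restrict id F" "\<sigma>' 1 = restrict conj F" |
        "\<sigma>' 0 = restrict conj F" "\<sigma>' 1 = restrict id F"
      using restrict_id_neq_conj unfolding F_def[symmetric] by (auto simp: doubleton_eq_iff)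
    then have "(Determinant.det (mat 2 2 (\<lambda>(i, j). \<sigma>' i (\<omega>' j))))\<^sup>2 =
        (\<omega>' 0 * conj (\<omega>' 1) - \<omega>' 1 * conj (\<omega>' 0))\<^sup>2"
    proof cases
      case 2
      have "(conj (\<omega>' 0) * \<omega>' 1 - conj (\<omega>' 1) * \<omega>' 0)\<^sup>2 =
          (\<omega>' 0 * conj (\<omega>' 1) - \<omega>' 1 * conj (\<omega>' 0))\<^sup>2"
        by (subst power2_commute) (simp only: mult.commute)
      with 2 show ?thesis
        using \<open>\<omega>' 0 \<in> F\<close> \<open>\<omega>' 1 \<in> F\<close> by (simp add: det_mat_2)
    qed (use \<open>\<omega>' 0 \<in> F\<close> \<open>\<omega>' 1 \<in> F\<close> in \<open>simp add: det_mat_2\<close>)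
    also have "\<omega>' 0 * conj (\<omega>' 1) - \<omega>' 1 * conj (\<omega>' 0) =
        - (of_int (x0 * y1 - x1 * y0) * (2 * b * \<theta>))"
      unfolding w conj by (simp add: algebra_simps)
    also have "(- (of_int (x0 * y1 - x1 * y0) * (2 * b * \<theta>)))\<^sup>2 =
        of_int ((x0 * y1 - x1 * y0)\<^sup>2) * (2 * b * \<theta>)\<^sup>2"
      by (simp only: power2_minus power_mult_distrib of_int_power)
    also have "\<dots> = of_int d" by (simp only: sq d') simp
    finally show "(Determinant.det (mat k' k' (\<lambda>(i, j). \<sigma>' i (\<omega>' j))))\<^sup>2 = of_int d"
      by (simp only: k')
  qed
qed

text \<open>Integers are written as \<open>(t + w * \<theta>) / 2\<close> with trace
  \<open>t\<close>; squarefreeness of \<open>s\<close> makes \<open>w\<close> integral. Integrality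
  of the norm is a congruence modulo 4, which allows odd \<open>t\<close> and \<open>w\<close> only
  if \<open>s\<close> is 1 modulo 4.\<close>

lemma discriminant_squarefree:
  assumes sqf: "squarefree s"
  shows "field_discriminant (adjoin {\<theta>}) = sqfree_disc s"
proof -
  have trace_norm: "\<exists>t w. x = (of_int t + of_int w * \<theta>) / 2 \<and> (t\<^sup>2 - s * w\<^sup>2) mod 4 = 0"
    if x: "x \<in> ring_of_integers (adjoin {\<theta>})" for x
  proof -
    obtain u v where uv: "x = u + v * \<theta>" "u \<in> \<rat>" "v \<in> \<rat>"
      using x by (auto simp: ring_of_integers_def field_eq)
    have alg: "algebraic_int x" using x by (simp add: ring_of_integers_def)
    show ?thesis
    proof (cases "v = 0")
      case True
      then have "x \<in> \<int>" using uv alg rational_algebraic_int_is_int by auto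
      then obtain t where "x = of_int t" by (elim Ints_cases)
      then show ?thesis by (intro exI[of _ "2 * t"] exI[of _ 0]) (simp add: power2_eq_square)
    next
      case False
      from min_poly_algebraic_int[OF alg[unfolded uv(1)] min_poly[OF uv(2,3) False]]
      have "u\<^sup>2 - v\<^sup>2 * of_int s \<in> \<int>" "2 * u \<in> \<int>" using Ints.uminus_mem by force+
      then obtain n t where nt: "u\<^sup>2 - v\<^sup>2 * of_int s = of_int n" "2 * u = of_int t"
        by (auto elim!: Ints_cases)
      have "(2 * v)\<^sup>2 * of_int s = (2 * u)\<^sup>2 - 4 * (u\<^sup>2 - v\<^sup>2 * of_int s)"
        by (simp add: power_mult_distrib algebra_simps)
      then have *: "(2 * v)\<^sup>2 * of_int s = of_int (t\<^sup>2 - 4 * n)" by (simp add: nt)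
      then have "2 * v \<in> \<int>" using squarefree_mult_square_int[OF sqf, of "2 * v"] uv by auto
      then obtain w where w: "2 * v = of_int w" by (elim Ints_cases)
      from * have "w\<^sup>2 * s = t\<^sup>2 - 4 * n" unfolding w
        by (metis of_int_eq_iff of_int_mult of_int_power)
      then have "t\<^sup>2 - s * w\<^sup>2 = 4 * n" by (simp add: mult.commute)
      moreover have "x = (of_int t + of_int w * \<theta>) / 2" by (simp add: uv(1) field_simps flip: nt w)
      ultimately show ?thesis by (intro exI[of _ t] exI[of _ w]) simp
    qed
  qed
  show ?thesis
  proof (cases "s mod 4 = 1")
    case True
    then obtain c where c: "s = 4 * c + 1" by (metis mult_div_mod_eq)
    show ?thesis
    proof (rule discriminant[of "(1 + \<theta>) / 2" "1 / 2" "1 / 2"])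
      show "algebraic_int ((1 + \<theta>) / 2)"
      proof (rule algebraic_int.intros)
        show "lead_coeff [:- of_int c, - 1, 1 :: complex:] = 1" by simp
        have "\<theta> * \<theta> = 4 * of_int c + 1" using square by (simp add: c power2_eq_square)
        then show "poly [:- of_int c, - 1, 1:] ((1 + \<theta>) / 2) = 0"
          by (simp add: field_simps)
      qed (auto simp: coeff_pCons split: nat.splits)
      show "of_int (sqfree_disc s) = 4 * (1 / 2)\<^sup>2 * (of_int s :: complex)"
        using True by (simp add: sqfree_disc_def power2_eq_square)
      fix x assume "x \<in> ring_of_integers (adjoin {\<theta>})"
      from trace_norm[OF this] obtain t w
        where tw: "x = (of_int t + of_int w * \<theta>) / 2" "(t\<^sup>2 - s * w\<^sup>2) mod 4 = 0"
        by (elim exE conjE)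
      have "even (t - w)"
      proof -
        have *: "even z" if "z mod 4 = 0" for z :: int using that by presburger
        have "even (t\<^sup>2 - s * w\<^sup>2)" using tw(2) by (rule *)
        moreover have "odd s" using True by presburger
        ultimately show ?thesis by simp
      qed
      then obtain y where "t - w = 2 * y" by (elim evenE)
      then have "t = 2 * y + w" by simp
      then have "x = of_int y + of_int w * ((1 + \<theta>) / 2)" by (simp add: tw(1) field_simps)
      then show "\<exists>y z. x = of_int y + of_int z * ((1 + \<theta>) / 2)" by blast
    qed (auto simp: field_simps)
  next
    case False
    show ?thesis
    proof (rule discriminant[of \<theta> 0 1])
      show "algebraic_int \<theta>"
      proof (rule algebraic_int.intros)
        show "lead_coeff [:- of_int s, 0, 1 :: complex:] = 1" by simp
        show "poly [:- of_int s, 0, 1:] \<theta> = 0" using square by (simp add: power2_eq_square)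
      qed (auto simp: coeff_pCons split: nat.splits)
      show "of_int (sqfree_disc s) = 4 * 1\<^sup>2 * (of_int s :: complex)"
        using False by (simp add: sqfree_disc_def)
      fix x assume "x \<in> ring_of_integers (adjoin {\<theta>})"
      from trace_norm[OF this] obtain t w
        where tw: "x = (of_int t + of_int w * \<theta>) / 2" "(t\<^sup>2 - s * w\<^sup>2) mod 4 = 0"
        by (elim exE conjE)
      have s4: "s mod 4 \<noteq> 0"
      proof
        assume "s mod 4 = 0"
        then have "2\<^sup>2 dvd s" by (simp add: mod_eq_0_iff_dvd)
        then have "is_unit (2 :: int)" using sqf unfolding squarefree_def by blast
        then show False by simp
      qed
      \<comment> \<open>An odd \<open>w\<close> would make \<open>s\<close> a square modulo 4, hence
        0 or 1, and both residues are excluded.\<close>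
      have "even t \<and> even w"
      proof (cases rule: square_mod_4_cases[of w])
        case w: (1 y)
        then have "s * w\<^sup>2 = 4 * (s * y)" by simp
        moreover have "even a" if "(a - 4 * b) mod 4 = 0" for a b :: int using that by presburger
        ultimately have "even (t\<^sup>2)" using tw(2) by metis
        with w show ?thesis by simp
      next
        case w: (2 y)
        have "s * w\<^sup>2 = 4 * (s * y) + s" unfolding w by (simp add: algebra_simps)
        moreover have "(a - s) mod 4 = 0" if "(a - (4 * b + s)) mod 4 = 0" for a b :: int
          using that by presburger
        ultimately have ts: "(t\<^sup>2 - s) mod 4 = 0" using tw(2) by metis
        have r0: "s mod 4 = 0" if "(4 * a - s) mod 4 = 0" for a using that by presburger
        have r1: "s mod 4 = 1" if "(4 * a + 1 - s) mod 4 = 0" for a using that by presburger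
        show ?thesis
        proof (cases rule: square_mod_4_cases[of t])
          case (1 a)
          have "(4 * a - s) mod 4 = 0" using ts unfolding 1(2) .
          with s4 show ?thesis using r0[of a] by metis
        next
          case (2 a)
          have "(4 * a + 1 - s) mod 4 = 0" using ts unfolding 2(2) .
          with False show ?thesis using r1[of a] by metis
        qed
      qed
      then obtain t' w' where "t = 2 * t'" "w = 2 * w'" by (auto elim!: evenE)
      then have "x = of_int t' + of_int w' * \<theta>" by (simp add: tw(1) field_simps)
      then show "\<exists>y z. x = of_int y + of_int z * \<theta>" by blast
    qed auto
  qed
qed

end

text \<open>This serves the rational squares, whose square roots generate no quadratic
  field.\<close>

lemma field_discriminant_Rats: "field_discriminant \<rat> = 1"
proof -
  have fix_Rats: "\<phi> x = x" if "\<phi> \<in> embeddings \<rat>" "x \<in> \<rat>" for \<phi> x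
    using that ring_hom_fixes_Rats[OF field_subset_Rats, of \<phi> x]
    by (auto simp: embeddings_iff)
  have emb: "embeddings \<rat> = {restrict id \<rat>}"
  proof
    show "embeddings \<rat> \<subseteq> {restrict id \<rat>}"
    proof
      fix \<phi> assume \<phi>: "\<phi> \<in> embeddings \<rat>"
      then have "\<phi> \<in> extensional \<rat>" by (simp add: embeddings_iff)
      then have "\<phi> = restrict id \<rat>"
        by (rule extensionalityI) (simp_all add: fix_Rats[OF \<phi>])
      then show "\<phi> \<in> {restrict id \<rat>}" by simp
    qed
    show "{restrict id \<rat>} \<subseteq> embeddings \<rat>" by (auto simp: embeddings_iff)
  qed
  have lessThan1: "{..<1} = {0 :: nat}" by auto
  have ints: "ring_of_integers \<rat> = \<int>"
    by (auto simp: ring_of_integers_def rational_algebraic_int_is_int int_imp_algebraic_int elim!: Ints_cases)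
  have basis: "integral_basis \<rat> 1 (\<lambda>_. 1)"
    unfolding integral_basis_def ints
  proof (intro conjI allI impI ballI)
    fix x :: complex assume "x \<in> \<int>"
    then obtain y where x: "x = of_int y" by (elim Ints_cases)
    show "\<exists>!c :: nat \<Rightarrow> int. c \<in> extensional {..<1} \<and> x = (\<Sum>j<1. of_int (c j) * 1)"
    proof (rule ex1I[of _ "restrict (\<lambda>_. y) {..<1}"])
      fix c :: "nat \<Rightarrow> int" assume "c \<in> extensional {..<1} \<and> x = (\<Sum>j<1. of_int (c j) * 1)"
      then show "c = restrict (\<lambda>_. y) {..<1}"
        by (intro extensionalityI[of _ "{..<1}"]) (auto simp: x)
    qed (simp add: x)
  qed simp
  have bij: "bij_betw (\<lambda>_. restrict id \<rat>) {..<1 :: nat} (embeddings \<rat>)"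
    by (auto simp: emb bij_betw_def inj_on_def)
  show ?thesis
  proof (rule field_discriminantI[OF basis bij])
    show "of_int 1 = (Determinant.det (mat 1 1 (\<lambda>(i, j). restrict id \<rat> (1 :: complex))))\<^sup>2"
      by (simp add: det_mat_1)
    fix k' \<omega>' \<sigma>' assume basis': "integral_basis \<rat> k' \<omega>'" and bij': "bij_betw \<sigma>' {..<k'} (embeddings \<rat>)"
      and k': "k' = 1"
    have "\<omega>' 0 \<in> \<int>" using basis' by (simp add: integral_basis_def k' ints)
    then obtain w where w: "\<omega>' 0 = of_int w" by (elim Ints_cases)
    have "\<exists>c :: nat \<Rightarrow> int. 1 = (\<Sum>j<1. of_int (c j) * \<omega>' j)"
      using basis' Ints_1 unfolding integral_basis_def k' ints by blast
    then obtain c :: "nat \<Rightarrow> int" where "1 = of_int (c 0) * \<omega>' 0" by (auto simp: lessThan1)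
    then have "of_int 1 = (of_int (c 0 * w) :: complex)" by (simp add: w)
    then have "1 = c 0 * w" by (simp only: of_int_eq_iff)
    then have "\<bar>w\<bar> = 1" by (auto simp: zmult_eq_1_iff)
    then have sq: "w\<^sup>2 = 1" by (metis power2_abs power_one)
    have "\<sigma>' 0 \<in> embeddings \<rat>" using bij' by (auto simp: bij_betw_def k')
    then have "\<sigma>' 0 (\<omega>' 0) = of_int w" using fix_Rats w by simp
    then have "(Determinant.det (mat 1 1 (\<lambda>(i, j). \<sigma>' i (\<omega>' j))))\<^sup>2 = of_int (w\<^sup>2)" by (simp add: det_mat_1)
    then show "(Determinant.det (mat k' k' (\<lambda>(i, j). \<sigma>' i (\<omega>' j))))\<^sup>2 = of_int 1"
      by (simp only: k' sq)
  qed
qed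

text \<open>Numerator times denominator differs from \<open>q\<close> by a rational square.\<close>

lemma squarefree_rat_decompose:
  fixes q :: rat
  assumes "q \<noteq> 0"
  obtains r s where "squarefree s" "q = r\<^sup>2 * of_int s" "r \<noteq> 0"
proof -
  obtain a b where ab: "b \<noteq> 0" "q = of_int a / of_int b" by (metis Rat_cases of_int_0_less_iff Fract_of_int_quotient less_irrefl)
  define s t where "s = squarefree_part (a * b)" and "t = square_part (a * b)"
  have "a * b = s * t\<^sup>2" unfolding s_def t_def by (rule squarefree_decompose)
  then have st: "of_int a * of_int b = (of_int s * (of_int t)\<^sup>2 :: rat)"
    by (metis of_int_mult of_int_power)
  have "q = of_int a * of_int b / (of_int b)\<^sup>2" using ab by (simp add: power2_eq_square)
  then have "q = (of_int t / of_int b)\<^sup>2 * of_int s" by (simp add: st power_divide)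
  moreover from this have "of_int t / of_int b \<noteq> (0 :: rat)" using assms by auto
  moreover have "squarefree s" unfolding s_def by auto
  ultimately show thesis using that by blast
qed

lemma csqrt_of_rat_in_adjoin_iff:
  assumes "q = r\<^sup>2 * of_int s" "r \<noteq> 0"
  shows "csqrt (of_rat q) \<in> adjoin S \<longleftrightarrow> csqrt (of_int s) \<in> adjoin S"
proof -
  have "(of_rat r :: complex) \<in> adjoin S" using adjoin.Rats_subset[of S] by auto
  then have "csqrt ((of_rat r)\<^sup>2) \<in> adjoin S" by (rule csqrt_square_in_adjoin)
  then show ?thesis
    using csqrt_mult_in_adjoin_iff[of "(of_rat r)\<^sup>2" S "of_int s"] assms
    by (simp add: of_rat_mult of_rat_power)
qed

text \<open>If \<surd>s is rational, squarefreeness leaves only \<open>s = 1\<close>.\<close>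

theorem quad_disc_eq:
  assumes "squarefree s" "q = r\<^sup>2 * of_int s" "r \<noteq> 0"
  shows "quad_disc q = sqfree_disc s"
proof -
  have "adjoin {csqrt (of_rat q)} = adjoin {csqrt (of_int s)}"
    using csqrt_of_rat_in_adjoin_iff[OF assms(2,3)] by (intro adjoin_eqI) (auto intro: in_adjoin)
  moreover have "field_discriminant (adjoin {csqrt (of_int s)}) = sqfree_disc s"
  proof (cases "csqrt (of_int s) \<in> \<rat>")
    case True
    then obtain z where z: "s = z\<^sup>2" using rational_sqrt_int[of "csqrt (of_int s)" s] by auto
    then have "is_unit z" using assms(1) by (auto simp: squarefree_def)
    then have "\<bar>z\<bar> = 1" by simp
    then have "s = 1" unfolding z by (metis power2_abs power_one)
    moreover have "adjoin {1} = \<rat>" using adjoin_insert_mem[of 1 "{}"] by (simp add: adjoin_empty)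
    ultimately show ?thesis by (simp add: sqfree_disc_def field_discriminant_Rats)
  next
    case False
    then interpret quadratic_field "csqrt (of_int s)" s by unfold_locales auto
    show ?thesis using discriminant_squarefree[OF assms(1)] .
  qed
  ultimately show ?thesis by (simp add: quad_disc_def)
qed


section \<open>The numbers \<open>\<gamma>\<close>\<close>

lemma odd_part_decompose:
  assumes "f > 0"
  obtains e where "f = 2 ^ e * odd_part f" "odd (odd_part f)"
proof -
  obtain o' where o': "f = 2 ^ nu2 f * o'" "odd o'"
    using multiplicity_decompose'[of f 2] assms by auto
  have "Max {d. odd d \<and> d dvd f} = o'"
  proof (rule Max_eqI)
    show "finite {d. odd d \<and> d dvd f}" using assms by simp
    show "o' \<in> {d. odd d \<and> d dvd f}" using o' by (metis dvd_triv_right mem_Collect_eq)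
    fix d assume "d \<in> {d. odd d \<and> d dvd f}"
    then have d: "odd d" "d dvd 2 ^ nu2 f * o'" using o' by auto
    from d(1) have "coprime d (2 ^ nu2 f)" by simp
    with d(2) have "d dvd o'" by (simp add: coprime_dvd_mult_right_iff)
    moreover have "o' > 0" using o' assms by (intro Nat.gr0I) auto
    ultimately show "d \<le> o'" by (rule dvd_imp_le)
  qed
  with o' that show thesis by (auto simp: odd_part_def)
qed

lemma neg_one_pow_abs [simp]: "\<bar>neg_one_pow k\<bar> = 1" "neg_one_pow k * neg_one_pow k = 1"
  by (simp_all add: neg_one_pow_def)

text \<open>This is the purpose of the signs in \<open>gam\<close>: the square root of a signed odd
  factor lies in the cyclotomic field of that odd order.\<close>

lemma neg_one_pow_mod_4:
  assumes "odd c"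
  shows "(neg_one_pow ((c - 1) div 2) * c) mod 4 = 1"
proof -
  obtain j where j: "c = 2 * j + 1" using assms by (elim oddE)
  then have "(c - 1) div 2 = j" by simp
  moreover have "(2 * j + 1) mod 4 = 1" if "even j" using that by presburger
  moreover have "(- (2 * j + 1)) mod 4 = 1" if "odd j" using that by presburger
  ultimately show ?thesis by (auto simp: neg_one_pow_def j)
qed

lemma int_two_power_dvd_iff: "2 ^ k dvd int m \<longleftrightarrow> 2 ^ k dvd m"
proof -
  have "(2 :: int) ^ k = int (2 ^ k)" by simp
  then show ?thesis by (simp only: of_nat_dvd_iff)
qed

lemma two_power_dvd_lcm:
  fixes f n :: nat
  assumes "2 ^ k dvd lcm f n" "f > 0" "n > 0"
  shows "2 ^ k dvd f \<or> 2 ^ k dvd n"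
proof -
  have "k \<le> nu2 (lcm f n)"
    using assms by (intro multiplicity_geI) (auto simp: lcm_pos_nat)
  also have "nu2 (lcm f n) = max (nu2 f) (nu2 n)"
    using assms by (intro multiplicity_lcm) auto
  finally show ?thesis by (metis le_max_iff_disj multiplicity_dvd')
qed

lemma dvd_lcm_imp_dvd_mult:
  assumes "D dvd int (lcm f n)"
  shows "D dvd int f * int n"
proof -
  have "lcm f n dvd f * n" by (rule lcm_least) simp_all
  then have "int (lcm f n) dvd int (f * n)" by (simp only: of_nat_dvd_iff)
  with assms show ?thesis by (metis dvd_trans of_nat_mult)
qed

lemma dvd_of_two_power_dvd:
  fixes D m :: int
  assumes "D \<noteq> 0" "2 ^ nu2 D dvd m" "D dvd 2 ^ e * m"
  shows "D dvd m"
proof -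
  obtain u where u: "D = 2 ^ nu2 D * u" "odd u"
    using multiplicity_decompose'[of D 2] assms(1) by auto
  have "u dvd 2 ^ e * m" using assms(3) u(1) by (metis dvd_mult_right)
  moreover have cop: "coprime u (2 ^ j)" for j using u(2) by simp
  ultimately have "u dvd m" by (simp add: coprime_dvd_mult_right_iff)
  with assms(2) have "2 ^ nu2 D * u dvd m" using cop[of "nu2 D"] by (intro divides_mult) (auto simp: ac_simps)
  then show ?thesis using u(1) by simp
qed

text \<open>The power of 2 in \<open>D\<close> is not split: it goes entirely to the factor dividing
  \<open>n\<close> or to the one dividing \<open>f\<close>, and the two branches of
  \<open>gam\<close> decide which. The other factor is odd and receives the sign that makes it 1
  modulo 4, so both are 0 or 1 modulo 4.\<close>

lemma gam_factorization:
  assumes "f > 0" "n > 0" and D: "D \<noteq> 0" "D mod 4 = 0 \<or> D mod 4 = 1" "D dvd int (lcm f n)"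
  obtains b where "D = b * gam f D" "gam f D mod 4 = 0 \<or> gam f D mod 4 = 1"
    "b mod 4 = 0 \<or> b mod 4 = 1" "gam f D dvd int f" "b dvd int n"
proof (cases "nu2 f < nu2 D")
  case True
  obtain e where e: "f = 2 ^ e * odd_part f" "odd (odd_part f)" using odd_part_decompose assms(1) .
  define m where "m = gcd (int (odd_part f)) D"
  define \<epsilon> where "\<epsilon> = neg_one_pow ((m - 1) div 2)"
  have \<gamma>: "gam f D = \<epsilon> * m" using True by (simp add: gam_def m_def \<epsilon>_def)
  have "odd m" using e(2) unfolding m_def by (metis dvd_trans even_of_nat gcd_dvd1)
  then have mod1: "gam f D mod 4 = 1" unfolding \<gamma> \<epsilon>_def by (rule neg_one_pow_mod_4)
  obtain D1 where D1: "D = m * D1" unfolding m_def by (meson dvdE gcd_dvd2)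
  obtain o1 where o1: "int (odd_part f) = m * o1" unfolding m_def by (meson dvdE gcd_dvd1)
  have m0: "m \<noteq> 0" using D(1) D1 by auto
  have cop: "coprime D1 o1"
  proof -
    have "coprime (int (odd_part f) div m) (D div m)"
      unfolding m_def using D(1) by (intro div_gcd_coprime) auto
    then show ?thesis using m0 by (simp add: D1 o1 ac_simps)
  qed
  have "even D" using True by (metis not_less_zero not_dvd_imp_multiplicity_0)
  then have "4 dvd D" using D(2) by presburger
  moreover have "coprime 4 m"
  proof -
    have "coprime (2 ^ 2) m" using \<open>odd m\<close> by (simp only: coprime_power_left_iff coprime_left_2_iff_odd) simp
    then show ?thesis by simp
  qed
  ultimately have "4 dvd D1" unfolding D1 by (simp add: coprime_dvd_mult_right_iff)
  have "D dvd int f * int n"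
    using D(3) by (rule dvd_lcm_imp_dvd_mult)
  then have "m * D1 dvd m * (o1 * (2 ^ e * int n))"
    by (subst (asm) e(1)) (simp add: D1 o1 mult_ac)
  then have "D1 dvd o1 * (2 ^ e * int n)" using m0 by simp
  then have D1n: "D1 dvd 2 ^ e * int n" using cop by (simp add: coprime_dvd_mult_right_iff)
  have "D1 \<noteq> 0" using D(1) D1 by auto
  \<comment> \<open>A power of 2 dividing the lcm divides \<open>f\<close> or \<open>n\<close>, and
    the case assumption rules out \<open>f\<close>.\<close>
  have "2 ^ nu2 D1 dvd int n"
  proof -
    have le: "nu2 D1 = nu2 D"
      using \<open>odd m\<close> m0 \<open>D1 \<noteq> 0\<close> by (simp add: D1 prime_elem_multiplicity_mult_distrib not_dvd_imp_multiplicity_0)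
    have "2 ^ nu2 D dvd int (lcm f n)" using multiplicity_dvd D(3) by (rule dvd_trans)
    then have "2 ^ nu2 D dvd lcm f n" by (simp only: int_two_power_dvd_iff)
    then have "2 ^ nu2 D dvd f \<or> 2 ^ nu2 D dvd n" using two_power_dvd_lcm assms(1,2) by blast
    moreover have "\<not> 2 ^ nu2 D dvd f"
    proof
      assume "2 ^ nu2 D dvd f"
      then have "nu2 D \<le> nu2 f" using assms(1) by (intro multiplicity_geI) auto
      with True show False by simp
    qed
    ultimately have "2 ^ nu2 D dvd n" by blast
    then show ?thesis by (simp only: le int_two_power_dvd_iff)
  qed
  then have "D1 dvd int n" using dvd_of_two_power_dvd \<open>D1 \<noteq> 0\<close> D1n by blast
  then have 1: "\<epsilon> * D1 dvd int n" by (simp add: \<epsilon>_def neg_one_pow_def)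
  have "\<epsilon> * D1 * gam f D = (\<epsilon> * \<epsilon>) * (m * D1)" unfolding \<gamma> by (simp only: mult_ac)
  then have 2: "D = \<epsilon> * D1 * gam f D"
    by (simp only: \<epsilon>_def neg_one_pow_abs D1[symmetric] mult_1)
  have 3: "(\<epsilon> * D1) mod 4 = 0" using \<open>4 dvd D1\<close> by (simp add: mod_eq_0_iff_dvd)
  have "m dvd int f" unfolding m_def by (subst (2) e(1)) (simp add: dvd_mult)
  then have 4: "gam f D dvd int f" by (simp add: \<gamma> \<epsilon>_def neg_one_pow_def)
  show thesis by (rule that[OF 2 disjI2[OF mod1] disjI1[OF 3] 4 1])
next
  case False
  define G where "G = gcd (int f) D"
  define b where "b = D div G"
  define \<epsilon> where "\<epsilon> = neg_one_pow ((b - 1) div 2)"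
  have \<gamma>: "gam f D = \<epsilon> * G" using False by (simp add: gam_def G_def b_def \<epsilon>_def)
  have Db: "D = G * b" by (simp add: G_def b_def)
  have G0: "G \<noteq> 0" using D(1) by (simp add: G_def)
  obtain f1 where f1: "int f = G * f1" unfolding G_def by (meson dvdE gcd_dvd1)
  \<comment> \<open>\<open>G\<close> already contains the full power of 2 in
    \<open>D\<close>.\<close>
  have "odd b"
  proof
    assume "even b"
    have "2 ^ nu2 D dvd int f"
      using False by (simp only: int_two_power_dvd_iff) (simp add: multiplicity_dvd')
    moreover have "2 ^ nu2 D dvd D" by (rule multiplicity_dvd)
    ultimately have "2 ^ nu2 D dvd G" by (simp add: G_def)
    with \<open>even b\<close> have "2 ^ Suc (nu2 D) dvd D" unfolding power_Suc2 by (subst (2) Db) (rule mult_dvd_mono)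
    then have "Suc (nu2 D) \<le> nu2 D" using D(1) by (intro multiplicity_geI) auto
    then show False by simp
  qed
  then have b1: "(\<epsilon> * b) mod 4 = 1" unfolding \<epsilon>_def by (rule neg_one_pow_mod_4)
  have "\<epsilon> * b * gam f D = (\<epsilon> * \<epsilon>) * (G * b)" unfolding \<gamma> by (simp only: mult_ac)
  then have D': "D = \<epsilon> * b * gam f D" by (simp only: \<epsilon>_def neg_one_pow_abs Db[symmetric] mult_1)
  have "gam f D mod 4 = ((\<epsilon> * b) mod 4 * gam f D) mod 4" by (simp add: b1)
  also have "\<dots> = (\<epsilon> * b * gam f D) mod 4" by (rule mod_mult_left_eq)
  also have "\<dots> = D mod 4" by (simp only: D'[symmetric])
  finally have "gam f D mod 4 = D mod 4" .
  moreover have "gam f D dvd int f" by (simp add: \<gamma> \<epsilon>_def neg_one_pow_def G_def)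
  moreover have "\<epsilon> * b dvd int n"
  proof -
    have "D dvd int f * int n"
      using D(3) by (rule dvd_lcm_imp_dvd_mult)
    then have "G * b dvd G * (f1 * int n)" by (simp add: Db[symmetric] f1 mult.assoc)
    then have "b dvd f1 * int n" using G0 by simp
    moreover have "coprime b f1"
    proof -
      have "coprime (int f div G) (D div G)"
        unfolding G_def using D(1) by (intro div_gcd_coprime) auto
      then show ?thesis using G0 by (simp add: f1 b_def ac_simps)
    qed
    ultimately have "b dvd int n" by (simp add: coprime_dvd_mult_right_iff)
    then show ?thesis by (simp add: \<epsilon>_def neg_one_pow_def)
  qed
  ultimately show thesis using that[OF D'] D(2) b1 by simp
qed


section \<open>Quadratic extensions of \<open>cyclotomic n\<close>\<close>

text \<open>Only squares are compared, since principal square roots are multiplicative only up to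
  sign.\<close>

lemma adjoin_pair_cong:
  assumes "x\<^sup>2 = (c * y)\<^sup>2" "c \<in> adjoin {z}" "c \<noteq> 0"
  shows "adjoin {z, x} = adjoin {z, y}"
proof -
  have c: "c \<in> adjoin {z, w}" for w
    using assms(2) adjoin_mono[of "{z}" "{z, w}"] by auto
  have "x \<in> adjoin {z, y}"
    using adjoin.square_eq_mem[OF assms(1), of "{z, y}"] c by (auto intro: in_adjoin)
  moreover have "c * y \<in> adjoin {z, x}"
    using adjoin.square_eq_mem[OF assms(1), of "{z, x}"] by (auto intro: in_adjoin)
  then have "y \<in> adjoin {z, x}" using adjoin.mult_mem_iff[OF c assms(3)] by blast
  ultimately show ?thesis by (intro adjoin_eqI) (auto intro: in_adjoin)
qed

lemma adjoin_pair_mem: "x \<in> adjoin {z} \<Longrightarrow> adjoin {z, x} = adjoin {z}"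
  using adjoin_insert_mem[of x "{z}"] by (simp add: insert_commute)

lemma sqfree_disc_props:
  assumes "squarefree s"
  shows "sqfree_disc s \<noteq> 0" "sqfree_disc s mod 4 = 0 \<or> sqfree_disc s mod 4 = 1"
    "nu2 (sqfree_disc s) \<le> 3"
proof -
  have s0: "s \<noteq> 0" using assms by auto
  then show "sqfree_disc s \<noteq> 0" "sqfree_disc s mod 4 = 0 \<or> sqfree_disc s mod 4 = 1"
    by (auto simp: sqfree_disc_def)
  have "nu2 s \<le> 1"
  proof (rule ccontr)
    assume "\<not> nu2 s \<le> 1"
    then have "2\<^sup>2 dvd s" by (intro multiplicity_dvd') simp
    then have "is_unit (2 :: int)" using assms unfolding squarefree_def by blast
    then show False by simp
  qed
  moreover have "nu2 (2 * (2 * s)) = Suc (Suc (nu2 s))"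
    using s0 multiplicity_times_same[of "2 * s" 2] multiplicity_times_same[of s 2] by (simp only:) simp
  then have "nu2 (4 * s) = Suc (Suc (nu2 s))" by (simp only: mult.assoc[symmetric]) simp
  ultimately show "nu2 (sqfree_disc s) \<le> 3" by (auto simp: sqfree_disc_def)
qed

lemma quad_disc_obtain:
  assumes "q \<noteq> 0"
  obtains s t where "squarefree s" "quad_disc q = sqfree_disc s" "t \<noteq> 0"
    "q = t\<^sup>2 * of_int (quad_disc q)"
proof -
  obtain r s where rs: "squarefree s" "q = r\<^sup>2 * of_int s" "r \<noteq> 0"
    using squarefree_rat_decompose[OF assms] .
  have D: "quad_disc q = sqfree_disc s" using quad_disc_eq rs by blast
  have "q = (if s mod 4 = 1 then r else r / 2)\<^sup>2 * of_int (sqfree_disc s)"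
    by (simp add: rs(2) sqfree_disc_def power_divide)
  then show thesis using rs D by (intro that[of s "if s mod 4 = 1 then r else r / 2"]) auto
qed

lemma quad_disc_props:
  assumes "q \<noteq> 0"
  shows "quad_disc q \<noteq> 0" "quad_disc q mod 4 = 0 \<or> quad_disc q mod 4 = 1" "nu2 (quad_disc q) \<le> 3"
  using quad_disc_obtain[OF assms] sqfree_disc_props by metis+

lemma csqrt_rat_in_cyclotomic_iff:
  assumes "q \<noteq> 0" "N > 0"
  shows "csqrt (of_rat q) \<in> cyclotomic N \<longleftrightarrow> quad_disc q dvd int N"
proof -
  obtain s t where st: "squarefree s" "quad_disc q = sqfree_disc s" "t \<noteq> 0"
      "q = t\<^sup>2 * of_int (quad_disc q)"
    using quad_disc_obtain[OF assms(1)] .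
  have "csqrt (of_rat q) \<in> cyclotomic N \<longleftrightarrow> csqrt (of_int (quad_disc q)) \<in> cyclotomic N"
    by (rule csqrt_of_rat_in_adjoin_iff[OF st(4,3)])
  also have "\<dots> \<longleftrightarrow> quad_disc q dvd int N"
  proof
    assume "csqrt (of_int (quad_disc q)) \<in> cyclotomic N"
    then have "csqrt (of_int s) \<in> cyclotomic N" unfolding st(2) by (simp only: csqrt_sqfree_disc_in_adjoin_iff)
    then show "quad_disc q dvd int N" unfolding st(2) by (rule csqrt_in_cyclotomic_imp_dvd[OF st(1) assms(2)])
  next
    assume "quad_disc q dvd int N"
    then have "cyclotomic (nat \<bar>quad_disc q\<bar>) \<subseteq> cyclotomic N"
      using assms(2) by (intro cyclotomic_mono) simp_all
    moreover have "csqrt (of_int (quad_disc q)) \<in> cyclotomic (nat \<bar>quad_disc q\<bar>)"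
      using quad_disc_props[OF assms(1)] by (intro sqrt_discriminant_in_cyclotomic)
    ultimately show "csqrt (of_int (quad_disc q)) \<in> cyclotomic N" by blast
  qed
  finally show ?thesis .
qed

text \<open>The factor \<open>c\<close> is a rational multiple of \<surd>b for the complementary
  factor \<open>b\<close> of the discriminant, which divides \<open>n\<close>.\<close>

lemma gam_quad_disc:
  assumes "q \<noteq> 0" "f > 0" "n > 0" "quad_disc q dvd int (lcm f n)"
  obtains c where "csqrt (of_int (gam f (quad_disc q))) \<in> cyclotomic f"
    "c \<in> cyclotomic n" "c \<noteq> 0" "of_rat q = (c * csqrt (of_int (gam f (quad_disc q))))\<^sup>2"
proof -
  define D where "D = quad_disc q"
  have D: "D \<noteq> 0" "D mod 4 = 0 \<or> D mod 4 = 1" "D dvd int (lcm f n)"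
    using quad_disc_props[OF assms(1)] assms(4) by (simp_all add: D_def)
  obtain b where b: "D = b * gam f D" "gam f D mod 4 = 0 \<or> gam f D mod 4 = 1"
      "b mod 4 = 0 \<or> b mod 4 = 1" "gam f D dvd int f" "b dvd int n"
    using gam_factorization[OF assms(2,3) D] .
  have nz: "b \<noteq> 0" "gam f D \<noteq> 0" using b(1) D(1) by auto
  obtain t where t: "t \<noteq> 0" "q = t\<^sup>2 * of_int D"
    using quad_disc_obtain[OF assms(1)] unfolding D_def by blast
  have "cyclotomic (nat \<bar>gam f D\<bar>) \<subseteq> cyclotomic f" "cyclotomic (nat \<bar>b\<bar>) \<subseteq> cyclotomic n"
    using assms(2,3) b(4,5) by (simp_all add: cyclotomic_mono)
  then have \<gamma>f: "csqrt (of_int (gam f D)) \<in> cyclotomic f" and bn: "csqrt (of_int b) \<in> cyclotomic n"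
    using sqrt_discriminant_in_cyclotomic[OF nz(2) b(2)] sqrt_discriminant_in_cyclotomic[OF nz(1) b(3)]
    by (simp_all only: subset_iff)
  have "of_rat t \<in> cyclotomic n" using adjoin.Rats_subset[of "{zeta n}"] by auto
  then have "of_rat t * csqrt (of_int b) \<in> cyclotomic n" using bn by (rule adjoin.mult_mem)
  moreover have "of_rat t * csqrt (of_int b) \<noteq> 0" using t(1) nz(1) by simp
  moreover have "of_rat q = (of_rat t * csqrt (of_int b) * csqrt (of_int (gam f D)))\<^sup>2"
  proof -
    have "complex_of_rat q = (of_rat t)\<^sup>2 * of_int (b * gam f D)"
      unfolding t(2) b(1)[symmetric] by (simp add: of_rat_mult of_rat_power)
    then show ?thesis by (simp add: power_mult_distrib)
  qed
  ultimately show thesis using that \<gamma>f unfolding D_def by blast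
qed

text \<open>The default value 1 of \<open>gam0\<close> covers two opposite situations: \<surd>q
  already lies in \<open>cyclotomic n\<close>, or it lies outside the cyclotomic field of order
  \<open>lcm f n\<close>.\<close>

lemma cyclotomic_Int_adjoin_csqrt:
  assumes "q \<noteq> 0" "f > 0" "n > 0"
  shows "cyclotomic f \<inter> adjoin {zeta n, csqrt (of_rat q)} =
    adjoin {zeta (gcd f n), csqrt (of_int (gam0 f n (quad_disc q)))}"
proof -
  have sq: "(csqrt (of_rat q))\<^sup>2 \<in> cyclotomic n" using adjoin.Rats_subset[of "{zeta n}"] by auto
  have lcm: "lcm f n > 0" using assms(2,3) by (simp add: lcm_pos_nat)
  consider "\<not> quad_disc q dvd int (lcm f n)" | "quad_disc q dvd int n" |
      "quad_disc q dvd int (lcm f n)" "\<not> quad_disc q dvd int n" by blast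
  then show ?thesis
  proof cases
    case 1
    then have "csqrt (of_rat q) \<notin> cyclotomic (lcm f n)"
      using csqrt_rat_in_cyclotomic_iff[OF assms(1) lcm] by simp
    from cyclotomic_Int_adjoin_nonmember[OF assms(2,3) sq this] 1
    show ?thesis by (simp add: gam0_def adjoin_pair_mem)
  next
    case 2
    then have "csqrt (of_rat q) \<in> cyclotomic n"
      using csqrt_rat_in_cyclotomic_iff[OF assms(1,3)] by simp
    then show ?thesis using 2 cyclotomic_Int[OF assms(2,3)] by (simp add: gam0_def adjoin_pair_mem)
  next
    case 3
    define \<gamma> where "\<gamma> = gam f (quad_disc q)"
    obtain c where c: "csqrt (of_int \<gamma>) \<in> cyclotomic f"
        "c \<in> cyclotomic n" "c \<noteq> 0" "of_rat q = (c * csqrt (of_int \<gamma>))\<^sup>2"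
      using gam_quad_disc[OF assms 3(1)] unfolding \<gamma>_def .
    have "adjoin {zeta n, csqrt (of_rat q)} = adjoin {zeta n, csqrt (of_int \<gamma>)}"
      using c by (intro adjoin_pair_cong) simp_all
    also have "cyclotomic f \<inter> adjoin {zeta n, csqrt (of_int \<gamma>)} =
        adjoin {zeta (gcd f n), csqrt (of_int \<gamma>)}"
      using assms c(1) by (intro cyclotomic_Int_adjoin_root) simp_all
    finally show ?thesis using 3 by (simp add: gam0_def \<gamma>_def)
  qed
qed

section \<open>Adjoining a square root of \<open>zeta n\<close>\<close>

lemma zeta_double_square: "n > 0 \<Longrightarrow> (zeta (2 * n))\<^sup>2 = zeta n"
  using zeta_power_div[of n "2 * n"] by simp

lemma zeta_double_odd_power:
  assumes "n > 0" "odd k"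
  obtains c where "c \<in> cyclotomic n" "c \<noteq> 0" "zeta (2 * n) ^ k = c * zeta (2 * n)"
proof -
  obtain j where j: "k = 2 * j + 1" using assms(2) by (elim oddE)
  have "zeta (2 * n) ^ k = zeta n ^ j * zeta (2 * n)"
    using zeta_double_square[OF assms(1)] by (simp add: j power_mult)
  then show thesis by (intro that[of "zeta n ^ j"]) (auto intro: adjoin.power_mem in_adjoin)
qed

lemma nu2_mult: "a \<noteq> 0 \<Longrightarrow> b \<noteq> 0 \<Longrightarrow> nu2 (a * b :: nat) = nu2 a + nu2 b"
  by (rule prime_elem_multiplicity_mult_distrib) auto

lemma nu2_eq_0_iff: "a \<noteq> 0 \<Longrightarrow> nu2 (a :: nat) = 0 \<longleftrightarrow> odd a"
  using multiplicity_eq_zero_iff[of a "2 :: nat"] by simp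

text \<open>Here \<open>lcm f n\<close> is an odd multiple of \<open>n\<close>, so its field meets
  \<open>cyclotomic (2 * n)\<close> only in \<open>cyclotomic n\<close>.\<close>

lemma zeta_double_notin_lcm:
  assumes "f > 0" "n > 0" "even n" "nu2 f \<le> nu2 n"
  shows "zeta (2 * n) \<notin> cyclotomic (lcm f n)"
proof
  assume z: "zeta (2 * n) \<in> cyclotomic (lcm f n)"
  obtain c where c: "lcm f n = n * c" by (meson dvdE dvd_lcm2)
  have lcm: "lcm f n > 0" using assms(1,2) by (simp add: lcm_pos_nat)
  then have c0: "c \<noteq> 0" using c by auto
  have "nu2 (lcm f n) = max (nu2 f) (nu2 n)"
    using assms(1,2) by (intro multiplicity_lcm) auto
  then have "nu2 c = 0" using assms c0 nu2_mult[of n c] unfolding c by simp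
  then have "odd c" using nu2_eq_0_iff c0 by blast
  then have "gcd c 2 = 1" by simp
  then have "gcd (lcm f n) (2 * n) = n" unfolding c using gcd_mult_distrib_nat[of n c 2] by (simp add: mult.commute)
  moreover have "zeta (2 * n) \<in> cyclotomic (2 * n)" by (rule in_adjoin) simp
  ultimately have "zeta (2 * n) \<in> cyclotomic n"
    using cyclotomic_Int[OF lcm, of "2 * n"] z assms(2) by auto
  then show False using zeta_double_notin_cyclotomic assms(2,3) by blast
qed

text \<open>The first claim puts \<open>zeta (2 * gcd f n)\<close> into \<open>cyclotomic f\<close>;
  the second makes it an odd power of \<open>zeta (2 * n)\<close>, hence equal to it up to a factor
  in \<open>cyclotomic n\<close>.\<close>

lemma double_gcd_props:
  fixes f n :: nat
  assumes "f > 0" "n > 0" "nu2 f > nu2 n"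
  shows "2 * gcd f n dvd f" "odd (n div gcd f n)"
proof -
  define e where "e = gcd f n"
  obtain f' where f': "f = e * f'" unfolding e_def by (meson dvdE gcd_dvd1)
  obtain n' where n': "n = e * n'" unfolding e_def by (meson dvdE gcd_dvd2)
  have nz: "e \<noteq> 0" "f' \<noteq> 0" "n' \<noteq> 0" using assms(1,2) f' n' by auto
  have "nu2 f' > nu2 n'" using assms(3) nu2_mult nz by (simp add: f' n')
  then have "even f'" using nu2_eq_0_iff[OF nz(2)] by linarith
  then show "2 * gcd f n dvd f" unfolding e_def[symmetric] by (subst f') (simp add: mult.commute)
  have "coprime f' n'"
    using div_gcd_coprime[of f n] assms(1) nz f' n' e_def by (metis nonzero_mult_div_cancel_left not_gr0)
  then have "odd n'" using \<open>even f'\<close> by (meson coprime_common_divisor odd_one)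
  then show "odd (n div gcd f n)" using n' nz e_def by (metis nonzero_mult_div_cancel_left)
qed

text \<open>Trading \<open>zeta (2 * n)\<close> for \<open>zeta (2 * gcd f n)\<close> yields a
  generator inside \<open>cyclotomic f\<close>, to which \<open>cyclotomic_Int_adjoin_root\<close>
  applies.\<close>

lemma cyclotomic_Int_adjoin_zeta_double_mult:
  assumes "f > 0" "n > 0" "nu2 f > nu2 n" and y: "y \<in> cyclotomic f" "y\<^sup>2 \<in> cyclotomic n"
    and x: "x = c * y" "c \<in> cyclotomic n" "c \<noteq> 0"
  shows "cyclotomic f \<inter> adjoin {zeta n, zeta (2 * n) * x} =
    adjoin {zeta (gcd f n), zeta (2 * gcd f n) * y}"
proof -
  define d where "d = gcd f n"
  have d: "d > 0" "d dvd n" "2 * d dvd f" "odd (n div d)"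
    using assms(1,2) double_gcd_props[OF assms(1-3)] by (simp_all add: d_def)
  have "zeta (2 * d) = zeta (2 * n) ^ (n div d)"
    using zeta_power_div[of "2 * d" "2 * n"] d assms(2) by (simp add: div_mult_mult1)
  then obtain e where e: "e \<in> cyclotomic n" "e \<noteq> 0" "zeta (2 * d) = e * zeta (2 * n)"
    using zeta_double_odd_power[OF assms(2) d(4)] by metis
  have "adjoin {zeta n, zeta (2 * n) * x} = adjoin {zeta n, zeta (2 * d) * y}"
  proof (rule adjoin_pair_cong)
    show "c / e \<in> cyclotomic n" "c / e \<noteq> 0" using e x by (auto intro: adjoin.divide_mem)
    have "zeta (2 * n) * x = c / e * (zeta (2 * d) * y)"
      unfolding e(3) x(1) using e(2) by simp
    then show "(zeta (2 * n) * x)\<^sup>2 = (c / e * (zeta (2 * d) * y))\<^sup>2" by (simp only:)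
  qed
  also have "cyclotomic f \<inter> adjoin {zeta n, zeta (2 * d) * y} = adjoin {zeta d, zeta (2 * d) * y}"
    unfolding d_def
  proof (rule cyclotomic_Int_adjoin_root[OF assms(1,2)], unfold d_def[symmetric])
    show "zeta (2 * d) * y \<in> cyclotomic f"
      using y(1) zeta_in_cyclotomic[OF d(3) assms(1)] by (intro adjoin.mult_mem)
    have "zeta d \<in> cyclotomic n" using zeta_in_cyclotomic[OF d(2) assms(2)] .
    then show "(zeta (2 * d) * y)\<^sup>2 \<in> cyclotomic n"
      using y(2) zeta_double_square[OF d(1)] by (simp add: power_mult_distrib adjoin.mult_mem)
  qed
  finally show ?thesis by (simp add: d_def)
qed

lemma cyclotomic_Int_adjoin_zeta_double:
  assumes "f > 0" "n > 0"
  shows "cyclotomic f \<inter> adjoin {zeta n, zeta (2 * n)} =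
    (if nu2 f > nu2 n \<and> even n then adjoin {zeta (gcd f n), zeta (2 * gcd f n)}
     else cyclotomic (gcd f n))"
proof -
  consider "odd n" | "even n" "nu2 f > nu2 n" | "even n" "nu2 f \<le> nu2 n" by linarith
  then show ?thesis
  proof cases
    case 1
    \<comment> \<open>For odd \<open>n\<close> the generator is redundant, since the odd power
      \<open>zeta (2 * n) ^ n\<close> is -1.\<close>
    obtain c where c: "c \<in> cyclotomic n" "c \<noteq> 0" "zeta (2 * n) ^ n = c * zeta (2 * n)"
      using zeta_double_odd_power[OF assms(2) 1] .
    then have "zeta (2 * n) = - 1 / c" using zeta_double_power[OF assms(2)] by (simp add: field_simps)
    then have "zeta (2 * n) \<in> cyclotomic n" using c(1) by (auto intro: adjoin.divide_mem)
    then show ?thesis using 1 cyclotomic_Int[OF assms] by (simp add: adjoin_pair_mem)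
  next
    case 2
    then show ?thesis
      using cyclotomic_Int_adjoin_zeta_double_mult[OF assms, of 1 1 1] by simp
  next
    case 3
    have "(zeta (2 * n))\<^sup>2 \<in> cyclotomic n"
      using zeta_double_square[OF assms(2)] by (simp add: in_adjoin)
    from cyclotomic_Int_adjoin_nonmember[OF assms this zeta_double_notin_lcm[OF assms 3]]
    show ?thesis using 3 by simp
  qed
qed

text \<open>If the product lies in the field of order \<open>N = lcm f n\<close>, then \<surd>q lies
  in that of order \<open>2 * N\<close>. The assumption for \<open>nu2 n = 2\<close> then brings
  \<surd>q down to order \<open>N\<close>, and \<open>zeta (2 * n)\<close> with it, so the factors
  can be judged separately.\<close>

lemma cyclotomic_Int_adjoin_zeta_double_csqrt:
  assumes "f > 0" "n > 0" "q \<noteq> 0" "nu2 n \<ge> 2" and 8: "nu2 n = 2 \<Longrightarrow> \<not> 8 dvd quad_disc q"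
  shows "cyclotomic f \<inter> adjoin {zeta n, zeta (2 * n) * csqrt (of_rat q)} =
    (if nu2 f > nu2 n \<and> quad_disc q dvd int (lcm f n)
     then adjoin {zeta (gcd f n), zeta (2 * gcd f n) * csqrt (of_int (gam f (quad_disc q)))}
     else cyclotomic (gcd f n))"
proof (cases "nu2 f > nu2 n \<and> quad_disc q dvd int (lcm f n)")
  case True
  obtain c where c: "csqrt (of_int (gam f (quad_disc q))) \<in> cyclotomic f" "c \<in> cyclotomic n" "c \<noteq> 0"
      "of_rat q = (c * csqrt (of_int (gam f (quad_disc q))))\<^sup>2"
    using gam_quad_disc[OF assms(3,1,2)] True by blast
  define y where "y = csqrt (of_int (gam f (quad_disc q)))"
  have "(csqrt (of_rat q))\<^sup>2 = (c * y)\<^sup>2" using c(4) by (simp add: y_def)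
  then consider "csqrt (of_rat q) = c * y" | "csqrt (of_rat q) = - c * y"
    unfolding power2_eq_iff mult_minus_left by blast
  then obtain c' where c': "csqrt (of_rat q) = c' * y" "c' \<in> cyclotomic n" "c' \<noteq> 0"
    using c(2,3) adjoin.uminus_mem[OF c(2)] by cases (metis neg_equal_0_iff_equal)+
  have "y\<^sup>2 \<in> cyclotomic n" by (simp add: y_def)
  from cyclotomic_Int_adjoin_zeta_double_mult[OF assms(1,2) _ _ this c'] True c(1)
  show ?thesis by (simp add: y_def)
next
  case False
  define N where "N = lcm f n"
  have N: "N > 0" "f dvd N" "n dvd N" using assms(1,2) by (auto simp: N_def lcm_pos_nat)
  define \<beta> where "\<beta> = zeta (2 * n) * csqrt (of_rat q)"
  have "even n" using assms(4) nu2_eq_0_iff[of n] assms(2) by auto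
  have "of_rat q \<in> cyclotomic n" using adjoin.Rats_subset[of "{zeta n}"] by auto
  moreover have "zeta n \<in> cyclotomic n" by (simp add: in_adjoin)
  ultimately have "zeta n * of_rat q \<in> cyclotomic n" by (intro adjoin.mult_mem)
  then have sq: "\<beta>\<^sup>2 \<in> cyclotomic n"
    by (simp add: \<beta>_def power_mult_distrib zeta_double_square[OF assms(2)])
  have "\<beta> \<notin> cyclotomic N"
  proof
    assume \<beta>: "\<beta> \<in> cyclotomic N"
    have "cyclotomic N \<subseteq> cyclotomic (2 * N)" using N(1) by (simp add: cyclotomic_mono)
    moreover have "zeta (2 * n) \<in> cyclotomic (2 * N)" using N by (intro zeta_in_cyclotomic) auto
    ultimately have "csqrt (of_rat q) \<in> cyclotomic (2 * N)"
      using \<beta> adjoin.mult_mem_iff[of "zeta (2 * n)"] unfolding \<beta>_def by auto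
    then have D2: "quad_disc q dvd 2 ^ 1 * int N"
      using csqrt_rat_in_cyclotomic_iff[OF assms(3), of "2 * N"] N(1) by simp
    have nuD: "nu2 (quad_disc q) \<le> 3" using quad_disc_props(3)[OF assms(3)] .
    have nuN: "nu2 N = max (nu2 f) (nu2 n)"
      unfolding N_def using assms(1,2) by (intro multiplicity_lcm) auto
    \<comment> \<open>A discriminant contains at most the factor 8, so this can fail only for
      \<open>nu2 N = 2\<close> with 8 dividing the discriminant.\<close>
    have "nu2 (quad_disc q) \<le> nu2 N"
    proof (cases "nu2 f > nu2 n \<or> nu2 n > 2")
      case True
      then show ?thesis using nuD nuN assms(4) by linarith
    next
      case False
      then have "nu2 n = 2" using assms(4) by linarith
      then have "\<not> 2 ^ 3 dvd quad_disc q" using 8 by simp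
      then have "nu2 (quad_disc q) < 3" by (metis multiplicity_dvd' not_less)
      with \<open>nu2 n = 2\<close> nuN show ?thesis by linarith
    qed
    then have "2 ^ nu2 (quad_disc q) dvd N" by (rule multiplicity_dvd')
    then have "2 ^ nu2 (quad_disc q) dvd int N" by (simp only: int_two_power_dvd_iff)
    then have DN: "quad_disc q dvd int N"
      using dvd_of_two_power_dvd[OF quad_disc_props(1)[OF assms(3)] _ D2] by simp
    then have "csqrt (of_rat q) \<in> cyclotomic N"
      using csqrt_rat_in_cyclotomic_iff[OF assms(3) N(1)] by simp
    moreover have "csqrt (of_rat q) * zeta (2 * n) \<in> cyclotomic N"
      using \<beta> by (simp add: \<beta>_def mult.commute)
    ultimately have "zeta (2 * n) \<in> cyclotomic N"
      using adjoin.mult_mem_iff assms(3) by fastforce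
    moreover have "nu2 f \<le> nu2 n" using False DN by (simp add: N_def)
    ultimately show False
      using zeta_double_notin_lcm[OF assms(1,2) \<open>even n\<close>] by (simp add: N_def)
  qed
  from cyclotomic_Int_adjoin_nonmember[OF assms(1,2) sq this[unfolded N_def]] False
  show ?thesis by (auto simp: \<beta>_def)
qed


section \<open>The Kummer field\<close>

text \<open>The principal logarithm of a negative number has imaginary part \<open>pi\<close>;
  division by \<open>n\<close> gives the angle of \<open>zeta (2 * n)\<close>.\<close>

lemma principal_root:
  assumes "R > 0" "n > 0"
  shows "complex_of_real R powr (1 / of_nat n) = of_real (root n R)"
    and "(- complex_of_real R) powr (1 / of_nat n) = zeta (2 * n) * of_real (root n R)"
proof -
  have root: "complex_of_real (root n R) = exp (of_real (ln R) / of_nat n)"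
    using assms by (simp add: root_powr_inverse powr_def exp_of_real[symmetric] field_simps)
  show "complex_of_real R powr (1 / of_nat n) = of_real (root n R)"
    using assms(1) unfolding root by (simp add: powr_def Ln_of_real)
  have "Ln (- complex_of_real R) = of_real (ln R) + of_real pi * \<i>"
    using Ln_of_real'[of "- R"] assms(1) by simp
  then have "(- complex_of_real R) powr (1 / of_nat n) = exp (of_real pi * \<i> / of_nat n + of_real (ln R) / of_nat n)"
    using assms(1) by (simp add: powr_def add_divide_distrib add.commute)
  also have "\<dots> = zeta (2 * n) * of_real (root n R)"
    unfolding exp_add root zeta_def by simp
  finally show "(- complex_of_real R) powr (1 / of_nat n) = zeta (2 * n) * of_real (root n R)" .
qed

text \<open>By coprimality \<open>nu2 k\<close> or \<open>nu2 c\<close> is 0, and their difference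
  is that of \<open>nu2 n\<close> and \<open>nu2 h + 1\<close>. The parities decide which of
  \<open>zeta (2 * n)\<close> and \<surd>g0 survive.\<close>

lemma nu2_gcd_cofactors:
  fixes n h :: nat
  assumes "n > 0" "h > 0"
  defines "k \<equiv> n div gcd n (2 * h)" and "c \<equiv> (2 * h) div gcd n (2 * h)"
  shows "nu2 n \<le> nu2 h \<Longrightarrow> odd k \<and> even c"
    and "nu2 n > nu2 h \<Longrightarrow> odd c \<and> (odd k \<longleftrightarrow> nu2 n = nu2 h + 1)"
proof -
  define e where "e = gcd n (2 * h)"
  have n: "n = e * k" and h: "2 * h = e * c" by (simp_all add: e_def k_def c_def)
  have nz: "e \<noteq> 0" "k \<noteq> 0" using n assms(1) by auto
  moreover have "c \<noteq> 0" using h assms(2) by (intro notI) simp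
  ultimately have nz: "e \<noteq> 0" "k \<noteq> 0" "c \<noteq> 0" by blast+
  have nu: "nu2 n = nu2 e + nu2 k" unfolding n using nz by (intro nu2_mult)
  have "nu2 (2 * h) = nu2 e + nu2 c" unfolding h using nz by (intro nu2_mult)
  moreover have "nu2 (2 * h) = Suc (nu2 h)" using assms(2) by (intro multiplicity_times_same) auto
  ultimately have nu': "Suc (nu2 h) = nu2 e + nu2 c" by simp
  have "coprime k c" unfolding k_def c_def using assms(1) by (intro div_gcd_coprime) auto
  then have "odd k \<or> odd c" by (meson coprime_common_divisor odd_one)
  then have "nu2 k = 0 \<or> nu2 c = 0" by (simp only: nu2_eq_0_iff[OF nz(2)] nu2_eq_0_iff[OF nz(3)])
  then have "nu2 n \<le> nu2 h \<longrightarrow> nu2 k = 0 \<and> \<not> nu2 c = 0"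
      "nu2 n > nu2 h \<longrightarrow> nu2 c = 0 \<and> (nu2 k = 0 \<longleftrightarrow> nu2 n = nu2 h + 1)"
    using nu nu' by linarith+
  then show "nu2 n \<le> nu2 h \<Longrightarrow> odd k \<and> even c"
    "nu2 n > nu2 h \<Longrightarrow> odd c \<and> (odd k \<longleftrightarrow> nu2 n = nu2 h + 1)"
    unfolding nu2_eq_0_iff[OF nz(2)] nu2_eq_0_iff[OF nz(3)] by simp_all
qed

text \<open>Cancelling the exponent \<open>gcd n (2 * h)\<close> between positive reals gives
  \<open>(r ^ k)\<^sup>2 = g ^ c\<close>, whose root is rational up to at most one factor
  \<surd>g.\<close>

lemma adjoin_radical_power:
  fixes g :: rat and r :: real
  assumes "n > 0" "g > 0" and r: "r > 0" "r ^ n = of_rat g ^ h"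
  defines "k \<equiv> n div gcd n (2 * h)" and "c \<equiv> (2 * h) div gcd n (2 * h)"
  shows "adjoin {zeta n, (\<eta> * of_real r) ^ k} =
    adjoin {zeta n, \<eta> ^ k * (if even c then 1 else csqrt (of_rat g))}"
proof -
  define e where "e = gcd n (2 * h)"
  have n: "n = e * k" and h: "2 * h = e * c" by (simp_all add: e_def k_def c_def)
  have e: "e > 0" using assms(1) by (simp add: e_def)
  have "((r ^ k)\<^sup>2) ^ e = (r ^ n)\<^sup>2" unfolding n by (simp add: mult_ac flip: power_mult)
  also have "\<dots> = real_of_rat g ^ (2 * h)" by (simp add: r(2) mult.commute flip: power_mult)
  also have "\<dots> = (real_of_rat g ^ c) ^ e" unfolding h by (simp add: mult.commute flip: power_mult)
  finally have "(r ^ k)\<^sup>2 = real_of_rat g ^ c"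
    using e assms(2) r(1) by (subst (asm) power_eq_iff_eq_base) auto
  then have "complex_of_real ((r ^ k)\<^sup>2) = of_real (real_of_rat g ^ c)" by (simp only:)
  then have rk: "(of_real r ^ k)\<^sup>2 = (of_rat g :: complex) ^ c" by (simp add: of_real_of_rat)
  show ?thesis
  proof (rule adjoin_pair_cong)
    have g: "of_rat g \<in> cyclotomic n" using adjoin.Rats_subset[of "{zeta n}"] by auto
    then show "of_rat g ^ (c div 2) \<in> cyclotomic n" by (rule adjoin.power_mem)
    show "of_rat g ^ (c div 2) \<noteq> (0 :: complex)" using assms(2) by simp
    have split: "(of_rat g :: complex) ^ c =
        (of_rat g ^ (c div 2) * (if even c then 1 else csqrt (of_rat g)))\<^sup>2"
    proof (cases "even c")
      case True
      then show ?thesis by (simp flip: power_mult)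
    next
      case False
      then obtain j where "c = 2 * j + 1" by (elim oddE)
      then show ?thesis by (simp add: power_mult_distrib mult.commute flip: power_mult)
    qed
    show "((\<eta> * of_real r) ^ k)\<^sup>2 =
        (of_rat g ^ (c div 2) * (\<eta> ^ k * (if even c then 1 else csqrt (of_rat g))))\<^sup>2"
      using rk split by (simp only: power_mult_distrib mult_ac)
  qed
qed

lemma adjoin_zeta_double_odd_power:
  assumes "n > 0" "odd k"
  shows "adjoin {zeta n, zeta (2 * n) ^ k * y} = adjoin {zeta n, zeta (2 * n) * y}"
proof -
  obtain c where "c \<in> cyclotomic n" "c \<noteq> 0" "zeta (2 * n) ^ k = c * zeta (2 * n)"
    using zeta_double_odd_power[OF assms] .
  then show ?thesis by (intro adjoin_pair_cong[of _ c]) (simp_all add: mult.assoc)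
qed

lemma adjoin_zeta_double_even_power:
  assumes "n > 0" "even k"
  shows "adjoin {zeta n, zeta (2 * n) ^ k * y} = adjoin {zeta n, y}"
proof (rule adjoin_pair_cong)
  obtain j where "k = 2 * j" using assms(2) by (elim evenE)
  then have *: "zeta (2 * n) ^ k = zeta n ^ j"
    using zeta_double_square[OF assms(1)] by (simp add: power_mult)
  then show "zeta (2 * n) ^ k \<in> cyclotomic n" by (simp add: adjoin.power_mem in_adjoin)
qed simp_all

text \<open>With \<open>n = 2 * n'\<close> and \<open>n'\<close> odd, \<i> is an odd power of
  \<open>zeta (2 * n)\<close>, so either can replace the other.\<close>

lemma adjoin_zeta_double_csqrt_neg:
  assumes "n > 0" "nu2 n = 1"
  shows "adjoin {zeta n, zeta (2 * n) * csqrt (of_rat q)} = adjoin {zeta n, csqrt (of_rat (- q))}"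
proof -
  obtain n' where n': "n = 2 ^ nu2 n * n'" "odd n'"
    using multiplicity_decompose'[of n 2] assms(1) by auto
  then have "2 * n = 4 * n'" using assms(2) by simp
  then have "zeta (2 * n) ^ n' = \<i>" using zeta_power_div[of 4 "2 * n"] assms(1) by simp
  then obtain c where c: "c \<in> cyclotomic n" "c \<noteq> 0" "\<i> = c * zeta (2 * n)"
    using zeta_double_odd_power[OF assms(1) n'(2)] by metis
  have sq: "(c * zeta (2 * n))\<^sup>2 = - 1" unfolding c(3)[symmetric] by simp
  show ?thesis
  proof (rule adjoin_pair_cong)
    show "1 / c \<in> cyclotomic n" "1 / c \<noteq> 0" using c(1,2) by (auto intro: adjoin.divide_mem)
    have "(zeta (2 * n) * csqrt (of_rat q))\<^sup>2 = (c * zeta (2 * n))\<^sup>2 * of_rat q / c\<^sup>2"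
      using c(2) by (simp add: power_mult_distrib)
    also have "\<dots> = (1 / c * csqrt (of_rat (- q)))\<^sup>2"
      unfolding sq by (simp add: power_mult_distrib power_divide of_rat_minus)
    finally show "(zeta (2 * n) * csqrt (of_rat q))\<^sup>2 = (1 / c * csqrt (of_rat (- q)))\<^sup>2" .
  qed
qed

text \<open>Now \<open>zeta 8\<close> is an odd power of \<open>zeta (2 * n)\<close>, and \<i> lies
  in \<open>cyclotomic n\<close>. As \<open>zeta 8 * (1 - \<i>)\<close> is a square root of 2,
  \<surd>2 can replace \<open>zeta (2 * n)\<close>.\<close>

lemma adjoin_zeta_double_csqrt_double:
  assumes "n > 0" "nu2 n = 2"
  shows "adjoin {zeta n, zeta (2 * n) * csqrt (of_rat q)} = adjoin {zeta n, csqrt (of_rat (2 * q))}"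
proof -
  obtain n' where n': "n = 2 ^ nu2 n * n'" "odd n'"
    using multiplicity_decompose'[of n 2] assms(1) by auto
  then have n4: "n = 4 * n'" using assms(2) by simp
  then have "zeta (2 * n) ^ n' = zeta 8" using zeta_power_div[of 8 "2 * n"] assms(1) by simp
  then obtain c where c: "c \<in> cyclotomic n" "c \<noteq> 0" "zeta 8 = c * zeta (2 * n)"
    using zeta_double_odd_power[OF assms(1) n'(2)] by metis
  have sq: "(c * zeta (2 * n))\<^sup>2 = \<i>"
    unfolding c(3)[symmetric] using zeta_power_div[of 4 8] by simp
  have "\<i> \<in> cyclotomic n" using zeta_in_cyclotomic[of 4 n] assms(1) n4 by simp
  then have "1 - \<i> \<in> cyclotomic n" by (rule adjoin.diff_mem[OF adjoin.one_mem])
  then have d: "c * (1 - \<i>) \<in> cyclotomic n" using c(1) by (intro adjoin.mult_mem)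
  have "1 - \<i> \<noteq> 0" by (simp add: complex_eq_iff)
  then have d0: "c * (1 - \<i>) \<noteq> 0" using c(2) by simp
  show ?thesis
  proof (rule adjoin_pair_cong)
    show "1 / (c * (1 - \<i>)) \<in> cyclotomic n" using d by (intro adjoin.divide_mem adjoin.one_mem)
    show "1 / (c * (1 - \<i>)) \<noteq> 0" using d0 by simp
    have "(zeta (2 * n) * csqrt (of_rat q))\<^sup>2 =
        (c * zeta (2 * n))\<^sup>2 * (1 - \<i>)\<^sup>2 * of_rat q / (c * (1 - \<i>))\<^sup>2"
      using c(2) \<open>1 - \<i> \<noteq> 0\<close> by (simp add: power_mult_distrib)
    also have "(c * zeta (2 * n))\<^sup>2 * (1 - \<i>)\<^sup>2 = 2"
      unfolding sq by (simp add: power2_eq_square algebra_simps)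
    also have "2 * of_rat q / (c * (1 - \<i>))\<^sup>2 = (1 / (c * (1 - \<i>)) * csqrt (of_rat (2 * q)))\<^sup>2"
      unfolding power_mult_distrib[of "1 / _"] power_divide by (simp add: of_rat_mult)
    finally show "(zeta (2 * n) * csqrt (of_rat q))\<^sup>2 =
        (1 / (c * (1 - \<i>)) * csqrt (of_rat (2 * q)))\<^sup>2" .
  qed
qed

theorem theorem5:
  fixes g g0 :: rat and h f n :: nat
  assumes "g \<notin> {-1, 0, 1}"
    and "g0 > 0"
    and "\<not> (\<exists>r :: rat. \<exists>k :: nat. k \<ge> 2 \<and> g0 = r ^ k)"
    and "h \<ge> 1"
    and "g = g0 ^ h \<or> g = - (g0 ^ h)"
    and "f \<ge> 1" and "n \<ge> 1"
  shows "adjoin {zeta f} \<inter> kummer_field g n =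
    (if exceptional g g0 h f n
     then adjoin {zeta (gcd f n), zeta (2 * gcd f n) * csqrt (of_int (gam_g g g0 h f n))}
     else adjoin {zeta (gcd f n), csqrt (of_int (gam_g g g0 h f n))})"
proof -
  have pos: "f > 0" "n > 0" "h > 0" using assms(4,6,7) by auto
  define R where "R = real_of_rat g0 ^ h"
  have R: "R > 0" using assms(2) by (simp add: R_def)
  define r where "r = root n R"
  have r: "r > 0" "r ^ n = real_of_rat g0 ^ h"
    using R pos(2) by (simp_all add: r_def R_def real_root_gt_zero real_root_pow_pos)
  have g0h: "of_rat (g0 ^ h) = complex_of_real R" by (simp add: R_def of_rat_power of_real_of_rat)
  define k where "k = n div gcd n (2 * h)"
  define c where "c = (2 * h) div gcd n (2 * h)"
  note parity = nu2_gcd_cofactors[OF pos(2,3), folded k_def c_def]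
  have g0: "g0 \<noteq> 0" using assms(2) by simp
  \<comment> \<open>Used with \<open>\<eta>\<close> equal to 1 for positive \<open>g\<close> and to
    \<open>zeta (2 * n)\<close> for negative \<open>g\<close>.\<close>
  have reduce: "cyclotomic f \<inter> adjoin {zeta n, \<eta> * of_real r} =
      cyclotomic f \<inter> adjoin {zeta n, \<eta> ^ k * (if even c then 1 else csqrt (of_rat g0))}"
    if "\<eta> \<in> cyclotomic (2 * n)" "\<eta> ^ n \<in> \<rat>" "\<eta> \<noteq> 0" for \<eta>
    using cyclotomic_Int_radical[OF pos(1,2) assms(2,3) r that k_def]
      adjoin_radical_power[OF pos(2) assms(2) r, of \<eta>] by (simp add: k_def c_def)
  have even_n: "nu2 n \<ge> 1 \<longleftrightarrow> even n" using nu2_eq_0_iff[of n] pos(2) by auto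
  show ?thesis
  proof (cases "g > 0")
    case True
    have "g = g0 ^ h"
      using assms(2,5) True by (metis less_asym neg_0_less_iff_less zero_less_power)
    then have kummer: "kummer_field g n = adjoin {zeta n, 1 * of_real r}"
      using principal_root(1)[OF R pos(2)] by (simp add: kummer_field_def g0h r_def)
    have L: "cyclotomic f \<inter> kummer_field g n =
        cyclotomic f \<inter> adjoin {zeta n, if even c then 1 else csqrt (of_rat g0)}"
      unfolding kummer using reduce[of 1] by simp
    show ?thesis
    proof (cases "nu2 n \<le> nu2 h")
      case le: True
      then have "gcase g g0 h n = 1" using True by (simp add: gcase_def)
      then show ?thesis using L parity(1)[OF le] cyclotomic_Int[OF pos(1,2)]
        by (simp add: exceptional_def gam_g_def adjoin_pair_mem)
    next
      case False
      then have "gcase g g0 h n = 2" using True by (simp add: gcase_def)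
      moreover have "odd c" using parity(2) False by simp
      ultimately show ?thesis using L cyclotomic_Int_adjoin_csqrt[OF g0 pos(1,2)]
        by (simp add: exceptional_def gam_g_def)
    qed
  next
    case False
    then have neg: "g < 0" using assms(1) by auto
    have "g = - (g0 ^ h)"
      using assms(2,5) False by auto
    then have kummer: "kummer_field g n = adjoin {zeta n, zeta (2 * n) * of_real r}"
      using principal_root(2)[OF R pos(2)] by (simp add: kummer_field_def of_rat_minus g0h r_def)
    have L: "cyclotomic f \<inter> kummer_field g n =
        cyclotomic f \<inter> adjoin {zeta n, zeta (2 * n) ^ k * (if even c then 1 else csqrt (of_rat g0))}"
      unfolding kummer using zeta_double_power[OF pos(2)] by (intro reduce) (auto intro: in_adjoin)
    \<comment> \<open>By \<open>parity\<close> the surviving radicals are, in this order,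
      \<open>zeta (2 * n)\<close>, \<surd>g0 and their product.\<close>
    consider "nu2 n \<le> nu2 h" | "nu2 n \<ge> nu2 h + 2" | "nu2 n = nu2 h + 1" by linarith
    then show ?thesis
    proof cases
      case 1
      then have case6: "gcase g g0 h n = 6" using neg by (simp add: gcase_def)
      have "cyclotomic f \<inter> kummer_field g n = cyclotomic f \<inter> adjoin {zeta n, zeta (2 * n)}"
        using L parity(1)[OF 1] adjoin_zeta_double_odd_power[OF pos(2), of k 1] by simp
      then show ?thesis
        using cyclotomic_Int_adjoin_zeta_double[OF pos(1,2)] case6 even_n
        by (auto simp: exceptional_def gam_g_def adjoin_pair_mem)
    next
      case 2
      then have case3: "gcase g g0 h n = 3" using neg by (simp add: gcase_def)
      have "odd c" "even k" using parity(2) 2 by auto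
      then have "cyclotomic f \<inter> kummer_field g n = cyclotomic f \<inter> adjoin {zeta n, csqrt (of_rat g0)}"
        using L adjoin_zeta_double_even_power[OF pos(2)] by simp
      then show ?thesis
        using cyclotomic_Int_adjoin_csqrt[OF g0 pos(1,2)] case3
        by (simp add: exceptional_def gam_g_def)
    next
      case 3
      then have "odd c" "odd k" using parity(2) by auto
      then have L': "cyclotomic f \<inter> kummer_field g n =
          cyclotomic f \<inter> adjoin {zeta n, zeta (2 * n) * csqrt (of_rat g0)}"
        using L adjoin_zeta_double_odd_power[OF pos(2)] by simp
      \<comment> \<open>The first two alternatives rewrite the product as \<surd>(-g0) and \<surd>(2
        * g0); the third keeps it, under the assumptions of
        \<open>cyclotomic_Int_adjoin_zeta_double_csqrt\<close>.\<close>
      consider "nu2 h = 0" | "nu2 h = 1" "8 dvd quad_disc g0" |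
          "nu2 n \<ge> 2" "nu2 n = 2 \<longrightarrow> \<not> 8 dvd quad_disc g0"
        using 3 by linarith
      then show ?thesis
      proof cases
        case h: 1
        then have "gcase g g0 h n = 4" using 3 neg by (simp add: gcase_def)
        moreover have "adjoin {zeta n, zeta (2 * n) * csqrt (of_rat g0)} = adjoin {zeta n, csqrt (of_rat (- g0))}"
          using 3 h by (intro adjoin_zeta_double_csqrt_neg[OF pos(2)]) simp
        ultimately show ?thesis
          using L' cyclotomic_Int_adjoin_csqrt[of "- g0", OF _ pos(1,2)] g0
          by (simp add: exceptional_def gam_g_def)
      next
        case h: 2
        then have "gcase g g0 h n = 5" using 3 neg by (simp add: gcase_def)
        moreover have "adjoin {zeta n, zeta (2 * n) * csqrt (of_rat g0)} = adjoin {zeta n, csqrt (of_rat (2 * g0))}"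
          using 3 h by (intro adjoin_zeta_double_csqrt_double[OF pos(2)]) simp
        ultimately show ?thesis
          using L' cyclotomic_Int_adjoin_csqrt[of "2 * g0", OF _ pos(1,2)] g0
          by (simp add: exceptional_def gam_g_def)
      next
        case h: 3
        then have case7: "gcase g g0 h n = 7" using 3 neg by (auto simp: gcase_def)
        \<comment> \<open>In case 7 one condition decides both whether the case is exceptional and
          whether \<open>gam1\<close> takes the value of \<open>gam\<close>.\<close>
        define E where "E \<longleftrightarrow> nu2 f > nu2 n \<and> quad_disc g0 dvd int (lcm f n)"
        have exc: "exceptional g g0 h f n \<longleftrightarrow> E"
          using case7 h(1) by (auto simp: exceptional_def E_def)
        have gam: "gam_g g g0 h f n = (if E then gam f (quad_disc g0) else 1)"
          by (simp add: case7 gam_g_def gam1_def E_def)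
        have "cyclotomic f \<inter> kummer_field g n =
            (if E then adjoin {zeta (gcd f n), zeta (2 * gcd f n) * csqrt (of_int (gam f (quad_disc g0)))}
             else cyclotomic (gcd f n))"
          unfolding L' E_def
          by (rule cyclotomic_Int_adjoin_zeta_double_csqrt[OF pos(1,2) g0 h(1)]) (use h(2) in blast)
        then show ?thesis unfolding exc gam by (cases E) (simp_all add: adjoin_pair_mem)
      qed
    qed
  qed
qed

end
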